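(* Let $n\ge 2$, let $\Omega\subset\mathbb{R}^n$ be a domain and let $f:\Omega\to\mathbb{R}^n$ be a locally finite piecewise affine homeomorphism (onto its image). Let $X(\Omega)$ be a rearrangement invariant function space whose characteristic function $\phi_X$ satisfies $\phi_X(t)\to 0$ as $t\to 0$. Then for every $\epsilon>0$ there exists an injective map $\tilde f\in\mathcal{C}^1(\Omega,\mathbb{R}^n)$ such that $$\|\tilde f-f\|_{L^\infty(\Omega)}<\epsilon \quad\text{and}\quad \|D\tilde f-Df\|_{X(\Omega)}<\epsilon .$$
   Context: An $n$-simplex is the convex hull of $n+1$ points $A_1,\dots,A_{n+1}\in\mathbb{R}^n$ such that $A_2-A_1,\dots,A_{n+1}-A_1$ are linearly independent. A simplicial complex of $\Omega\subset\mathbb{R}^n$ is a countable (possibly finite) set $\mathcal{T}=\{T_1,T_2,\dots\}$ of $n$-simplices with pairwise disjoint interiors such that $\Omega=\bigcup_i T_i$. It is locally finite if for every $x\in\Omega$ there is $r>0$ such that only finitely many $T_i$ intersect $B(x,r)$. A map $f$ on $\Omega$ is piecewise affine if there is a simplicial complex $\mathcal{T}$ of $\Omega$ such that on each $T_i\in\mathcal{T}$ the map $f$ equals some affine map $L_i(x)=M_ix+c_i$. A locally finite piecewise affine homeomorphism is a homeomorphism which is piecewise affine with respect to a locally finite $\mathcal{T}$. The derivative $Df$ is defined almost everywhere (in the interiors of the simplices). Rearrangement invariant function spaces are understood in the standard sense of rearrangement invariant Banach function spaces (with respect to Lebesgue measure $\mathcal{L}^n$ on $\Omega$). The characteristic function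 of $X$ is $\phi_X(t)=\|\chi_A\|_X$ for any measurable $A\subset\Omega$ with $\mathcal{L}^n(A)=t$ (independent of the choice of $A$). For matrix-valued $M$, $\|M\|_{X(\Omega)}$ is the $X(\Omega)$-norm of $|M|$. *)

theory Defs
  imports "HOL-Probability.Essential_Supremum"
begin

section \<open>Locally finite piecewise affine homeomorphisms\<close>

text \<open>Unlike a simplicial complex in the combinatorial sense, the simplices are not required to
  meet along common faces.\<close>

definition simplicial_complex_of :: "(real^'n) set set \<Rightarrow> (real^'n) set \<Rightarrow> bool" where
  "simplicial_complex_of \<T> \<Omega> \<longleftrightarrow>
     countable \<T> \<and>
     (\<forall>T\<in>\<T>. int CARD('n) simplex T) \<and>
     disjoint_family_on interior \<T> \<and>
     \<Omega> = \<Union>\<T>"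

definition locally_finite_complex :: "(real^'n) set set \<Rightarrow> (real^'n) set \<Rightarrow> bool" where
  "locally_finite_complex \<T> \<Omega> \<longleftrightarrow> (\<forall>x\<in>\<Omega>. \<exists>r>0. finite {T\<in>\<T>. T \<inter> ball x r \<noteq> {}})"

definition piecewise_affine_wrt ::
  "(real^'n) set set \<Rightarrow> (real^'n \<Rightarrow> real^'n) \<Rightarrow> bool" where
  "piecewise_affine_wrt \<T> f \<longleftrightarrow> (\<forall>T\<in>\<T>. \<exists>M c. \<forall>x\<in>T. f x = M *v x + c)"

definition locally_finite_pa_homeomorphism ::
  "(real^'n) set \<Rightarrow> (real^'n \<Rightarrow> real^'n) \<Rightarrow> bool" where
  "locally_finite_pa_homeomorphism \<Omega> f \<longleftrightarrow>
     (\<exists>g. homeomorphism \<Omega> (f ` \<Omega>) f g) \<and>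
     (\<exists>\<T>. simplicial_complex_of \<T> \<Omega> \<and> locally_finite_complex \<T> \<Omega> \<and> piecewise_affine_wrt \<T> f)"

section \<open>Rearrangement invariant Banach function spaces\<close>

text \<open>As in Bennett and Sharpley, a Banach function space over \<open>M\<close> is given by a Banach function
  norm \<open>\<rho>\<close> on the nonnegative extended-valued measurable functions: the space consists of the
  measurable \<open>u\<close> with \<open>\<rho> \<bar>u\<bar> < \<infinity>\<close>, normed by \<open>\<rho> \<bar>u\<bar>\<close>. Values of \<open>\<rho>\<close> on nonmeasurable functions
  are irrelevant.\<close>

locale banach_function_norm =
  fixes M :: "'a measure" and \<rho> :: "('a \<Rightarrow> ennreal) \<Rightarrow> ennreal"
  assumes norm_eq_0_iff:
      "u \<in> borel_measurable M \<Longrightarrow> \<rho> u = 0 \<longleftrightarrow> (AE x in M. u x = 0)"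
    and norm_scale:
      "\<lbrakk>u \<in> borel_measurable M; 0 \<le> a\<rbrakk> \<Longrightarrow> \<rho> (\<lambda>x. ennreal a * u x) = ennreal a * \<rho> u"
    and norm_triangle:
      "\<lbrakk>u \<in> borel_measurable M; v \<in> borel_measurable M\<rbrakk> \<Longrightarrow> \<rho> (\<lambda>x. u x + v x) \<le> \<rho> u + \<rho> v"
    and norm_mono:
      "\<lbrakk>u \<in> borel_measurable M; v \<in> borel_measurable M; AE x in M. u x \<le> v x\<rbrakk> \<Longrightarrow> \<rho> u \<le> \<rho> v"
    and norm_Fatou:
      "\<lbrakk>\<And>k. U k \<in> borel_measurable M; u \<in> borel_measurable M;
        AE x in M. incseq (\<lambda>k. U k x) \<and> u x = (SUP k. U k x)\<rbrakk> \<Longrightarrow> \<rho> u = (SUP k. \<rho> (U k))"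
    and norm_indicator_finite:
      "\<lbrakk>E \<in> sets M; emeasure M E < \<infinity>\<rbrakk> \<Longrightarrow> \<rho> (indicator E) < \<infinity>"
    and norm_local_L1:
      "\<lbrakk>E \<in> sets M; emeasure M E < \<infinity>\<rbrakk> \<Longrightarrow>
        \<exists>C>0. \<forall>u\<in>borel_measurable M. (\<integral>\<^sup>+x\<in>E. u x \<partial>M) \<le> ennreal C * \<rho> u"

definition equimeasurable :: "'a measure \<Rightarrow> ('a \<Rightarrow> ennreal) \<Rightarrow> ('a \<Rightarrow> ennreal) \<Rightarrow> bool" where
  "equimeasurable M u v \<longleftrightarrow>
     (\<forall>t\<ge>0. emeasure M {x\<in>space M. ennreal t < u x} = emeasure M {x\<in>space M. ennreal t < v x})"

locale ri_banach_function_norm = banach_function_norm +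
  assumes norm_rearrangement:
    "\<lbrakk>u \<in> borel_measurable M; v \<in> borel_measurable M; AE x in M. u x < \<infinity>; AE x in M. v x < \<infinity>;
      equimeasurable M u v\<rbrakk> \<Longrightarrow> \<rho> u = \<rho> v"

text \<open>The choice of \<open>A\<close> is immaterial for an r.i. norm, see \<open>characteristic_fun_eq\<close> below. The
  value is meaningful for those \<open>t \<ge> 0\<close> which are the measure of some set; over a nonempty open
  subset of Euclidean space this includes all sufficiently small \<open>t\<close>.\<close>

definition characteristic_fun ::
  "'a measure \<Rightarrow> (('a \<Rightarrow> ennreal) \<Rightarrow> ennreal) \<Rightarrow> real \<Rightarrow> ennreal" where
  "characteristic_fun M \<rho> t = \<rho> (indicator (SOME A. A \<in> sets M \<and> emeasure M A = ennreal t))"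

lemma (in ri_banach_function_norm) characteristic_fun_eq:
  assumes A: "A \<in> sets M" "emeasure M A = ennreal t"
  shows "characteristic_fun M \<rho> t = \<rho> (indicator A)"
proof -
  define B where "B = (SOME A. A \<in> sets M \<and> emeasure M A = ennreal t)"
  have B: "B \<in> sets M" "emeasure M B = ennreal t"
    using someI[of "\<lambda>A. A \<in> sets M \<and> emeasure M A = ennreal t" A] A by (auto simp: B_def)
  have level: "{x \<in> space M. ennreal s < indicator E x} = (if s < 1 then E else {})"
    if "E \<in> sets M" "0 \<le> s" for E s
    using sets.sets_into_space[OF that(1)] that(2)
    by (auto simp: indicator_def ennreal_less_one_iff not_less split: if_splits)
  have "equimeasurable M (indicator B) (indicator A)"
    unfolding equimeasurable_def using A B by (auto simp: level)
  then have "\<rho> (indicator B) = \<rho> (indicator A)"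
    using A B by (intro norm_rearrangement) (auto simp: indicator_def)
  then show ?thesis
    by (simp add: characteristic_fun_def B_def)
qed

definition function_space_norm ::
  "(('a \<Rightarrow> ennreal) \<Rightarrow> ennreal) \<Rightarrow> ('a \<Rightarrow> 'b::real_normed_vector) \<Rightarrow> ennreal" where
  "function_space_norm \<rho> F = \<rho> (\<lambda>x. ennreal (norm (F x)))"

section \<open>Further notation\<close>

definition Linfty_norm :: "'a measure \<Rightarrow> ('a \<Rightarrow> 'b::real_normed_vector) \<Rightarrow> ennreal" where
  "Linfty_norm M F = esssup M (\<lambda>x. ennreal (norm (F x)))"

text \<open>The Jacobian matrix; at points where \<open>f\<close> is not differentiable (a null set for a piecewise
  affine map) it is an unspecified constant.\<close>

abbreviation Jac :: "(real^'n \<Rightarrow> real^'n) \<Rightarrow> real^'n \<Rightarrow> real^'n^'n" where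
  "Jac f x \<equiv> jacobian f (at x)"

definition C1_on :: "(real^'n) set \<Rightarrow> (real^'n \<Rightarrow> real^'n) \<Rightarrow> bool" where
  "C1_on \<Omega> f \<longleftrightarrow> (\<forall>x\<in>\<Omega>. f differentiable (at x)) \<and> continuous_on \<Omega> (Jac f)"

end

theory Submission
  imports Defs
begin

text \<open>
  The approximation is \<open>g = f \<circ> h\<close> with \<open>h\<close> a \<open>C\<^sup>1\<close> homeomorphism of \<open>\<Omega>\<close>, close to the identity, whose
  derivative at \<open>x\<close> has range in the directions parallel to all facets through \<open>h x\<close>. In these
  directions the affine pieces of \<open>f\<close> meeting at \<open>h x\<close> agree, so \<open>g\<close> is \<open>C\<^sup>1\<close>. It is
  injective, though not a diffeomorphism: its rank drops on the preimages of the facets.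

  The map \<open>h\<close> is the inverse of \<open>G z = z + (\<Sum>j. v\<^sub>j z *\<^sub>R a\<^sub>j)\<close>, where \<open>a\<^sub>j\<close> is a normal of the facet \<open>F\<^sub>j\<close>.
  The function \<open>v\<^sub>j\<close> is supported near \<open>F\<^sub>j\<close>, is \<open>C\<^sup>1\<close> off \<open>F\<^sub>j\<close>, and has infinite slope exactly in direction
  \<open>a\<^sub>j\<close> at \<open>F\<^sub>j\<close>; as it is increasing in that direction up to a Lipschitz error, \<open>G\<close> is strongly
  monotone. Since \<open>h = id\<close> outside the supports and \<open>D h\<close> is bounded, \<open>D g - D f\<close> is bounded by a
  constant \<open>k\<^sub>j\<close> on the \<open>j\<close>-th support and vanishes elsewhere; the supports can be taken so small
  that \<open>\<Sum>j. k\<^sub>j \<phi>\<^sub>X(\<bar>supp v\<^sub>j\<bar>) < \<epsilon>\<close>.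
\<close>

section \<open>Strict derivatives\<close>

text \<open>Averaging \<open>f\<close> gives no control of injectivity where many pieces meet, all
  the more so if neighbouring simplices do not share whole faces. Precomposition with an injective
  map keeps injectivity for free, and the conclusion tolerates a derivative of lower rank.
  Collapsing normals forces \<open>h\<close> to have a non-differentiable inverse, so
  \<open>G\<close> is built first and \<open>h\<close> is read off from it. In \<open>G\<close> the
  contributions of different facets are simply added, and their one-sided bounds add up as well; for
  \<open>h\<close> they would interact through composition. Where several facets meet, the range of
  the derivative of \<open>h\<close> becomes orthogonal to all active normals at once. On the
  supports no closeness of the two derivatives is attempted: strong monotonicity with constant 1/2
  makes \<open>h\<close> 2-Lipschitz, so both derivatives are bounded by local constants of
  \<open>f\<close>. These constants are fixed before the supports are shrunk, which is what lets the
  decay of the characteristic function pay for them.\<close>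

text \<open>A function with a strict derivative at every point of an open set is \<open>C\<^sup>1\<close> there, so continuity of
  the derivative needs no separate argument.\<close>

definition has_strict_derivative ::
  "('a::real_normed_vector \<Rightarrow> 'b::real_normed_vector) \<Rightarrow> ('a \<Rightarrow> 'b) \<Rightarrow> 'a \<Rightarrow> bool" where
  "has_strict_derivative f D x \<longleftrightarrow> bounded_linear D \<and>
     (\<exists>\<omega>. (\<omega> \<longlongrightarrow> 0) (nhds (x, x)) \<and>
        (\<forall>y z. norm (f y - f z - D (y - z)) \<le> \<omega> (y, z) * norm (y - z)))"

lemma has_strict_derivative_I:
  assumes "bounded_linear D"
    and "\<And>e. e > 0 \<Longrightarrow> \<forall>\<^sub>F p in nhds (x, x).
      norm (f (fst p) - f (snd p) - D (fst p - snd p)) \<le> e * norm (fst p - snd p)"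
  shows "has_strict_derivative f D x"
proof -
  \<comment> \<open>On the diagonal the quotient is 0 / 0 = 0, so the choice also covers equal
    arguments.\<close>
  define \<omega> where "\<omega> p = norm (f (fst p) - f (snd p) - D (fst p - snd p)) / norm (fst p - snd p)" for p
  have "(\<omega> \<longlongrightarrow> 0) (nhds (x, x))"
  proof (rule tendstoI)
    fix e :: real assume "e > 0"
    then have "e / 2 > 0" by simp
    from assms(2)[OF this] show "\<forall>\<^sub>F p in nhds (x, x). dist (\<omega> p) 0 < e"
    proof eventually_elim
      case (elim p)
      have "\<omega> p \<le> e / 2" using elim \<open>e > 0\<close>
        by (cases "fst p = snd p") (auto simp: \<omega>_def divide_simps)
      moreover have "0 \<le> \<omega> p" by (simp add: \<omega>_def)
      ultimately show ?case using \<open>e > 0\<close> by simp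
    qed
  qed
  moreover have "norm (f y - f z - D (y - z)) \<le> \<omega> (y, z) * norm (y - z)" for y z
    using assms(1) by (cases "y = z") (auto simp: \<omega>_def linear_simps)
  ultimately show ?thesis using assms(1) unfolding has_strict_derivative_def by blast
qed

lemma has_strict_derivative_eventually:
  assumes "has_strict_derivative f D x" "e > 0"
  shows "\<forall>\<^sub>F p in nhds (x, x).
      norm (f (fst p) - f (snd p) - D (fst p - snd p)) \<le> e * norm (fst p - snd p)"
proof -
  from assms(1) obtain \<omega> where \<omega>: "(\<omega> \<longlongrightarrow> 0) (nhds (x, x))"
    "\<And>y z. norm (f y - f z - D (y - z)) \<le> \<omega> (y, z) * norm (y - z)"
    unfolding has_strict_derivative_def by blast
  from order_tendstoD(2)[OF \<omega>(1) assms(2)] show ?thesis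
  proof eventually_elim
    case (elim p)
    then have "\<omega> p * norm (fst p - snd p) \<le> e * norm (fst p - snd p)"
      by (intro mult_right_mono) auto
    then show ?case using \<omega>(2)[of "fst p" "snd p"] by simp
  qed
qed

lemma has_strict_derivative_bounded_linear:
  "has_strict_derivative f D x \<Longrightarrow> bounded_linear D"
  by (simp add: has_strict_derivative_def)

lemma eventually_nhds_pair_left:
  "\<forall>\<^sub>F p in nhds (x, x). P p \<Longrightarrow> \<forall>\<^sub>F y in nhds x. P (y, x)"
  by (auto simp: nhds_prod eventually_prod_filter elim!: eventually_mono dest: eventually_nhds_x_imp_x)

lemma has_strict_derivative_imp_has_derivative:
  assumes "has_strict_derivative f D x"
  shows "(f has_derivative D) (at x)"
  unfolding has_derivative_at_alt
proof (intro conjI allI impI)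
  show "bounded_linear D" using assms by (rule has_strict_derivative_bounded_linear)
  fix e :: real assume "e > 0"
  from eventually_nhds_pair_left[OF has_strict_derivative_eventually[OF assms this]]
  show "\<exists>d>0. \<forall>y. norm (y - x) < d \<longrightarrow> norm (f y - f x - D (y - x)) \<le> e * norm (y - x)"
    by (auto simp: eventually_nhds_metric dist_norm)
qed

lemma has_strict_derivative_imp_isCont:
  "has_strict_derivative f D x \<Longrightarrow> isCont f x"
  using has_strict_derivative_imp_has_derivative has_derivative_continuous by blast

lemma tendsto_fst_nhds: "isCont f x \<Longrightarrow> ((\<lambda>p. f (fst p)) \<longlongrightarrow> f x) (nhds (x, y))"
  and tendsto_snd_nhds: "isCont f y \<Longrightarrow> ((\<lambda>p. f (snd p)) \<longlongrightarrow> f y) (nhds (x, y))"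
  for f :: "'a::t2_space \<Rightarrow> 'b::topological_space"
  unfolding nhds_prod isCont_def tendsto_at_iff_tendsto_nhds
  using filterlim_compose[OF _ filterlim_fst] filterlim_compose[OF _ filterlim_snd] by fast+

text \<open>Testing both estimates on \<open>y = x + t *\<^sub>R v\<close> and letting
  \<open>t\<close> decrease to 0 compares the two linear maps directly. With \<open>T = 0\<close>
  this gives the Lipschitz bound for \<open>D\<close>; with \<open>T\<close> the derivative at a
  nearby point it gives continuity of the derivative.\<close>

lemma has_strict_derivative_near_linear:
  assumes "has_strict_derivative f D x" "bounded_linear T"
    and "\<forall>\<^sub>F p in nhds (x, x).
      norm (f (fst p) - f (snd p) - T (fst p - snd p)) \<le> e * norm (fst p - snd p)"
  shows "norm (D v - T v) \<le> e * norm v"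
proof (rule field_le_epsilon)
  fix e' :: real assume "e' > 0"
  define e2 where "e2 = e' / (norm v + 1)"
  have e2: "e2 > 0" "e2 * norm v \<le> e'" using \<open>e' > 0\<close>
    by (auto simp: e2_def field_simps add_pos_nonneg)
  interpret D: bounded_linear D using assms(1) by (rule has_strict_derivative_bounded_linear)
  interpret T: bounded_linear T by fact
  from has_strict_derivative_eventually[OF assms(1) e2(1)] assms(3)
  have "\<forall>\<^sub>F p in nhds (x, x). norm (D (fst p - snd p) - T (fst p - snd p)) \<le> (e + e2) * norm (fst p - snd p)"
  proof eventually_elim
    case (elim p)
    have "D (fst p - snd p) - T (fst p - snd p) = (f (fst p) - f (snd p) - T (fst p - snd p))
        - (f (fst p) - f (snd p) - D (fst p - snd p))" by simp
    also have "norm \<dots> \<le> (e + e2) * norm (fst p - snd p)"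
      using elim by (intro order.trans[OF norm_triangle_ineq4]) (simp add: algebra_simps)
    finally show ?case .
  qed
  from eventually_nhds_pair_left[OF this]
  have ev: "\<forall>\<^sub>F y in nhds x. norm (D (y - x) - T (y - x)) \<le> (e + e2) * norm (y - x)" by simp
  have "((\<lambda>t. x + t *\<^sub>R v) \<longlongrightarrow> x) (at_right 0)"
    by (auto intro!: tendsto_eq_intros)
  from eventually_conj[OF eventually_compose_filterlim[OF ev this] eventually_at_right_less[of 0]]
  obtain t :: real where t: "t > 0" "norm (D (t *\<^sub>R v) - T (t *\<^sub>R v)) \<le> (e + e2) * norm (t *\<^sub>R v)"
    by (auto dest: eventually_happens'[rotated])
  then have "t * norm (D v - T v) \<le> t * ((e + e2) * norm v)"
    by (simp add: D.scaleR T.scaleR algebra_simps flip: scaleR_diff_right)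
  then have "norm (D v - T v) \<le> (e + e2) * norm v" using t(1) by simp
  then show "norm (D v - T v) \<le> e * norm v + e'" using e2(2) by (simp add: algebra_simps)
qed

lemma has_strict_derivative_Lipschitz_bound:
  assumes "has_strict_derivative f D x"
    and "\<And>y z. norm (f y - f z) \<le> L * norm (y - z)"
  shows "norm (D v) \<le> L * norm v"
  using has_strict_derivative_near_linear[OF assms(1), of "\<lambda>_. 0" L v] assms(2) by simp

text \<open>The strict estimate at \<open>x\<close> holds on a whole neighbourhood of
  \<open>(x, x)\<close>, hence also near \<open>(y, y)\<close> for every \<open>y\<close> close to
  \<open>x\<close>. There it says that \<open>f\<close> is nearly \<open>D x\<close>, so
  \<open>D y\<close> must be close to \<open>D x\<close>. An ordinary derivative would not permit
  this change of base point.\<close>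

lemma has_strict_derivative_continuous:
  fixes f :: "'a::real_normed_vector \<Rightarrow> 'b::real_normed_vector"
  assumes "open S" "\<And>x. x \<in> S \<Longrightarrow> has_strict_derivative f (D x) x"
  shows "continuous_on S (\<lambda>x. D x v)"
  unfolding continuous_on_eq_continuous_at[OF assms(1)]
proof
  fix x assume x: "x \<in> S"
  show "isCont (\<lambda>x. D x v) x"
    unfolding isCont_def
  proof (rule tendsto_at_iff_tendsto_nhds[THEN iffD2, OF tendstoI])
    fix e :: real assume "e > 0"
    define e2 where "e2 = e / (norm v + 1)"
    have e2: "e2 > 0" "e2 * norm v < e" using \<open>e > 0\<close>
      by (auto simp: e2_def field_simps add_pos_nonneg)
    have "\<forall>\<^sub>F q in nhds (x, x). \<forall>\<^sub>F p in nhds q.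
        norm (f (fst p) - f (snd p) - D x (fst p - snd p)) \<le> e2 * norm (fst p - snd p)"
      using has_strict_derivative_eventually[OF assms(2)[OF x] e2(1)] by (simp only: eventually_eventually)
    then have "\<forall>\<^sub>F y in nhds x. \<forall>\<^sub>F p in nhds (y, y).
        norm (f (fst p) - f (snd p) - D x (fst p - snd p)) \<le> e2 * norm (fst p - snd p)"
      by (rule eventually_compose_filterlim) (auto simp: nhds_prod intro!: filterlim_Pair filterlim_ident)
    moreover have "\<forall>\<^sub>F y in nhds x. y \<in> S" using assms(1) x by (rule eventually_nhds_in_open)
    ultimately show "\<forall>\<^sub>F y in nhds x. dist (D y v) (D x v) < e"
    proof eventually_elim
      case (elim y)
      have "norm (D y v - D x v) \<le> e2 * norm v"
        by (rule has_strict_derivative_near_linear[OF assms(2)[OF elim(2)]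
              has_strict_derivative_bounded_linear[OF assms(2)[OF x]] elim(1)])
      then show ?case using e2 by (simp add: dist_norm)
    qed
  qed
qed

lemma has_strict_derivative_mult:
  fixes f g :: "'a::real_normed_vector \<Rightarrow> real"
  assumes f: "has_strict_derivative f Df x" and g: "has_strict_derivative g Dg x"
  shows "has_strict_derivative (\<lambda>x. f x * g x) (\<lambda>v. f x * Dg v + g x * Df v) x"
proof -
  interpret Df: bounded_linear Df using f by (rule has_strict_derivative_bounded_linear)
  interpret Dg: bounded_linear Dg using g by (rule has_strict_derivative_bounded_linear)
  obtain \<omega> where \<omega>: "(\<omega> \<longlongrightarrow> 0) (nhds (x, x))"
    "\<And>y z. norm (f y - f z - Df (y - z)) \<le> \<omega> (y, z) * norm (y - z)"
    using f unfolding has_strict_derivative_def by blast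
  obtain \<psi> where \<psi>: "(\<psi> \<longlongrightarrow> 0) (nhds (x, x))"
    "\<And>y z. norm (g y - g z - Dg (y - z)) \<le> \<psi> (y, z) * norm (y - z)"
    using g unfolding has_strict_derivative_def by blast
  define K where "K p = \<bar>f (fst p)\<bar> * \<psi> p + \<bar>f (fst p) - f x\<bar> * onorm Dg
    + \<bar>g (snd p)\<bar> * \<omega> p + \<bar>g (snd p) - g x\<bar> * onorm Df" for p
  have "(K \<longlongrightarrow> 0) (nhds (x, x))"
    unfolding K_def
    using tendsto_fst_nhds[OF has_strict_derivative_imp_isCont[OF f], of x]
      tendsto_snd_nhds[OF has_strict_derivative_imp_isCont[OF g], of x] \<omega>(1) \<psi>(1)
    by (auto intro!: tendsto_eq_intros)
  moreover have "norm (f y * g y - f z * g z - (f x * Dg (y - z) + g x * Df (y - z)))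
      \<le> K (y, z) * norm (y - z)" for y z
  proof -
    have "f y * g y - f z * g z - (f x * Dg (y - z) + g x * Df (y - z))
      = f y * (g y - g z - Dg (y - z)) + (f y - f x) * Dg (y - z)
        + g z * (f y - f z - Df (y - z)) + (g z - g x) * Df (y - z)"
      by (simp add: algebra_simps)
    also have "norm \<dots> \<le> \<bar>f y\<bar> * (\<psi> (y, z) * norm (y - z)) + \<bar>f y - f x\<bar> * (onorm Dg * norm (y - z))
        + \<bar>g z\<bar> * (\<omega> (y, z) * norm (y - z)) + \<bar>g z - g x\<bar> * (onorm Df * norm (y - z))"
      using \<omega>(2)[of y z] \<psi>(2)[of y z] onorm[OF Df.bounded_linear_axioms, of "y - z"]
        onorm[OF Dg.bounded_linear_axioms, of "y - z"]
      unfolding real_norm_def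
      by (intro order.trans[OF abs_triangle_ineq] add_mono) (auto simp: abs_mult intro!: mult_left_mono)
    also have "\<dots> = K (y, z) * norm (y - z)" by (simp add: K_def algebra_simps)
    finally show ?thesis .
  qed
  moreover have "bounded_linear (\<lambda>v. f x * Dg v + g x * Df v)"
    by (intro bounded_linear_add bounded_linear_const_mult Df.bounded_linear_axioms Dg.bounded_linear_axioms)
  ultimately show ?thesis unfolding has_strict_derivative_def by blast
qed

lemma has_strict_derivative_add:
  assumes f: "has_strict_derivative f Df x" and g: "has_strict_derivative g Dg x"
  shows "has_strict_derivative (\<lambda>x. f x + g x) (\<lambda>v. Df v + Dg v) x"
proof (rule has_strict_derivative_I)
  show "bounded_linear (\<lambda>v. Df v + Dg v)"
    using f g by (intro bounded_linear_add) (auto dest: has_strict_derivative_bounded_linear)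
  fix e :: real assume "e > 0"
  then have "e / 2 > 0" by simp
  from has_strict_derivative_eventually[OF f this] has_strict_derivative_eventually[OF g this]
  show "\<forall>\<^sub>F p in nhds (x, x). norm (f (fst p) + g (fst p) - (f (snd p) + g (snd p))
       - (Df (fst p - snd p) + Dg (fst p - snd p))) \<le> e * norm (fst p - snd p)"
  proof eventually_elim
    case (elim p)
    have "f (fst p) + g (fst p) - (f (snd p) + g (snd p)) - (Df (fst p - snd p) + Dg (fst p - snd p))
      = (f (fst p) - f (snd p) - Df (fst p - snd p)) + (g (fst p) - g (snd p) - Dg (fst p - snd p))"
      by simp
    also have "norm \<dots> \<le> e * norm (fst p - snd p)"
      using elim by (intro order.trans[OF norm_triangle_ineq]) simp
    finally show ?case .
  qed
qed

lemma has_strict_derivative_const: "has_strict_derivative (\<lambda>_. c) (\<lambda>_. 0) x"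
  by (rule has_strict_derivative_I) auto

lemma has_strict_derivative_sum:
  "(\<And>i. i \<in> I \<Longrightarrow> has_strict_derivative (f i) (D i) x) \<Longrightarrow>
    has_strict_derivative (\<lambda>x. \<Sum>i\<in>I. f i x) (\<lambda>v. \<Sum>i\<in>I. D i v) x"
  by (induction I rule: infinite_finite_induct)
    (simp_all add: has_strict_derivative_const has_strict_derivative_add)

lemma has_strict_derivative_scaleR_right:
  assumes f: "has_strict_derivative f D x"
  shows "has_strict_derivative (\<lambda>x. f x *\<^sub>R a) (\<lambda>v. D v *\<^sub>R a) x"
proof (rule has_strict_derivative_I)
  show "bounded_linear (\<lambda>v. D v *\<^sub>R a)"
    using f by (intro bounded_linear_scaleR_const) (auto dest: has_strict_derivative_bounded_linear)
  fix e :: real assume "e > 0"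
  then have "e / (norm a + 1) > 0" by (simp add: add_nonneg_pos)
  from has_strict_derivative_eventually[OF f this]
  show "\<forall>\<^sub>F p in nhds (x, x). norm (f (fst p) *\<^sub>R a - f (snd p) *\<^sub>R a - D (fst p - snd p) *\<^sub>R a)
       \<le> e * norm (fst p - snd p)"
  proof eventually_elim
    case (elim p)
    have "norm (f (fst p) *\<^sub>R a - f (snd p) *\<^sub>R a - D (fst p - snd p) *\<^sub>R a)
      = norm (f (fst p) - f (snd p) - D (fst p - snd p)) * norm a"
      by (simp flip: scaleR_diff_left)
    also have "\<dots> \<le> (e / (norm a + 1) * norm (fst p - snd p)) * (norm a + 1)"
      using elim by (intro mult_mono) auto
    also have "\<dots> = e * norm (fst p - snd p)"
      by (simp add: add_nonneg_eq_0_iff)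
    finally show ?case .
  qed
qed

section \<open>Functions with infinite slope at a facet\<close>

text \<open>For \<open>u \<ge> 0\<close> the left-hand side is a strictly increasing bijection of
  the reals, so the description is unique. The value is the cube root of \<open>s\<close> for
  \<open>u = 0\<close> and has slope at most \<open>1 / u\<close> in \<open>s\<close> for
  \<open>u > 0\<close>.\<close>

definition cubic_root :: "real \<Rightarrow> real \<Rightarrow> real" where
  "cubic_root u s = (THE y. y ^ 3 + u * y = s)"

text \<open>Subtracting the equations and splitting off \<open>x - y\<close> from the difference of
  cubes isolates the increment of the root. Uniqueness, continuity, slope and differentiability of
  the root are all read off from this identity.\<close>

lemma cubic_diff_factor:
  fixes x y u w :: real
  assumes "x ^ 3 + u * x = s" "y ^ 3 + w * y = t"
  shows "(x\<^sup>2 + x * y + y\<^sup>2 + u) * (x - y) = (s - t) - (u - w) * y"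
proof -
  have "(x\<^sup>2 + x * y + y\<^sup>2 + u) * (x - y) = (x ^ 3 + u * x) - (y ^ 3 + w * y) - (u - w) * y"
    by algebra
  then show ?thesis by (simp only: assms)
qed

text \<open>The differences of the two sides are \<open>3 * (x + y)\<^sup>2\<close> and
  \<open>(2 * x + y)\<^sup>2\<close>.\<close>

lemma sum_squares_cross_ge:
  fixes x y :: real
  shows "(x - y)\<^sup>2 \<le> 4 * (x\<^sup>2 + x * y + y\<^sup>2)"
    "3 * y\<^sup>2 \<le> 4 * (x\<^sup>2 + x * y + y\<^sup>2)"
    "0 \<le> x\<^sup>2 + x * y + y\<^sup>2"
proof -
  have *: "0 \<le> (x + y)\<^sup>2" "0 \<le> (2 * x + y)\<^sup>2" by simp_all
  then show "(x - y)\<^sup>2 \<le> 4 * (x\<^sup>2 + x * y + y\<^sup>2)"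
    "3 * y\<^sup>2 \<le> 4 * (x\<^sup>2 + x * y + y\<^sup>2)"
    by (simp_all add: power2_eq_square algebra_simps)
  then show "0 \<le> x\<^sup>2 + x * y + y\<^sup>2" using zero_le_power2[of y] by argo
qed

lemma cubic_root_bound:
  fixes y u s :: real
  assumes "y ^ 3 + u * y = s" "u \<ge> 0"
  shows "\<bar>y\<bar> \<le> 1 + \<bar>s\<bar>"
proof (rule ccontr)
  assume "\<not> ?thesis"
  then have y: "\<bar>y\<bar> > 1 + \<bar>s\<bar>" by simp
  then have "1 * 1 \<le> \<bar>y\<bar> * \<bar>y\<bar>" by (intro mult_mono) auto
  then have "1 \<le> y\<^sup>2 + u" using assms(2) by (simp add: power2_eq_square)
  then have "\<bar>y\<bar> * 1 \<le> \<bar>y\<bar> * \<bar>y\<^sup>2 + u\<bar>" by (intro mult_left_mono) auto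
  also have "\<dots> = \<bar>s\<bar>"
    unfolding abs_mult[symmetric] assms(1)[symmetric]
    by (simp add: algebra_simps power2_eq_square power3_eq_cube)
  finally show False using y by simp
qed

lemma cubic_root:
  assumes u: "u \<ge> 0"
  shows "cubic_root u s ^ 3 + u * cubic_root u s = s"
proof -
  let ?p = "\<lambda>y::real. y ^ 3 + u * y"
  define c where "c = 1 + \<bar>s\<bar>"
  have c: "c \<ge> 1" by (simp add: c_def)
  have big: "c \<le> ?p c"
  proof -
    have "c * 1 \<le> c * (c\<^sup>2 + u)" using c u
      by (intro mult_left_mono) (auto simp: power2_eq_square intro: add_increasing2 mult_ge1_I)
    then show ?thesis by (simp add: algebra_simps power2_eq_square power3_eq_cube)
  qed
  have "\<exists>y\<ge>-c. y \<le> c \<and> ?p y = s"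
  proof (intro IVT')
    have "?p (- c) = - ?p c" by simp
    moreover have "\<bar>s\<bar> \<le> ?p c" using big by (simp add: c_def)
    ultimately show "?p (- c) \<le> s" "s \<le> ?p c" by linarith+
  qed (use c in \<open>auto intro!: continuous_intros\<close>)
  then obtain y where y: "?p y = s" by blast
  have "z = y" if "?p z = s" for z
  proof (rule ccontr)
    assume "z \<noteq> y"
    from cubic_diff_factor[OF that y] have "(z\<^sup>2 + z * y + y\<^sup>2 + u) * (z - y) = 0" by simp
    with \<open>z \<noteq> y\<close> have "z\<^sup>2 + z * y + y\<^sup>2 + u = 0" by simp
    then have "(z - y)\<^sup>2 \<le> 0" using sum_squares_cross_ge(1)[of z y] u by argo
    with \<open>z \<noteq> y\<close> show False by simp
  qed
  with y have "\<exists>!y. ?p y = s" by blast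
  from theI'[OF this] show ?thesis by (simp add: cubic_root_def)
qed

text \<open>With \<open>q\<close> the factor from \<open>cubic_diff_factor\<close>, take
  \<open>A = 1 / q\<close>. The error is then at most
  \<open>4 * m ^ 3 * \<delta> * \<bar>y\<bar> / q\<close>, and
  \<open>\<bar>y\<bar> * m\<^sup>2 \<le> q\<close> by the arithmetic-geometric mean inequality. For
  a coefficient \<open>m ^ p\<close> the same computation leaves a power \<open>p/2 - 1\<close> of
  \<open>m\<close>; it tends to 0 with \<open>m\<close> only for \<open>p > 2\<close>, and
  \<open>p = 4\<close> moreover is a polynomial in the squared distance used later.\<close>

lemma cubic_diff_estimate_ordered:
  fixes x y m n :: real
  assumes eq: "x ^ 3 + m ^ 4 * x = s" "y ^ 3 + n ^ 4 * y = t"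
    and mn: "0 \<le> n" "n \<le> m" "m - n \<le> \<delta>"
    and N: "N * (x\<^sup>2 + x * y + y\<^sup>2 + m ^ 4) \<le> 1"
  shows "\<exists>A\<ge>N. A \<ge> 0 \<and> \<bar>x - y - A * (s - t)\<bar> \<le> 4 * m * \<delta>"
proof -
  define q where "q = x\<^sup>2 + x * y + y\<^sup>2 + m ^ 4"
  have m4: "0 \<le> m ^ 4" by simp
  have xy: "0 \<le> x\<^sup>2 + x * y + y\<^sup>2"
    by (rule sum_squares_cross_ge(3))
  then have q0: "0 \<le> q" using m4 by (simp add: q_def)
  have q1: "3 * y\<^sup>2 + 4 * m ^ 4 \<le> 4 * q" using sum_squares_cross_ge(2)[of y x] by (simp add: q_def)
  have fac: "q * (x - y) = (s - t) - (m ^ 4 - n ^ 4) * y"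
    using cubic_diff_factor[OF eq] by (simp add: q_def)
  have m: "0 \<le> m" and d: "0 \<le> \<delta>" using mn by auto
  show ?thesis
  proof (cases "q = 0")
    case True
    then have z: "m ^ 4 = 0" "x\<^sup>2 + x * y + y\<^sup>2 = 0" using xy m4 unfolding q_def by argo+
    have "(x - y)\<^sup>2 \<le> 4 * 0" "3 * y\<^sup>2 \<le> 4 * 0"
      using sum_squares_cross_ge(1,2)[where x = x and y = y] unfolding z(2) .
    then have "x - y = 0" "y = 0" by auto
    \<comment> \<open>In this degenerate case both roots and the increment \<open>s - t\<close>
      vanish, so any large \<open>A\<close> is admissible.\<close>
    moreover from this have "s = t" using fac True z mn by auto
    ultimately show ?thesis using m d by (intro exI[of _ "max N 0"]) auto
  next
    case False
    with q0 have q: "q > 0" by simp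
    have "m ^ 4 - n ^ 4 = (m - n) * (m ^ 3 + m\<^sup>2 * n + m * n\<^sup>2 + n ^ 3)"
      by (simp add: algebra_simps power2_eq_square power3_eq_cube power4_eq_xxxx)
    also have "\<dots> \<le> \<delta> * (4 * m ^ 3)"
    proof (intro mult_mono)
      have "m\<^sup>2 * n \<le> m\<^sup>2 * m" "m * n\<^sup>2 \<le> m * m\<^sup>2" "n ^ 3 \<le> m ^ 3"
        using mn by (auto intro!: mult_left_mono power_mono)
      then show "m ^ 3 + m\<^sup>2 * n + m * n\<^sup>2 + n ^ 3 \<le> 4 * m ^ 3"
        by (simp add: power2_eq_square power3_eq_cube algebra_simps)
    qed (use mn in auto)
    finally have du: "m ^ 4 - n ^ 4 \<le> 4 * m ^ 3 * \<delta>" by (simp only: mult_ac)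
    have du0: "0 \<le> m ^ 4 - n ^ 4" using power_mono[OF mn(2) mn(1), of 4] by simp
    have amgm: "\<bar>y\<bar> * m\<^sup>2 \<le> q"
    proof -
      have "0 \<le> (\<bar>y\<bar> - m\<^sup>2)\<^sup>2" by simp
      then have "2 * (\<bar>y\<bar> * m\<^sup>2) \<le> y\<^sup>2 + m ^ 4"
        by (simp add: power2_diff power_mult[symmetric] algebra_simps)
      then show ?thesis using q1 zero_le_power2[of y] m4 mult_nonneg_nonneg[of "\<bar>y\<bar>" "m\<^sup>2"] by linarith
    qed
    have "q * \<bar>x - y - 1 / q * (s - t)\<bar> = \<bar>q * (x - y) - (s - t)\<bar>"
    proof -
      have "q * (x - y - 1 / q * (s - t)) = q * (x - y) - (s - t)" using q by (simp add: field_simps)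
      then show ?thesis using q by (metis abs_mult abs_of_pos)
    qed
    also have "\<dots> = (m ^ 4 - n ^ 4) * \<bar>y\<bar>" using fac du0 by (simp add: abs_mult)
    also have "\<dots> \<le> 4 * m ^ 3 * \<delta> * \<bar>y\<bar>" by (intro mult_right_mono du) auto
    also have "\<dots> = 4 * m * \<delta> * (\<bar>y\<bar> * m\<^sup>2)" by (simp add: power2_eq_square power3_eq_cube)
    also have "\<dots> \<le> 4 * m * \<delta> * q" using m d by (intro mult_left_mono amgm) auto
    finally have "\<bar>x - y - 1 / q * (s - t)\<bar> \<le> 4 * m * \<delta>" using q by (simp add: mult.commute)
    moreover have "N \<le> 1 / q" using N q unfolding q_def[symmetric] by (simp add: field_simps)
    ultimately show ?thesis using q by (intro exI[of _ "1 / q"]) auto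
  qed
qed

lemma cubic_diff_estimate:
  fixes x y m n :: real
  assumes eq: "x ^ 3 + m ^ 4 * x = s" "y ^ 3 + n ^ 4 * y = t"
    and mn: "0 \<le> m" "0 \<le> n" "\<bar>m - n\<bar> \<le> \<delta>"
    and N: "N * (x\<^sup>2 + x * y + y\<^sup>2 + (max m n) ^ 4) \<le> 1"
  shows "\<exists>A\<ge>N. A \<ge> 0 \<and> \<bar>x - y - A * (s - t)\<bar> \<le> 4 * max m n * \<delta>"
proof (cases "n \<le> m")
  case True
  with assms show ?thesis using cubic_diff_estimate_ordered[OF eq] by (simp add: max_absorb1)
next
  case False
  then obtain A where A: "A \<ge> N" "A \<ge> 0" "\<bar>y - x - A * (t - s)\<bar> \<le> 4 * n * \<delta>"
    using cubic_diff_estimate_ordered[OF eq(2) eq(1), of \<delta> N] mn N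
    by (auto simp: max_absorb2 algebra_simps)
  have "x - y - A * (s - t) = - (y - x - A * (t - s))" by (simp add: algebra_simps)
  then have "\<bar>x - y - A * (s - t)\<bar> \<le> 4 * n * \<delta>" using A(3) by (simp only: abs_minus_cancel)
  then show ?thesis using A False by (intro exI[of _ A]) (auto simp: max_absorb2)
qed

text \<open>The slope along \<open>a\<close> tends to infinity, whereas the transversal part of the increments is
  negligible.\<close>

definition singular_along :: "('a::real_inner \<Rightarrow> real) \<Rightarrow> 'a \<Rightarrow> 'a \<Rightarrow> bool" where
  "singular_along v a x \<longleftrightarrow> (\<exists>\<omega>. (\<omega> \<longlongrightarrow> 0) (nhds (x, x)) \<and>
     (\<forall>N. \<forall>\<^sub>F p in nhds (x, x). \<exists>A\<ge>N.
        \<bar>v (fst p) - v (snd p) - A * (a \<bullet> (fst p - snd p))\<bar> \<le> \<omega> p * norm (fst p - snd p)))"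

lemma singular_along_scale:
  assumes "singular_along v a x" "c > 0"
  shows "singular_along (\<lambda>z. c * v z) a x"
proof -
  obtain \<omega> where \<omega>: "(\<omega> \<longlongrightarrow> 0) (nhds (x, x))"
    "\<And>N. \<forall>\<^sub>F p in nhds (x, x). \<exists>A\<ge>N.
      \<bar>v (fst p) - v (snd p) - A * (a \<bullet> (fst p - snd p))\<bar> \<le> \<omega> p * norm (fst p - snd p)"
    using assms(1) unfolding singular_along_def by blast
  have "((\<lambda>p. c * \<omega> p) \<longlongrightarrow> 0) (nhds (x, x))" using \<omega>(1) by (auto intro!: tendsto_eq_intros)
  moreover have "\<forall>\<^sub>F p in nhds (x, x). \<exists>A\<ge>N. \<bar>c * v (fst p) - c * v (snd p) - A * (a \<bullet> (fst p - snd p))\<bar>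
      \<le> c * \<omega> p * norm (fst p - snd p)" for N
    using \<omega>(2)[of "N / c"]
  proof eventually_elim
    case (elim p)
    then obtain A where A: "A \<ge> N / c"
      "\<bar>v (fst p) - v (snd p) - A * (a \<bullet> (fst p - snd p))\<bar> \<le> \<omega> p * norm (fst p - snd p)" by blast
    have "c * v (fst p) - c * v (snd p) - (c * A) * (a \<bullet> (fst p - snd p))
        = c * (v (fst p) - v (snd p) - A * (a \<bullet> (fst p - snd p)))" by (simp add: algebra_simps)
    also have "\<bar>\<dots>\<bar> \<le> c * (\<omega> p * norm (fst p - snd p))"
      using A(2) assms(2) by (simp add: abs_mult)
    finally show ?case using A(1) assms(2)
      by (intro exI[of _ "c * A"]) (simp add: field_simps)
  qed
  ultimately show ?thesis unfolding singular_along_def by blast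
qed

text \<open>The closest point of \<open>z\<close> is a competitor for \<open>y\<close>, which bounds
  the increment from above by a linear term plus \<open>(norm (y - z))\<^sup>2\<close>; exchanging
  \<open>y\<close> and \<open>z\<close> bounds it from below. The two linear terms differ only
  through \<open>closest_point F\<close>, which is continuous because \<open>F\<close> is
  convex.\<close>

lemma dist_closest_point_strict_derivative:
  fixes F :: "'a::euclidean_space set"
  assumes F: "closed F" "convex F" "F \<noteq> {}"
  shows "has_strict_derivative (\<lambda>z. (dist z (closest_point F z))\<^sup>2) (\<lambda>v. 2 * ((x - closest_point F x) \<bullet> v)) x"
proof -
  let ?P = "closest_point F"
  have upper: "(dist y (?P y))\<^sup>2 - (dist z (?P z))\<^sup>2 \<le> 2 * ((z - ?P z) \<bullet> (y - z)) + (norm (y - z))\<^sup>2" for y z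
  proof -
    have "dist y (?P y) \<le> dist y (?P z)"
      using F by (intro closest_point_le closest_point_in_set)
    then have "(dist y (?P y))\<^sup>2 \<le> (norm ((z - ?P z) + (y - z)))\<^sup>2"
      by (simp add: dist_norm)
    also have "\<dots> = (dist z (?P z))\<^sup>2 + 2 * ((z - ?P z) \<bullet> (y - z)) + (norm (y - z))\<^sup>2"
      unfolding dist_norm power2_norm_eq_inner by (simp add: algebra_simps inner_commute)
    finally show ?thesis by simp
  qed
  define \<omega> where "\<omega> p = norm (fst p - snd p) + 2 * norm (snd p - ?P (snd p) - (x - ?P x))
    + 2 * norm (fst p - ?P (fst p) - (x - ?P x))" for p
  have cont: "isCont (\<lambda>y. y - ?P y) x"
    by (intro continuous_intros continuous_at_closest_point F)
  have id: "isCont (\<lambda>y::'a. y) x" by simp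
  have "isCont (\<lambda>y. 2 * norm (y - ?P y - (x - ?P x))) x"
    by (intro continuous_intros cont)
  from tendsto_add[OF tendsto_add[OF tendsto_norm[OF tendsto_diff[OF
        tendsto_fst_nhds[OF id] tendsto_snd_nhds[OF id]]] tendsto_snd_nhds[OF this]] tendsto_fst_nhds[OF this]]
  have "(\<omega> \<longlongrightarrow> 0) (nhds (x, x))"
    unfolding \<omega>_def by simp
  moreover have "norm ((dist y (?P y))\<^sup>2 - (dist z (?P z))\<^sup>2 - 2 * ((x - ?P x) \<bullet> (y - z)))
      \<le> \<omega> (y, z) * norm (y - z)" for y z
  proof -
    let ?e = "\<lambda>w. w - ?P w - (x - ?P x)"
    have cs: "\<bar>?e w \<bullet> (y - z)\<bar> \<le> norm (?e w) * norm (y - z)" for w by (rule Cauchy_Schwarz_ineq2)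
    have "(dist y (?P y))\<^sup>2 - (dist z (?P z))\<^sup>2 - 2 * ((x - ?P x) \<bullet> (y - z))
       \<le> 2 * (?e z \<bullet> (y - z)) + (norm (y - z))\<^sup>2"
      using upper[of y z] by (simp add: algebra_simps inner_diff_left)
    moreover have "2 * (?e y \<bullet> (y - z)) - (norm (y - z))\<^sup>2
      \<le> (dist y (?P y))\<^sup>2 - (dist z (?P z))\<^sup>2 - 2 * ((x - ?P x) \<bullet> (y - z))"
    proof -
      have "(y - ?P y) \<bullet> (z - y) = - ((y - ?P y) \<bullet> (y - z))" by (simp add: algebra_simps)
      with upper[of z y] show ?thesis by (simp add: norm_minus_commute inner_diff_left)
    qed
    ultimately have "\<bar>(dist y (?P y))\<^sup>2 - (dist z (?P z))\<^sup>2 - 2 * ((x - ?P x) \<bullet> (y - z))\<bar>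
      \<le> (norm (y - z))\<^sup>2 + 2 * \<bar>?e z \<bullet> (y - z)\<bar> + 2 * \<bar>?e y \<bullet> (y - z)\<bar>"
      by linarith
    also have "\<dots> \<le> \<omega> (y, z) * norm (y - z)"
      using cs[of y] cs[of z] by (simp add: \<omega>_def algebra_simps power2_eq_square)
    finally show ?thesis by simp
  qed
  moreover have "bounded_linear (\<lambda>v. 2 * ((x - ?P x) \<bullet> v))"
    by (intro bounded_linear_const_mult bounded_linear_inner_right)
  ultimately show ?thesis unfolding has_strict_derivative_def by blast
qed

text \<open>Half the derivative of \<open>(max 0 t)\<^sup>2\<close> is the 1-Lipschitz function
  \<open>max 0 t\<close>, so the mean value theorem applies. The free point \<open>c\<close> becomes
  the base point of a strict derivative.\<close>

lemma max_0_square_diff: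
  fixes s t c :: real
  shows "\<bar>(max 0 s)\<^sup>2 - (max 0 t)\<^sup>2 - 2 * max 0 c * (s - t)\<bar> \<le> 2 * (\<bar>s - c\<bar> + \<bar>t - c\<bar>) * \<bar>s - t\<bar>"
proof -
  have *: "\<bar>(max 0 s)\<^sup>2 - (max 0 t)\<^sup>2 - 2 * max 0 c * (s - t)\<bar> \<le> 2 * (\<bar>s - c\<bar> + \<bar>t - c\<bar>) * \<bar>s - t\<bar>"
    if "t < s" for s t :: real
  proof -
    have deriv: "((\<lambda>t. (max 0 t)\<^sup>2) has_real_derivative 2 * max 0 x) (at x)" for x :: real
    proof -
      consider "x > 0" | "x < 0" | "x = 0" by linarith
      then show ?thesis
      proof cases
        case 1
        have "((\<lambda>t. t\<^sup>2) has_real_derivative 2 * max 0 x) (at x)"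
          using 1 by (auto intro!: derivative_eq_intros)
        then show ?thesis
          by (rule has_field_derivative_transform_within_open[of _ _ _ "{0<..}"]) (use 1 in auto)
      next
        case 2
        have "((\<lambda>t. 0) has_real_derivative 2 * max 0 x) (at x)"
          using 2 by (auto intro!: derivative_eq_intros)
        then show ?thesis
          by (rule has_field_derivative_transform_within_open[of _ _ _ "{..<0}"]) (use 2 in auto)
      next
        case 3
        have "\<bar>((max 0 h)\<^sup>2) / h\<bar> \<le> \<bar>h\<bar>" for h :: real
          by (auto simp: max_def power2_eq_square)
        then have "\<forall>\<^sub>F h::real in at 0. norm ((max 0 h)\<^sup>2 / h) \<le> norm h * 1" by simp
        from tendsto_0_le[OF tendsto_ident_at this]
        have "((\<lambda>h::real. (max 0 h)\<^sup>2 / h) \<longlongrightarrow> 0) (at 0)" .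
        with 3 show ?thesis by (simp add: DERIV_def)
      qed
    qed
    obtain \<xi> where xi: "t < \<xi>" "\<xi> < s"
      "(max 0 s)\<^sup>2 - (max 0 t)\<^sup>2 = (s - t) * (2 * max 0 \<xi>)"
      using MVT2[OF \<open>t < s\<close>, of "\<lambda>t. (max 0 t)\<^sup>2" "\<lambda>x. 2 * max 0 x"] deriv by blast
    have "\<bar>(max 0 s)\<^sup>2 - (max 0 t)\<^sup>2 - 2 * max 0 c * (s - t)\<bar> = 2 * \<bar>max 0 \<xi> - max 0 c\<bar> * \<bar>s - t\<bar>"
    proof -
      have "(s - t) * (2 * max 0 \<xi>) - 2 * max 0 c * (s - t) = 2 * (max 0 \<xi> - max 0 c) * (s - t)"
        by (simp add: algebra_simps)
      then show ?thesis unfolding xi(3) by (simp only: abs_mult abs_numeral)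
    qed
    also have "\<dots> \<le> 2 * (\<bar>s - c\<bar> + \<bar>t - c\<bar>) * \<bar>s - t\<bar>"
      using xi by (intro mult_mono) (auto simp: max_def)
    finally show ?thesis .
  qed
  consider "t < s" | "s < t" | "s = t" by linarith
  then show ?thesis
  proof cases
    case 2
    have "(max 0 s)\<^sup>2 - (max 0 t)\<^sup>2 - 2 * max 0 c * (s - t)
        = - ((max 0 t)\<^sup>2 - (max 0 s)\<^sup>2 - 2 * max 0 c * (t - s))" by (simp add: algebra_simps)
    then show ?thesis using *[OF 2] by (simp only: abs_minus_cancel) (simp add: algebra_simps abs_minus_commute)
  qed (use * in auto)
qed


lemma has_strict_derivative_max_0_square:
  fixes p :: "'a::real_normed_vector \<Rightarrow> real"
  assumes D: "has_strict_derivative p D x"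
  shows "has_strict_derivative (\<lambda>z. (max 0 (p z))\<^sup>2) (\<lambda>v. 2 * max 0 (p x) * D v) x"
proof -
  interpret D: bounded_linear D using D by (rule has_strict_derivative_bounded_linear)
  obtain \<omega> where \<omega>: "(\<omega> \<longlongrightarrow> 0) (nhds (x, x))"
    "\<And>y z. norm (p y - p z - D (y - z)) \<le> \<omega> (y, z) * norm (y - z)"
    using D unfolding has_strict_derivative_def by blast
  define \<alpha> where "\<alpha> q = 2 * (\<bar>p (fst q) - p x\<bar> + \<bar>p (snd q) - p x\<bar>)" for q
  define \<beta> where "\<beta> = 2 * max 0 (p x)"
  define \<psi> where "\<psi> q = \<alpha> q * (onorm D + \<omega> q) + \<beta> * \<omega> q" for q
  have "isCont p x" by (rule has_strict_derivative_imp_isCont[OF D])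
  note pt = tendsto_fst_nhds[OF this, of x] tendsto_snd_nhds[OF this, of x]
  have "(\<alpha> \<longlongrightarrow> 0) (nhds (x, x))"
    unfolding \<alpha>_def using pt by (auto intro!: tendsto_eq_intros)
  then have "(\<psi> \<longlongrightarrow> 0) (nhds (x, x))"
    unfolding \<psi>_def using \<omega>(1) by (auto intro!: tendsto_eq_intros)
  moreover have "norm ((max 0 (p y))\<^sup>2 - (max 0 (p z))\<^sup>2 - 2 * max 0 (p x) * D (y - z))
      \<le> \<psi> (y, z) * norm (y - z)" for y z
  proof -
    let ?e = "p y - p z - D (y - z)"
    have nonneg: "0 \<le> \<alpha> (y, z)" "0 \<le> \<beta>" by (simp_all add: \<alpha>_def \<beta>_def)
    have e: "\<bar>?e\<bar> \<le> \<omega> (y, z) * norm (y - z)" using \<omega>(2)[of y z] by simp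
    have "\<bar>D (y - z)\<bar> \<le> onorm D * norm (y - z)" using onorm[OF D.bounded_linear_axioms, of "y - z"] by simp
    with e have L: "\<bar>p y - p z\<bar> \<le> (onorm D + \<omega> (y, z)) * norm (y - z)"
      unfolding distrib_right by linarith
    have "\<bar>(max 0 (p y))\<^sup>2 - (max 0 (p z))\<^sup>2 - \<beta> * (p y - p z)\<bar> \<le> \<alpha> (y, z) * \<bar>p y - p z\<bar>"
      using max_0_square_diff[of "p y" "p z" "p x"] by (simp add: \<alpha>_def \<beta>_def)
    moreover have "\<bar>\<beta> * ?e\<bar> \<le> \<beta> * (\<omega> (y, z) * norm (y - z))"
      unfolding abs_mult using e nonneg by (simp add: mult_left_mono)
    moreover have "(max 0 (p y))\<^sup>2 - (max 0 (p z))\<^sup>2 - \<beta> * D (y - z)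
      = ((max 0 (p y))\<^sup>2 - (max 0 (p z))\<^sup>2 - \<beta> * (p y - p z)) + \<beta> * ?e"
      by (simp add: right_diff_distrib)
    moreover note mult_left_mono[OF L nonneg(1)]
    ultimately have "\<bar>(max 0 (p y))\<^sup>2 - (max 0 (p z))\<^sup>2 - \<beta> * D (y - z)\<bar>
      \<le> \<alpha> (y, z) * ((onorm D + \<omega> (y, z)) * norm (y - z)) + \<beta> * (\<omega> (y, z) * norm (y - z))"
      by linarith
    also have "\<dots> = \<psi> (y, z) * norm (y - z)" unfolding \<psi>_def by (simp only: distrib_right mult.assoc)
    finally show ?thesis by (simp only: \<beta>_def real_norm_def)
  qed
  moreover have "bounded_linear (\<lambda>v. 2 * max 0 (p x) * D v)"
    by (intro bounded_linear_const_mult D.bounded_linear_axioms)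
  ultimately show ?thesis unfolding has_strict_derivative_def by blast
qed

text \<open>This is implicit differentiation performed on increments:
  \<open>cubic_diff_factor\<close> bounds \<open>Q\<close> times the remainder of \<open>Y\<close>,
  and \<open>Q\<close> tends to \<open>Q0 = 3 * (Y x)\<^sup>2 + u x\<close>, which is positive
  because \<open>u x\<close> is. The derivative is therefore
  \<open>(S - Y x * U) / Q0\<close>.\<close>

lemma has_strict_derivative_cubic_solution:
  fixes u s Y :: "'a::real_normed_vector \<Rightarrow> real"
  assumes U: "has_strict_derivative u U x" and S: "has_strict_derivative s S x"
    and Y: "\<And>z. Y z ^ 3 + u z * Y z = s z" and u: "\<And>z. 0 \<le> u z" "0 < u x" and Y_cont: "isCont Y x"
  shows "\<exists>D. has_strict_derivative Y D x"
proof -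
  interpret U: bounded_linear U using U by (rule has_strict_derivative_bounded_linear)
  interpret S: bounded_linear S using S by (rule has_strict_derivative_bounded_linear)
  obtain \<omega> where \<omega>: "(\<omega> \<longlongrightarrow> 0) (nhds (x, x))"
    "\<And>y z. norm (u y - u z - U (y - z)) \<le> \<omega> (y, z) * norm (y - z)"
    using U unfolding has_strict_derivative_def by blast
  obtain \<sigma> where \<sigma>: "(\<sigma> \<longlongrightarrow> 0) (nhds (x, x))"
    "\<And>y z. norm (s y - s z - S (y - z)) \<le> \<sigma> (y, z) * norm (y - z)"
    using S unfolding has_strict_derivative_def by blast
  define Q where "Q q = (Y (fst q))\<^sup>2 + Y (fst q) * Y (snd q) + (Y (snd q))\<^sup>2 + u (fst q)" for q
  define Q0 where "Q0 = 3 * (Y x)\<^sup>2 + u x"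
  define L where "L v = (S v - Y x * U v) / Q0" for v
  have L: "bounded_linear L" unfolding L_def
    by (intro bounded_linear_compose[OF bounded_linear_divide] bounded_linear_sub
        bounded_linear_const_mult U.bounded_linear_axioms S.bounded_linear_axioms)
  interpret L: bounded_linear L by fact
  have Q0: "Q0 > 0" using u(2) by (simp add: Q0_def add_nonneg_pos)
  have Ytend: "((\<lambda>q. Y (fst q)) \<longlongrightarrow> Y x) (nhds (x, x))" "((\<lambda>q. Y (snd q)) \<longlongrightarrow> Y x) (nhds (x, x))"
    by (rule tendsto_fst_nhds tendsto_snd_nhds, rule Y_cont)+
  have "((\<lambda>q. u (fst q)) \<longlongrightarrow> u x) (nhds (x, x))"
    by (rule tendsto_fst_nhds[OF has_strict_derivative_imp_isCont[OF U]])
  with Ytend have Qt: "(Q \<longlongrightarrow> Q0) (nhds (x, x))"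
    unfolding Q_def Q0_def by (auto intro!: tendsto_eq_intros simp: power2_eq_square)
  have Qpos: "Q q \<ge> 0" for q
    using sum_squares_cross_ge(3)[of "Y (fst q)" "Y (snd q)"] u(1)[of "fst q"]
    unfolding Q_def by argo
  define \<psi> where "\<psi> q = \<bar>Q0 - Q q\<bar> * onorm L + \<bar>Y x - Y (snd q)\<bar> * onorm U
    + \<bar>Y (snd q)\<bar> * \<omega> q + \<sigma> q" for q
  have \<psi>: "(\<psi> \<longlongrightarrow> 0) (nhds (x, x))"
    unfolding \<psi>_def using Ytend Qt \<omega>(1) \<sigma>(1) by (auto intro!: tendsto_eq_intros)
  have est: "Q q * \<bar>Y (fst q) - Y (snd q) - L (fst q - snd q)\<bar> \<le> \<psi> q * norm (fst q - snd q)" for q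
  proof -
    obtain y z where q: "q = (y, z)" by (cases q)
    let ?e = "u y - u z - U (y - z)" and ?f = "s y - s z - S (y - z)"
    have fac: "Q q * (Y y - Y z) = (s y - s z) - (u y - u z) * Y z"
      using cubic_diff_factor[OF Y Y, of y z] unfolding Q_def q by simp
    have lin: "Q0 * L (y - z) = S (y - z) - Y x * U (y - z)"
      using Q0 by (simp add: L_def)
    have "Q q * (Y y - Y z - L (y - z)) = (Q0 - Q q) * L (y - z)
       + (Y x - Y z) * U (y - z) - Y z * ?e + ?f"
      using fac lin by (simp add: algebra_simps)
    moreover have "\<bar>(Q0 - Q q) * L (y - z)\<bar> \<le> \<bar>Q0 - Q q\<bar> * (onorm L * norm (y - z))"
      unfolding abs_mult using onorm[OF L.bounded_linear_axioms, of "y - z"] by (intro mult_left_mono) auto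
    moreover have "\<bar>(Y x - Y z) * U (y - z)\<bar> \<le> \<bar>Y x - Y z\<bar> * (onorm U * norm (y - z))"
      unfolding abs_mult using onorm[OF U.bounded_linear_axioms, of "y - z"] by (intro mult_left_mono) auto
    moreover have "\<bar>Y z * ?e\<bar> \<le> \<bar>Y z\<bar> * (\<omega> q * norm (y - z))"
      unfolding abs_mult using \<omega>(2)[of y z] by (intro mult_left_mono) (auto simp: q)
    moreover have "\<bar>?f\<bar> \<le> \<sigma> q * norm (y - z)" using \<sigma>(2)[of y z] by (simp add: q)
    ultimately have "\<bar>Q q * (Y y - Y z - L (y - z))\<bar> \<le> \<bar>Q0 - Q q\<bar> * (onorm L * norm (y - z))
      + \<bar>Y x - Y z\<bar> * (onorm U * norm (y - z)) + \<bar>Y z\<bar> * (\<omega> q * norm (y - z)) + \<sigma> q * norm (y - z)"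
      by linarith
    also have "\<dots> = \<psi> q * norm (y - z)" by (simp add: \<psi>_def q distrib_right mult.assoc)
    finally show ?thesis using Qpos[of q] by (simp add: abs_mult q)
  qed
  have "has_strict_derivative Y L x"
  proof (rule has_strict_derivative_I[OF L])
    fix e :: real assume "e > 0"
    have "\<forall>\<^sub>F q in nhds (x, x). Q0 / 2 < Q q" using Q0 by (intro order_tendstoD(1)[OF Qt]) simp
    moreover have "\<forall>\<^sub>F q in nhds (x, x). \<psi> q < e * (Q0 / 2)"
      using Q0 \<open>e > 0\<close> by (intro order_tendstoD(2)[OF \<psi>]) simp
    ultimately show "\<forall>\<^sub>F q in nhds (x, x).
        norm (Y (fst q) - Y (snd q) - L (fst q - snd q)) \<le> e * norm (fst q - snd q)"
    proof eventually_elim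
      case (elim q)
      have "Q0 / 2 * \<bar>Y (fst q) - Y (snd q) - L (fst q - snd q)\<bar>
        \<le> Q q * \<bar>Y (fst q) - Y (snd q) - L (fst q - snd q)\<bar>"
        using elim by (intro mult_right_mono) auto
      also note est
      also have "\<psi> q * norm (fst q - snd q) \<le> (e * (Q0 / 2)) * norm (fst q - snd q)"
        using elim by (intro mult_right_mono) auto
      finally have "Q0 / 2 * \<bar>Y (fst q) - Y (snd q) - L (fst q - snd q)\<bar>
        \<le> Q0 / 2 * (e * norm (fst q - snd q))" by (simp add: algebra_simps)
      then show ?case using Q0 by simp
    qed
  qed
  then show ?thesis by blast
qed

text \<open>The profile is \<open>\<kappa> Y\<close> with a cutoff \<open>\<kappa>\<close> and \<open>Y\<^sup>3 + d\<^sup>4 Y = s\<close>, where \<open>s = a \<bullet> z - b\<close> and \<open>d\<close> is the distance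
  to \<open>F\<close>. Thus \<open>Y\<close> behaves like a cube root of \<open>s\<close> near \<open>F\<close>; the term \<open>d\<^sup>4 Y\<close> regularizes it off \<open>F\<close>, and
  its exponent makes the transversal slopes vanish at the relative boundary of \<open>F\<close>.\<close>

lemma facet_profile_exists:
  fixes F :: "'a::euclidean_space set"
  assumes F: "closed F" "convex F" "F \<noteq> {}" "F \<subseteq> {x. a \<bullet> x = b}" and r: "r > 0"
  obtains v C where "\<And>z. isCont v z" "\<And>z. \<bar>v z\<bar> \<le> C"
    "\<And>z. (\<And>x. x \<in> F \<Longrightarrow> r \<le> dist z x) \<Longrightarrow> v z = 0"
    "\<And>y z. - C * (norm (y - z))\<^sup>2 \<le> (v y - v z) * (a \<bullet> (y - z))"
    "\<And>z. z \<in> F \<Longrightarrow> singular_along v a z"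
    "\<And>z. z \<notin> F \<Longrightarrow> \<exists>D. has_strict_derivative v D z"
proof -
  let ?P = "closest_point F"
  define d where "d z = dist z (?P z)" for z
  define s where "s z = a \<bullet> z - b" for z
  define Y where "Y z = cubic_root (d z ^ 4) (s z)" for z
  \<comment> \<open>The outer square makes the truncation \<open>C^1\<close>; on \<open>F\<close>
    the cutoff equals \<open>r ^ 4\<close>.\<close>
  define \<kappa> where "\<kappa> z = (max 0 (r\<^sup>2 - (d z)\<^sup>2))\<^sup>2" for z
  define v where "v z = \<kappa> z * Y z" for z
  have PF: "?P z \<in> F" for z using F by (intro closest_point_in_set)
  have d0: "0 \<le> d z" for z by (simp add: d_def)
  have dle: "d z \<le> dist z x" if "x \<in> F" for x z
    unfolding d_def using F that by (intro closest_point_le)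
  have d_Lip1: "d y \<le> d z + norm (y - z)" for y z
    using dle[OF PF[of z], of y] dist_triangle[of y "?P z" z] by (simp add: d_def dist_norm)
  have d_Lip: "\<bar>d y - d z\<bar> \<le> norm (y - z)" for y z
    using d_Lip1[of y z] d_Lip1[of z y] by (simp add: norm_minus_commute abs_le_iff)
  have d_cont: "isCont d z" for z
    unfolding d_def by (intro continuous_intros continuous_at_closest_point F)
  have s_diff: "s y - s z = a \<bullet> (y - z)" for y z by (simp add: s_def algebra_simps)
  have s_cont: "isCont s z" for z unfolding s_def by (intro continuous_intros)
  have s_P: "s (?P z) = 0" for z using PF[of z] F(4) by (auto simp: s_def)
  have s_le: "\<bar>s z\<bar> \<le> norm a * d z" for z
    using Cauchy_Schwarz_ineq2[of a "z - ?P z"] s_diff[of z "?P z"] s_P[of z] by (simp add: d_def dist_norm)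
  have Y: "Y z ^ 3 + d z ^ 4 * Y z = s z" for z unfolding Y_def by (rule cubic_root) simp
  have Y_bound: "\<bar>Y z\<bar> \<le> 1 + \<bar>s z\<bar>" for z by (rule cubic_root_bound[OF Y]) simp
  have dF: "d z = 0" if "z \<in> F" for z using dle[OF that, of z] d0[of z] by simp
  have dF': "d z > 0" if "z \<notin> F" for z using that PF[of z] by (auto simp: d_def)
  have YF: "Y z = 0" if "z \<in> F" for z
    using Y[of z] dF[OF that] s_le[of z] by simp
  have Y_cont: "isCont Y z" for z
  proof -
    \<comment> \<open>The factorization gives
      \<open>\<bar>Y y - Y z\<bar> ^ 3 \<le> 4 * \<bar>X y\<bar>\<close>. This bound survives on
      \<open>F\<close>, where the slope of \<open>Y\<close> is unbounded.\<close>
    define X where "X y = (s y - s z) - (d y ^ 4 - d z ^ 4) * Y z" for y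
    have "(\<lambda>y. root 3 (4 * \<bar>X y\<bar>)) \<midarrow>z\<rightarrow> root 3 (4 * \<bar>X z\<bar>)"
      unfolding X_def using d_cont[of z] s_cont[of z] unfolding isCont_def by (intro tendsto_intros)
    then have lim: "(\<lambda>y. root 3 (4 * \<bar>X y\<bar>)) \<midarrow>z\<rightarrow> 0" by (simp add: X_def)
    have "norm (Y y - Y z) \<le> norm (root 3 (4 * \<bar>X y\<bar>)) * 1" for y
    proof -
      let ?Q = "(Y y)\<^sup>2 + Y y * Y z + (Y z)\<^sup>2"
      have fac: "(?Q + d y ^ 4) * (Y y - Y z) = X y"
        using cubic_diff_factor[OF Y Y, of y z] by (simp only: X_def)
      have d4: "0 \<le> d y ^ 4" by simp
      have "\<bar>Y y - Y z\<bar> ^ 3 = (Y y - Y z)\<^sup>2 * \<bar>Y y - Y z\<bar>"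
        by (simp add: power3_eq_cube power2_eq_square abs_mult[symmetric])
      also have "\<dots> \<le> (4 * (?Q + d y ^ 4)) * \<bar>Y y - Y z\<bar>"
        using sum_squares_cross_ge(1)[of "Y y" "Y z"] d4 by (intro mult_right_mono) argo+
      also have "\<dots> = 4 * \<bar>X y\<bar>"
        unfolding fac[symmetric] abs_mult
        using sum_squares_cross_ge(3)[of "Y y" "Y z"] d4 by (subst abs_of_nonneg) argo+
      finally have "root 3 (\<bar>Y y - Y z\<bar> ^ 3) \<le> root 3 (4 * \<bar>X y\<bar>)" by simp
      then show ?thesis by (simp add: real_root_power_cancel)
    qed
    then have "\<forall>\<^sub>F y in at z. norm (Y y - Y z) \<le> norm (root 3 (4 * \<bar>X y\<bar>)) * 1" by simp
    from tendsto_0_le[OF lim this] show ?thesis unfolding isCont_def by (simp add: LIM_zero_iff)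
  qed
  have Y_est: "\<exists>A\<ge>N. A \<ge> 0 \<and> \<bar>Y y - Y z - A * (a \<bullet> (y - z))\<bar> \<le> 4 * max (d y) (d z) * norm (y - z)"
    if "N * ((Y y)\<^sup>2 + Y y * Y z + (Y z)\<^sup>2 + (max (d y) (d z)) ^ 4) \<le> 1" for y z N
    using cubic_diff_estimate[OF Y Y d0 d0 d_Lip that] unfolding s_diff .
  have \<kappa>0: "0 \<le> \<kappa> z" for z by (simp add: \<kappa>_def)
  have \<kappa>_eq_0: "\<kappa> z = 0" if "d z \<ge> r" for z
    using power_mono[OF that, of 2] r by (simp add: \<kappa>_def)
  have \<kappa>_le: "\<kappa> z \<le> r ^ 4" for z
  proof -
    have "(max 0 (r\<^sup>2 - (d z)\<^sup>2))\<^sup>2 \<le> (r\<^sup>2)\<^sup>2" by (intro power_mono) auto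
    then show ?thesis by (simp add: \<kappa>_def power_mult[symmetric])
  qed
  have d2_sd: "has_strict_derivative (\<lambda>z. (d z)\<^sup>2) (\<lambda>v. 2 * ((x - ?P x) \<bullet> v)) x" for x
    unfolding d_def by (rule dist_closest_point_strict_derivative[OF F(1-3)])
  have \<kappa>_sd: "\<exists>D. has_strict_derivative \<kappa> D x" for x
  proof -
    have "has_strict_derivative (\<lambda>z. r\<^sup>2 + -1 * (d z)\<^sup>2) (\<lambda>v. 0 + (-1 * (2 * ((x - ?P x) \<bullet> v)) + (d x)\<^sup>2 * 0)) x"
      by (intro has_strict_derivative_add has_strict_derivative_mult has_strict_derivative_const d2_sd)
    from has_strict_derivative_max_0_square[OF this] show ?thesis
      unfolding \<kappa>_def by (auto simp only: mult_minus1 diff_conv_add_uminus)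
  qed
  have Y_sd: "\<exists>D. has_strict_derivative Y D x" if "x \<notin> F" for x
  proof -
    have "has_strict_derivative (\<lambda>z. (d z)\<^sup>2 * (d z)\<^sup>2)
        (\<lambda>v. (d x)\<^sup>2 * (2 * ((x - ?P x) \<bullet> v)) + (d x)\<^sup>2 * (2 * ((x - ?P x) \<bullet> v))) x"
      by (intro has_strict_derivative_mult d2_sd)
    then obtain U where U: "has_strict_derivative (\<lambda>z. d z ^ 4) U x"
      by (auto simp flip: power_add)
    have "has_strict_derivative s (\<lambda>v. a \<bullet> v) x"
      by (rule has_strict_derivative_I)
        (auto simp: s_diff intro: bounded_linear_inner_right)
    from has_strict_derivative_cubic_solution[OF U this, of Y] show ?thesis
      using Y Y_cont dF'[OF that] by auto
  qed
  define K where "K = 1 + norm a * r"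
  have K: "K \<ge> 0" using r by (simp add: K_def)
  have Y_le: "\<bar>Y z\<bar> \<le> K" if "d z \<le> r" for z
    using Y_bound[of z] s_le[of z] mult_left_mono[OF that norm_ge_zero[of a]] by (simp add: K_def)
  have \<kappa>_Lip: "\<bar>\<kappa> y - \<kappa> z\<bar> \<le> 4 * r ^ 3 * norm (y - z)" for y z
  proof -
    \<comment> \<open>Truncating the distance at \<open>r\<close> makes the cutoff a polynomial in a
      bounded 1-Lipschitz quantity.\<close>
    define m where "m z = min (d z) r" for z
    have m: "0 \<le> m z" "m z \<le> r" for z using d0[of z] r by (auto simp: m_def)
    have \<kappa>m: "\<kappa> z = (r\<^sup>2 - (m z)\<^sup>2)\<^sup>2" for z
    proof (cases "d z \<le> r")
      case True
      then show ?thesis using power_mono[OF True d0, of 2] by (simp add: \<kappa>_def m_def)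
    qed (simp add: \<kappa>_eq_0 m_def)
    have m2: "(m z)\<^sup>2 \<le> r\<^sup>2" for z using m[of z] by (intro power_mono)
    have \<kappa>yz: "\<kappa> y - \<kappa> z = ((r\<^sup>2 - (m y)\<^sup>2) + (r\<^sup>2 - (m z)\<^sup>2)) * ((m y + m z) * (m z - m y))"
      unfolding \<kappa>m by algebra
    have "\<bar>\<kappa> y - \<kappa> z\<bar> = ((r\<^sup>2 - (m y)\<^sup>2) + (r\<^sup>2 - (m z)\<^sup>2)) * ((m y + m z) * \<bar>m z - m y\<bar>)"
    proof -
      have "0 \<le> (r\<^sup>2 - (m y)\<^sup>2) + (r\<^sup>2 - (m z)\<^sup>2)" "0 \<le> m y + m z"
        by (intro add_nonneg_nonneg; use m m2 in simp)+
      then show ?thesis by (simp only: \<kappa>yz abs_mult abs_of_nonneg)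
    qed
    also have "\<dots> \<le> (r\<^sup>2 + r\<^sup>2) * ((r + r) * norm (y - z))"
      using m[of y] m[of z] m2[of y] m2[of z] d_Lip[of y z] r
      by (intro mult_mono add_mono) (auto simp: m_def)
    also have "\<dots> = 4 * r ^ 3 * norm (y - z)" by (simp add: power2_eq_square power3_eq_cube)
    finally show ?thesis .
  qed
  \<comment> \<open>The first summand bounds \<open>v\<close>. In the second,
    \<open>4 * r ^ 3 * K\<close> is the rate of the increments of the cutoff times \<open>Y\<close>,
    and \<open>r ^ 4 * (4 * r)\<close> is the rate of the transversal error of \<open>Y\<close>
    times the cutoff.\<close>
  define C where "C = r ^ 4 * K + norm a * (4 * r ^ 3 * K + r ^ 4 * (4 * r))"
  have C1: "r ^ 4 * K \<le> C" "norm a * (4 * r ^ 3 * K) \<le> C" "norm a * (4 * r ^ 3 * K + r ^ 4 * (4 * r)) \<le> C"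
    using r K by (auto simp: C_def algebra_simps)
  have lower: "- C * (norm (y - z))\<^sup>2 \<le> t * (a \<bullet> (y - z))"
    if "\<bar>t\<bar> \<le> k * norm (y - z)" "norm a * k \<le> C" for t k y z
  proof -
    have "\<bar>t * (a \<bullet> (y - z))\<bar> \<le> (k * norm (y - z)) * (norm a * norm (y - z))"
      unfolding abs_mult using that(1) by (intro mult_mono Cauchy_Schwarz_ineq2) auto
    also have "\<dots> = (norm a * k) * (norm (y - z))\<^sup>2" by (simp add: power2_eq_square)
    also have "\<dots> \<le> C * (norm (y - z))\<^sup>2" by (intro mult_right_mono that) auto
    finally show ?thesis by (simp add: abs_le_iff)
  qed
  have v_far: "v z = 0" if "d z \<ge> r" for z using \<kappa>_eq_0[OF that] by (simp add: v_def)
  \<comment> \<open>Outside the support one of the two cutoffs is 0, so only the increment of the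
    cutoff remains and the infinite slope of \<open>Y\<close> does not enter.\<close>
  have v_diff: "\<bar>v y - v z\<bar> \<le> 4 * r ^ 3 * K * norm (y - z)" if "d y \<ge> r" for y z
  proof (cases "d z \<ge> r")
    case True
    then show ?thesis using that v_far K r by simp
  next
    case False
    have "\<bar>v y - v z\<bar> = \<bar>\<kappa> y - \<kappa> z\<bar> * \<bar>Y z\<bar>"
      using \<kappa>_eq_0[OF that] by (simp add: v_def abs_mult)
    also have "\<dots> \<le> (4 * r ^ 3 * norm (y - z)) * K"
      using False r by (intro mult_mono \<kappa>_Lip Y_le) auto
    finally show ?thesis by (simp add: algebra_simps)
  qed
  have split: "v y - v z = \<kappa> y * (Y y - Y z) + (\<kappa> y - \<kappa> z) * Y z" for y z
    by (simp add: v_def algebra_simps)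
  have one_sided: "- C * (norm (y - z))\<^sup>2 \<le> (v y - v z) * (a \<bullet> (y - z))" for y z
  proof -
    consider "d y \<ge> r" | "d z \<ge> r" | "d y < r" "d z < r" by linarith
    then show ?thesis
    proof cases
      case 1
      show ?thesis by (rule lower[OF v_diff[OF 1] C1(2)])
    next
      case 2
      have "\<bar>v y - v z\<bar> \<le> 4 * r ^ 3 * K * norm (y - z)"
        using v_diff[OF 2, of y] by (simp add: norm_minus_commute abs_minus_commute)
      then show ?thesis by (rule lower[OF _ C1(2)])
    next
      case 3
      \<comment> \<open>\<open>N = 0\<close> makes the hypothesis of \<open>Y_est\<close> trivial.
        The slope \<open>A\<close> has no upper bound, but it enters the product only as
        \<open>\<kappa> y * A * (a \<bullet> (y - z))\<^sup>2\<close>, which has the favourable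
        sign; all other parts are Lipschitz.\<close>
      obtain A where A: "A \<ge> 0" "\<bar>Y y - Y z - A * (a \<bullet> (y - z))\<bar> \<le> 4 * max (d y) (d z) * norm (y - z)"
        using Y_est[of 0 y z] by auto
      define E where "E = Y y - Y z - A * (a \<bullet> (y - z))"
      have E: "\<bar>E\<bar> \<le> 4 * r * norm (y - z)"
        using A(2) 3 order.trans[OF _ mult_right_mono[of "4 * max (d y) (d z)" "4 * r" "norm (y - z)"]]
        unfolding E_def[symmetric] by auto
      have "\<bar>(\<kappa> y - \<kappa> z) * Y z + \<kappa> y * E\<bar> \<le> (4 * r ^ 3 * norm (y - z)) * K + r ^ 4 * (4 * r * norm (y - z))"
        by (intro order.trans[OF abs_triangle_ineq] add_mono; unfold abs_mult abs_of_nonneg[OF \<kappa>0])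
          (intro mult_mono \<kappa>_le \<kappa>_Lip E Y_le; use 3 r in simp)+
      also have "\<dots> = (4 * r ^ 3 * K + r ^ 4 * (4 * r)) * norm (y - z)" by (simp add: algebra_simps)
      finally have "- C * (norm (y - z))\<^sup>2 \<le> ((\<kappa> y - \<kappa> z) * Y z + \<kappa> y * E) * (a \<bullet> (y - z))"
        by (rule lower[OF _ C1(3)])
      also have "\<dots> \<le> ((\<kappa> y - \<kappa> z) * Y z + \<kappa> y * E) * (a \<bullet> (y - z)) + \<kappa> y * A * (a \<bullet> (y - z))\<^sup>2"
        using \<kappa>0[of y] A(1) by simp
      also have "\<dots> = (v y - v z) * (a \<bullet> (y - z))"
        unfolding split by (simp add: E_def algebra_simps power2_eq_square)
      finally show ?thesis .
    qed
  qed
  have sing: "singular_along v a x" if x: "x \<in> F" for x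
  proof -
    \<comment> \<open>The first term is the transversal error of \<open>Y\<close>, the second comes
      from the variation of the cutoff. Both vanish on \<open>F\<close> because \<open>d\<close> and
      \<open>Y\<close> do.\<close>
    define \<omega> where "\<omega> q = r ^ 4 * (4 * max (d (fst q)) (d (snd q))) + 4 * r ^ 3 * \<bar>Y (snd q)\<bar>" for q
    have t: "((\<lambda>q. d (fst q)) \<longlongrightarrow> 0) (nhds (x, x))" "((\<lambda>q. d (snd q)) \<longlongrightarrow> 0) (nhds (x, x))"
      "((\<lambda>q. Y (fst q)) \<longlongrightarrow> 0) (nhds (x, x))" "((\<lambda>q. Y (snd q)) \<longlongrightarrow> 0) (nhds (x, x))"
      using tendsto_fst_nhds[OF d_cont, of x x] tendsto_snd_nhds[OF d_cont, of x x]
        tendsto_fst_nhds[OF Y_cont, of x x] tendsto_snd_nhds[OF Y_cont, of x x]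
      unfolding dF[OF x] YF[OF x] by simp_all
    have mt: "((\<lambda>q. max (d (fst q)) (d (snd q))) \<longlongrightarrow> 0) (nhds (x, x))"
      using tendsto_max[OF t(1,2)] by simp
    have "(\<omega> \<longlongrightarrow> 0) (nhds (x, x))"
      unfolding \<omega>_def using t mt by (auto intro!: tendsto_eq_intros)
    moreover have "\<forall>\<^sub>F q in nhds (x, x). \<exists>A\<ge>N.
        \<bar>v (fst q) - v (snd q) - A * (a \<bullet> (fst q - snd q))\<bar> \<le> \<omega> q * norm (fst q - snd q)" for N
    proof -
      \<comment> \<open>Near \<open>x\<close> the cutoff exceeds \<open>r ^ 4 / 2\<close>, so a
        slope \<open>N1\<close> of \<open>Y\<close> yields a slope \<open>N\<close> of
        \<open>v\<close>.\<close>
      define N1 where "N1 = 2 * max N 0 / r ^ 4"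
      have "((\<lambda>q. N1 * ((Y (fst q))\<^sup>2 + Y (fst q) * Y (snd q) + (Y (snd q))\<^sup>2
          + (max (d (fst q)) (d (snd q))) ^ 4)) \<longlongrightarrow> 0) (nhds (x, x))"
        using t mt by (auto intro!: tendsto_eq_intros)
      from order_tendstoD(2)[OF this, of 1]
      have "\<forall>\<^sub>F q in nhds (x, x). N1 * ((Y (fst q))\<^sup>2 + Y (fst q) * Y (snd q) + (Y (snd q))\<^sup>2
          + (max (d (fst q)) (d (snd q))) ^ 4) \<le> 1" by (auto elim: eventually_mono)
      moreover have "\<forall>\<^sub>F q in nhds (x, x). r ^ 4 / 2 < \<kappa> (fst q)"
      proof -
        obtain D where "has_strict_derivative \<kappa> D x" using \<kappa>_sd by blast
        then have "isCont \<kappa> x" by (rule has_strict_derivative_imp_isCont)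
        moreover have "\<kappa> x = r ^ 4" using dF[OF x] r by (simp add: \<kappa>_def power_mult[symmetric])
        ultimately have "((\<lambda>q. \<kappa> (fst q)) \<longlongrightarrow> r ^ 4) (nhds (x, x))"
          using tendsto_fst_nhds[of x \<kappa> x] by simp
        then show ?thesis using r by (intro order_tendstoD(1)) auto
      qed
      ultimately show ?thesis
      proof eventually_elim
        case (elim q)
        let ?y = "fst q" and ?z = "snd q"
        obtain A where A: "A \<ge> N1"
          "\<bar>Y ?y - Y ?z - A * (a \<bullet> (?y - ?z))\<bar> \<le> 4 * max (d ?y) (d ?z) * norm (?y - ?z)"
          using Y_est[OF elim(1)] by blast
        have "v ?y - v ?z - \<kappa> ?y * A * (a \<bullet> (?y - ?z))
          = \<kappa> ?y * (Y ?y - Y ?z - A * (a \<bullet> (?y - ?z))) + (\<kappa> ?y - \<kappa> ?z) * Y ?z"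
          unfolding split by (simp add: algebra_simps)
        also have "\<bar>\<dots>\<bar> \<le> r ^ 4 * (4 * max (d ?y) (d ?z) * norm (?y - ?z)) + (4 * r ^ 3 * norm (?y - ?z)) * \<bar>Y ?z\<bar>"
          by (intro order.trans[OF abs_triangle_ineq] add_mono; unfold abs_mult abs_of_nonneg[OF \<kappa>0])
            (intro mult_mono \<kappa>_le \<kappa>_Lip A(2) order_refl; use r in simp)+
        also have "\<dots> = \<omega> q * norm (?y - ?z)" by (simp add: \<omega>_def algebra_simps)
        finally have "\<bar>v ?y - v ?z - \<kappa> ?y * A * (a \<bullet> (?y - ?z))\<bar> \<le> \<omega> q * norm (?y - ?z)" .
        moreover have "N \<le> \<kappa> ?y * A"
        proof -
          have "N \<le> r ^ 4 / 2 * N1" using r by (simp add: N1_def)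
          also have "\<dots> \<le> \<kappa> ?y * A" using elim(2) A(1) r \<kappa>0[of ?y] by (intro mult_mono) (auto simp: N1_def)
          finally show ?thesis .
        qed
        ultimately show ?case by blast
      qed
    qed
    ultimately show ?thesis unfolding singular_along_def by blast
  qed
  show ?thesis
  proof (rule that[of v C])
    show "isCont v z" for z
    proof -
      obtain D where "has_strict_derivative \<kappa> D z" using \<kappa>_sd by blast
      then show ?thesis
        unfolding v_def by (intro continuous_intros Y_cont has_strict_derivative_imp_isCont)
    qed
    show "\<bar>v z\<bar> \<le> C" for z
    proof (cases "d z \<ge> r")
      case True
      have "0 \<le> r ^ 4 * K" using K by simp
      then show ?thesis using v_far[OF True] C1(1) by simp
    next
      case False
      then have "\<kappa> z * \<bar>Y z\<bar> \<le> r ^ 4 * K" by (intro mult_mono \<kappa>_le Y_le) auto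
      then show ?thesis using C1(1) \<kappa>0[of z] by (simp add: v_def abs_mult)
    qed
    show "v z = 0" if "\<And>x. x \<in> F \<Longrightarrow> r \<le> dist z x" for z
      using that[OF PF[of z]] by (intro v_far) (simp add: d_def)
    show "\<exists>D. has_strict_derivative v D z" if "z \<notin> F" for z
      using has_strict_derivative_mult \<kappa>_sd Y_sd[OF that] unfolding v_def by blast
  qed (fact one_sided sing)+
qed

section \<open>Collapsing facets\<close>

lemma orthogonal_projection_exists:
  fixes W :: "'a::euclidean_space set"
  assumes "subspace W"
  obtains P where "linear P" "\<And>x. P x \<in> W" "\<And>x w. w \<in> W \<Longrightarrow> P x \<bullet> w = x \<bullet> w"
proof -
  obtain B where B: "B \<subseteq> W" "pairwise orthogonal B" "\<And>x. x \<in> B \<Longrightarrow> norm x = 1"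
    "independent B" "span B = W"
    using orthonormal_basis_subspace[OF assms] by metis
  have fin: "finite B" using B(4) independent_imp_finite by blast
  define P where "P x = (\<Sum>b\<in>B. (x \<bullet> b) *\<^sub>R b)" for x
  have "linear P" unfolding P_def
    by (intro linear_compose_sum ballI linearI) (auto simp: algebra_simps)
  moreover have "P x \<in> W" for x
    unfolding P_def B(5)[symmetric] by (intro span_sum span_scale span_base)
  moreover have "P x \<bullet> w = x \<bullet> w" if w: "w \<in> W" for x w
  proof -
    have "(\<Sum>b\<in>B. (w \<bullet> b) *\<^sub>R b) = w"
      using orthonormal_basis_expand[OF B(2,3)] w B(5) fin by blast
    then have "x \<bullet> w = (\<Sum>b\<in>B. (w \<bullet> b) * (x \<bullet> b))"
      by (metis (no_types, lifting) inner_scaleR_right inner_sum_right sum.cong)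
    also have "\<dots> = P x \<bullet> w"
      by (simp add: P_def inner_sum_left inner_commute[of w] mult.commute)
    finally show ?thesis by simp
  qed
  ultimately show ?thesis using that by blast
qed

text \<open>The derivative is \<open>L\<^sup>-\<^sup>1 P\<close>, where \<open>P\<close> projects onto the orthogonal complement \<open>W\<close> of the
  directions \<open>a j\<close> and \<open>L\<close> is \<open>P (1 + B)\<close> on \<open>W\<close>: infinite stretching along the \<open>a j\<close> becomes
  collapse for the inverse.\<close>

lemma strict_derivative_of_singular_inverse:
  fixes G h :: "'a::euclidean_space \<Rightarrow> 'a" and v :: "'i \<Rightarrow> 'a \<Rightarrow> real"
  assumes J: "finite J"
    and G: "\<forall>\<^sub>F z in nhds z0. G z = z + (\<Sum>j\<in>J. v j z *\<^sub>R a j) + E z"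
    and sing: "\<And>j. j \<in> J \<Longrightarrow> singular_along (v j) (a j) z0"
    and E: "has_strict_derivative E B z0"
    and mono: "\<And>y z. (norm (y - z))\<^sup>2 / 2 \<le> (G y - G z) \<bullet> (y - z)"
    and Lip: "\<And>x y. norm (h x - h y) \<le> 2 * norm (x - y)"
    and inv: "\<And>z. h (G z) = z" "\<And>x. G (h x) = x"
  obtains D where "has_strict_derivative h D (G z0)" "\<And>x j. j \<in> J \<Longrightarrow> a j \<bullet> D x = 0"
proof -
  interpret B: bounded_linear B using E by (rule has_strict_derivative_bounded_linear)
  define W where "W = {w. \<forall>j\<in>J. a j \<bullet> w = 0}"
  have W: "subspace W" by (auto simp: W_def subspace_def inner_right_distrib)
  obtain P where P: "linear P" "\<And>x. P x \<in> W" "\<And>x w. w \<in> W \<Longrightarrow> P x \<bullet> w = x \<bullet> w"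
    using orthogonal_projection_exists[OF W] by metis
  interpret P: linear P by fact
  have Pa: "P (a j) = 0" if "j \<in> J" for j
  proof -
    have "P (a j) \<bullet> P (a j) = a j \<bullet> P (a j)" by (rule P(3)[OF P(2)])
    also have "\<dots> = 0" using P(2)[of "a j"] that by (auto simp: W_def)
    finally show ?thesis by simp
  qed
  \<comment> \<open>\<open>Q\<close> vanishes exactly on \<open>W\<close> and takes values in the
    span of the \<open>a j\<close>. Adding it completes \<open>P (1 + B)\<close> to a map that is
    injective on the whole space and still sends only vectors of \<open>W\<close> into
    \<open>W\<close>.\<close>
  define Q where "Q x = (\<Sum>j\<in>J. (a j \<bullet> x) *\<^sub>R a j)" for x
  define L where "L x = P (x + B x) + Q x" for x
  have linQ: "linear Q" unfolding Q_def
    by (intro linear_compose_sum ballI linearI) (auto simp: algebra_simps)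
  have linL: "linear L"
    unfolding L_def by (intro linearI)
      (simp_all add: P.add P.scale B.add B.scaleR linear_add[OF linQ] linear_scale[OF linQ] algebra_simps)
  have QW: "x \<in> W" if "Q x \<in> W" for x
  proof -
    have "(\<Sum>j\<in>J. (a j \<bullet> x)\<^sup>2) = Q x \<bullet> x"
      by (simp add: Q_def inner_sum_left power2_eq_square)
    moreover have "Q x \<bullet> Q x = (\<Sum>j\<in>J. (a j \<bullet> x) * (a j \<bullet> Q x))"
      by (subst (1) Q_def) (simp add: inner_sum_left)
    then have "Q x \<bullet> Q x = 0" using that by (simp add: W_def)
    ultimately have "(\<Sum>j\<in>J. (a j \<bullet> x)\<^sup>2) = 0" by simp
    then show ?thesis using J by (auto simp: W_def sum_nonneg_eq_0_iff)
  qed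
  \<comment> \<open>In a direction \<open>w\<close> of \<open>W\<close> the terms
    \<open>v j z *\<^sub>R a j\<close> are orthogonal to \<open>w\<close>, so the strong
    monotonicity of \<open>G\<close> passes in the limit to the regular part
    \<open>1 + B\<close>.\<close>
  have Wpos: "(norm w)\<^sup>2 / 2 \<le> (w + B w) \<bullet> w" if w: "w \<in> W" for w
  proof (rule field_le_epsilon)
    fix e :: real assume "e > 0"
    define e2 where "e2 = e / ((norm w)\<^sup>2 + 1)"
    have e2: "e2 > 0" "e2 * (norm w)\<^sup>2 \<le> e" using \<open>e > 0\<close> by (auto simp: e2_def field_simps add_pos_nonneg)
    have lim: "((\<lambda>t. z0 + t *\<^sub>R w) \<longlongrightarrow> z0) (at_right 0)" by (auto intro!: tendsto_eq_intros)
    have "\<forall>\<^sub>F z in nhds z0. norm (E z - E z0 - B (z - z0)) \<le> e2 * norm (z - z0)"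
      using eventually_nhds_pair_left[OF has_strict_derivative_eventually[OF E e2(1)]] by simp
    from eventually_conj[OF this G] have "\<forall>\<^sub>F z in nhds z0. norm (E z - E z0 - B (z - z0)) \<le> e2 * norm (z - z0) \<and>
      G z = z + (\<Sum>j\<in>J. v j z *\<^sub>R a j) + E z" .
    from eventually_conj[OF eventually_compose_filterlim[OF this lim] eventually_at_right_less[of 0]]
    obtain t :: real where t: "t > 0" "norm (E (z0 + t *\<^sub>R w) - E z0 - B (t *\<^sub>R w)) \<le> e2 * norm (t *\<^sub>R w)"
      "G (z0 + t *\<^sub>R w) = z0 + t *\<^sub>R w + (\<Sum>j\<in>J. v j (z0 + t *\<^sub>R w) *\<^sub>R a j) + E (z0 + t *\<^sub>R w)"
      by (auto dest: eventually_happens'[rotated])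
    let ?z = "z0 + t *\<^sub>R w" and ?r = "E (z0 + t *\<^sub>R w) - E z0 - B (t *\<^sub>R w)"
    have G0: "G z0 = z0 + (\<Sum>j\<in>J. v j z0 *\<^sub>R a j) + E z0" using G by (rule eventually_nhds_x_imp_x)
    have S0: "(\<Sum>j\<in>J. v j z *\<^sub>R a j) \<bullet> w = 0" for z
      using w by (simp add: inner_sum_left W_def)
    have "t * (t * ((norm w)\<^sup>2 / 2)) = (norm (?z - z0))\<^sup>2 / 2" using t(1) by (simp add: power2_eq_square)
    also have "\<dots> \<le> (G ?z - G z0) \<bullet> (?z - z0)" by (rule mono)
    also have "\<dots> = t * ((G ?z - G z0) \<bullet> w)" by simp
    also have "(G ?z - G z0) \<bullet> w = t * ((w + B w) \<bullet> w) + ?r \<bullet> w"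
      unfolding t(3) G0 using S0[of ?z] S0[of z0] by (simp add: algebra_simps B.scaleR)
    also have "?r \<bullet> w \<le> (e2 * norm (t *\<^sub>R w)) * norm w"
      using t(2) by (intro order.trans[OF norm_cauchy_schwarz] mult_right_mono) auto
    also have "\<dots> = t * (e2 * (norm w)\<^sup>2)" using t(1) by (simp add: power2_eq_square)
    also have "\<dots> \<le> t * e" using e2 t(1) by simp
    finally have "t * (t * ((norm w)\<^sup>2 / 2)) \<le> t * (t * ((w + B w) \<bullet> w + e))"
      using t(1) by (simp add: algebra_simps)
    then show "(norm w)\<^sup>2 / 2 \<le> (w + B w) \<bullet> w + e" using t(1) by (simp only: mult_le_cancel_left_pos)
  qed
  have LW: "x \<in> W" if "L x \<in> W" for x
  proof (rule QW)
    have "Q x = L x - P (x + B x)" by (simp add: L_def)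
    then show "Q x \<in> W" using subspace_diff[OF W that P(2)] by simp
  qed
  have "inj L"
  proof (subst linear_injective_0[OF linL], intro allI impI)
    fix x assume "L x = 0"
    then have xW: "x \<in> W" using subspace_0[OF W] by (simp add: LW)
    then have "Q x = 0" by (simp add: Q_def W_def)
    with \<open>L x = 0\<close> have "P (x + B x) \<bullet> x = 0" by (simp add: L_def)
    then have "(norm x)\<^sup>2 / 2 \<le> 0" using Wpos[OF xW] P(3)[OF xW] by simp
    then show "x = 0" by simp
  qed
  then obtain M where M: "linear M" "\<And>x. L (M x) = x" "\<And>x. M (L x) = x"
    using linear_injective_isomorphism[OF linL] by blast
  define D where "D x = M (P x)" for x
  have linD: "bounded_linear D" unfolding D_def linear_conv_bounded_linear[symmetric]
    using linear_compose[OF P(1) M(1)] by (simp add: o_def)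
  have DW: "D x \<in> W" for x by (rule LW) (simp add: D_def M(2) P(2))
  have "bounded_linear M" "bounded_linear P" using M(1) P(1) by (simp_all add: linear_conv_bounded_linear)
  then interpret M: bounded_linear M + P': bounded_linear P .
  define A where "A = (\<Sum>j\<in>J. norm (a j))"
  have A: "A \<ge> 0" unfolding A_def by (intro sum_nonneg) auto
  have strict: "has_strict_derivative h D (G z0)"
  proof (rule has_strict_derivative_I[OF linD])
    fix e :: real assume "e > 0"
    define \<eta> where "\<eta> = min 1 (e / (onorm M * (2 * onorm P + A) + 1))"
    have nn: "onorm M * (2 * onorm P + A) \<ge> 0"
      using A onorm_pos_le[OF M.bounded_linear_axioms] onorm_pos_le[OF P'.bounded_linear_axioms] by simp
    have \<eta>: "\<eta> > 0" "\<eta> \<le> 1" "onorm M * (2 * onorm P + A) * \<eta> \<le> e"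
    proof -
      show "\<eta> > 0" using nn \<open>e > 0\<close> by (simp add: \<eta>_def)
      show "\<eta> \<le> 1" by (simp add: \<eta>_def)
      have "onorm M * (2 * onorm P + A) * \<eta> \<le> (onorm M * (2 * onorm P + A) + 1) * (e / (onorm M * (2 * onorm P + A) + 1))"
        using nn \<open>e > 0\<close> by (intro mult_mono) (auto simp: \<eta>_def)
      also have "\<dots> = e" using nn by simp
      finally show "onorm M * (2 * onorm P + A) * \<eta> \<le> e" .
    qed
    \<comment> \<open>The estimate of \<open>small\<close> below ends with \<open>N * (a j \<bullet>
      \<delta>)\<^sup>2 \<le> norm \<xi> * norm \<delta> + (onorm B + \<eta> + A) * (norm
      \<delta>)\<^sup>2\<close>. Inserting \<open>norm \<delta> \<le> 2 * norm \<xi>\<close> turns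
      the right-hand side into \<open>c * (norm \<xi>)\<^sup>2\<close>, and \<open>N\<close> is
      chosen to make the quotient \<open>\<eta>\<^sup>2\<close>.\<close>
    define c where "c = 2 + 4 * (onorm B + \<eta> + A)"
    have c: "c > 0" using A \<eta>(1) onorm_pos_le[OF B.bounded_linear_axioms] by (simp add: c_def add_pos_nonneg)
    define N where "N = c / \<eta>\<^sup>2"
    have N: "N > 0" using c \<eta>(1) by (simp add: N_def)
    have evJ: "\<forall>\<^sub>F q in nhds (z0, z0). \<forall>j\<in>J. \<exists>\<alpha>\<ge>N. \<bar>v j (fst q) - v j (snd q) - \<alpha> * (a j \<bullet> (fst q - snd q))\<bar>
        \<le> 1 * norm (fst q - snd q)"
    proof (intro eventually_ball_finite J ballI)
      fix j assume "j \<in> J"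
      then obtain \<omega> where \<omega>: "(\<omega> \<longlongrightarrow> 0) (nhds (z0, z0))"
        "\<forall>\<^sub>F q in nhds (z0, z0). \<exists>\<alpha>\<ge>N. \<bar>v j (fst q) - v j (snd q) - \<alpha> * (a j \<bullet> (fst q - snd q))\<bar> \<le> \<omega> q * norm (fst q - snd q)"
        using sing unfolding singular_along_def by blast
      have "\<forall>\<^sub>F q in nhds (z0, z0). \<omega> q < 1" by (rule order_tendstoD(2)[OF \<omega>(1)]) simp
      then show "\<forall>\<^sub>F q in nhds (z0, z0). \<exists>\<alpha>\<ge>N. \<bar>v j (fst q) - v j (snd q) - \<alpha> * (a j \<bullet> (fst q - snd q))\<bar> \<le> 1 * norm (fst q - snd q)"
        using \<omega>(2)
      proof eventually_elim
        case (elim q)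
        have "\<omega> q * norm (fst q - snd q) \<le> 1 * norm (fst q - snd q)"
          using elim(1) by (intro mult_right_mono) auto
        then show ?case using elim(2) by (meson order.trans)
      qed
    qed
    have evG: "\<forall>\<^sub>F q in nhds (z0, z0). G (fst q) = fst q + (\<Sum>j\<in>J. v j (fst q) *\<^sub>R a j) + E (fst q) \<and>
        G (snd q) = snd q + (\<Sum>j\<in>J. v j (snd q) *\<^sub>R a j) + E (snd q)"
      unfolding nhds_prod using G by (auto simp: eventually_prod_filter)
    have "\<forall>\<^sub>F q in nhds (z0, z0). norm (fst q - snd q - D (G (fst q) - G (snd q))) \<le> e * norm (G (fst q) - G (snd q))"
      using evJ evG has_strict_derivative_eventually[OF E \<eta>(1)]
    proof eventually_elim
      case (elim q)
      let ?y = "fst q" and ?z = "snd q"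
      define \<delta> where "\<delta> = ?y - ?z"
      define \<xi> where "\<xi> = G ?y - G ?z"
      define r where "r = E ?y - E ?z - B \<delta>"
      have r: "norm r \<le> \<eta> * norm \<delta>" using elim(3) by (simp add: r_def \<delta>_def)
      have d\<xi>: "norm \<delta> \<le> 2 * norm \<xi>" using Lip[of "G ?y" "G ?z"] by (simp add: inv \<delta>_def \<xi>_def)
      obtain \<alpha> where \<alpha>: "\<And>j. j \<in> J \<Longrightarrow> \<alpha> j \<ge> N"
        "\<And>j. j \<in> J \<Longrightarrow> \<bar>v j ?y - v j ?z - \<alpha> j * (a j \<bullet> \<delta>)\<bar> \<le> norm \<delta>"
        using elim(1) unfolding \<delta>_def by (simp add: bchoice_iff) metis
      have \<xi>: "\<xi> = \<delta> + (\<Sum>j\<in>J. (v j ?y - v j ?z) *\<^sub>R a j) + B \<delta> + r"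
        using elim(2) by (simp add: \<xi>_def \<delta>_def r_def scaleR_diff_left sum_subtractf)
      \<comment> \<open>A displacement of size \<open>\<bar>a j \<bullet> \<delta>\<bar>\<close>
        costs at least \<open>N * (a j \<bullet> \<delta>)\<^sup>2\<close> in
        \<open>\<xi> \<bullet> \<delta>\<close>, up to terms of order
        \<open>(norm \<delta>)\<^sup>2\<close>. Since the costs of all facets have the same sign,
        each is controlled by the total.\<close>
      have small: "\<bar>a j \<bullet> \<delta>\<bar> \<le> \<eta> * norm \<xi>" if j: "j \<in> J" for j
      proof -
        have term_ge: "N * (a i \<bullet> \<delta>)\<^sup>2 - norm (a i) * (norm \<delta>)\<^sup>2 \<le> (v i ?y - v i ?z) * (a i \<bullet> \<delta>)" if "i \<in> J" for i
        proof -
          have "\<bar>(v i ?y - v i ?z - \<alpha> i * (a i \<bullet> \<delta>)) * (a i \<bullet> \<delta>)\<bar> \<le> norm \<delta> * (norm (a i) * norm \<delta>)"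
            unfolding abs_mult using \<alpha>(2)[OF that] by (intro mult_mono Cauchy_Schwarz_ineq2) auto
          moreover have "(v i ?y - v i ?z) * (a i \<bullet> \<delta>) = \<alpha> i * (a i \<bullet> \<delta>)\<^sup>2
              + (v i ?y - v i ?z - \<alpha> i * (a i \<bullet> \<delta>)) * (a i \<bullet> \<delta>)"
            by (simp add: algebra_simps power2_eq_square)
          moreover have "N * (a i \<bullet> \<delta>)\<^sup>2 \<le> \<alpha> i * (a i \<bullet> \<delta>)\<^sup>2"
            using \<alpha>(1)[OF that] by (intro mult_right_mono) auto
          ultimately show ?thesis by (simp add: power2_eq_square abs_le_iff algebra_simps)
        qed
        have "N * (a j \<bullet> \<delta>)\<^sup>2 - A * (norm \<delta>)\<^sup>2 \<le> (\<Sum>i\<in>J. N * (a i \<bullet> \<delta>)\<^sup>2) - A * (norm \<delta>)\<^sup>2"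
          using J j N by (intro diff_right_mono member_le_sum) auto
        also have "\<dots> = (\<Sum>i\<in>J. N * (a i \<bullet> \<delta>)\<^sup>2 - norm (a i) * (norm \<delta>)\<^sup>2)"
          by (simp add: sum_subtractf A_def sum_distrib_right)
        also have "\<dots> \<le> (\<Sum>i\<in>J. (v i ?y - v i ?z) * (a i \<bullet> \<delta>))" by (intro sum_mono term_ge)
        also have "\<dots> = \<xi> \<bullet> \<delta> - \<delta> \<bullet> \<delta> - B \<delta> \<bullet> \<delta> - r \<bullet> \<delta>"
          unfolding \<xi> by (simp add: inner_left_distrib inner_sum_left)
        also have "\<dots> \<le> norm \<xi> * norm \<delta> + onorm B * norm \<delta> * norm \<delta> + \<eta> * norm \<delta> * norm \<delta>"
        proof -
          have "\<bar>B \<delta> \<bullet> \<delta>\<bar> \<le> onorm B * norm \<delta> * norm \<delta>"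
            using onorm[OF B.bounded_linear_axioms, of \<delta>]
            by (intro order.trans[OF Cauchy_Schwarz_ineq2] mult_right_mono) auto
          moreover have "\<bar>r \<bullet> \<delta>\<bar> \<le> \<eta> * norm \<delta> * norm \<delta>"
            using r by (intro order.trans[OF Cauchy_Schwarz_ineq2] mult_right_mono) auto
          moreover have "\<xi> \<bullet> \<delta> \<le> norm \<xi> * norm \<delta>" by (rule norm_cauchy_schwarz)
          moreover have "0 \<le> \<delta> \<bullet> \<delta>" by simp
          ultimately show ?thesis by linarith
        qed
        finally have "N * (a j \<bullet> \<delta>)\<^sup>2 \<le> norm \<xi> * norm \<delta> + (onorm B + \<eta> + A) * (norm \<delta>)\<^sup>2"
          by (simp add: power2_eq_square algebra_simps)
        also have "\<dots> \<le> norm \<xi> * (2 * norm \<xi>) + (onorm B + \<eta> + A) * (2 * norm \<xi>)\<^sup>2"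
          using d\<xi> A \<eta>(1) onorm_pos_le[OF B.bounded_linear_axioms]
          by (intro add_mono mult_left_mono power_mono) auto
        also have "\<dots> = c * (norm \<xi>)\<^sup>2" by (simp add: c_def algebra_simps power2_eq_square)
        finally have "(a j \<bullet> \<delta>)\<^sup>2 \<le> (\<eta> * norm \<xi>)\<^sup>2"
          using c \<eta>(1) by (simp add: N_def field_simps power_mult_distrib)
        then show ?thesis using \<eta>(1) by (simp add: abs_le_square_iff[symmetric])
      qed
      \<comment> \<open>\<open>P\<close> removes the singular terms exactly, whatever their size.
        What is left compares \<open>L \<delta>\<close> with \<open>P \<xi>\<close> up to
        \<open>Q \<delta>\<close>, small by the previous step, and the remainder of
        \<open>E\<close>.\<close>
      have "P \<xi> = P (\<delta> + B \<delta>) + P r"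
        unfolding \<xi> by (simp add: P.add P.sum P.scale Pa)
      then have "L \<delta> - P \<xi> = Q \<delta> - P r" by (simp add: L_def)
      then have "\<delta> - D \<xi> = M (Q \<delta> - P r)"
        by (metis D_def M(3) M.diff)
      also have "norm \<dots> \<le> onorm M * norm (Q \<delta> - P r)" by (rule onorm[OF M.bounded_linear_axioms])
      also have "norm (Q \<delta> - P r) \<le> (2 * onorm P + A) * \<eta> * norm \<xi>"
      proof -
        have "norm (Q \<delta>) \<le> (\<Sum>j\<in>J. \<eta> * norm \<xi> * norm (a j))"
          unfolding Q_def using small
          by (intro order.trans[OF norm_sum] sum_mono) (auto intro: mult_right_mono)
        also have "\<dots> = A * (\<eta> * norm \<xi>)" by (simp add: A_def sum_distrib_left mult.commute)
        finally have 1: "norm (Q \<delta>) \<le> A * (\<eta> * norm \<xi>)" .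
        have "norm (P r) \<le> onorm P * norm r" by (rule onorm[OF P'.bounded_linear_axioms])
        also have "\<dots> \<le> onorm P * (\<eta> * (2 * norm \<xi>))"
          using d\<xi> \<eta>(1) onorm_pos_le[OF P'.bounded_linear_axioms]
          by (intro mult_left_mono order.trans[OF r]) auto
        finally show ?thesis using 1 norm_triangle_ineq4[of "Q \<delta>" "P r"] by (simp add: algebra_simps)
      qed
      finally have "norm (\<delta> - D \<xi>) \<le> onorm M * ((2 * onorm P + A) * \<eta> * norm \<xi>)"
        using onorm_pos_le[OF M.bounded_linear_axioms] by (simp add: mult_left_mono)
      also have "\<dots> \<le> e * norm \<xi>" using mult_right_mono[OF \<eta>(3), of "norm \<xi>"] by (simp add: mult.assoc)
      finally show ?case by (simp add: \<delta>_def \<xi>_def)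
    qed
    \<comment> \<open>The estimate so far concerns pairs \<open>G y\<close>, \<open>G z\<close>. As
      \<open>G\<close> is onto with continuous inverse \<open>h\<close>, these are all pairs near
      \<open>(G z0, G z0)\<close>.\<close>
    moreover have "filterlim (\<lambda>p. (h (fst p), h (snd p))) (nhds (z0, z0)) (nhds (G z0, G z0))"
    proof -
      have "2-lipschitz_on UNIV h" using Lip by (intro lipschitz_onI) (auto simp: dist_norm)
      then have "isCont h (G z0)"
        using lipschitz_on_continuous_on continuous_on_eq_continuous_at by blast
      from tendsto_fst_nhds[OF this] tendsto_snd_nhds[OF this] show ?thesis
        unfolding nhds_prod inv by (intro filterlim_Pair) (simp_all add: inv)
    qed
    ultimately show "\<forall>\<^sub>F p in nhds (G z0, G z0). norm (h (fst p) - h (snd p) - D (fst p - snd p)) \<le> e * norm (fst p - snd p)"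
      by (auto dest: eventually_compose_filterlim simp: inv)
  qed
  show ?thesis
    by (rule that[OF strict]) (use DW in \<open>auto simp: W_def\<close>)
qed

lemma sums_half_powers: "(\<lambda>j. (1/2) ^ (j + 2) :: real) sums (1/2)"
  using sums_mult[OF power_half_series, of "1/2"] by (simp add: power_Suc)

lemma compact_Union_cball:
  fixes K :: "'a::euclidean_space set"
  assumes "compact K"
  shows "compact (\<Union>x\<in>K. cball x r)"
proof -
  have "(\<Union>x\<in>K. cball x r) = {x + y |x y. x \<in> K \<and> y \<in> cball 0 r}"
    by (auto simp: dist_norm)
      (metis add_diff_cancel_left' diff_add_cancel norm_minus_commute add.commute)+
  then show ?thesis using compact_sums[OF assms compact_cball[of 0 r]] by simp
qed

text \<open>The weights \<open>p j\<close> sum to 1/2. With one-sided bounds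
  \<open>- p j * (norm (y - z))\<^sup>2\<close> the total perturbation \<open>V\<close> therefore
  spoils at most half of the monotonicity of the identity, and the inverse is 2-Lipschitz. The same
  weights multiplied by \<open>\<tau>\<close> bound the displacement. The index set may be finite or
  infinite, so indices outside \<open>I\<close> get the zero function.\<close>

lemma facet_collapsing_map_exists:
  fixes \<Omega> :: "'a::euclidean_space set" and F :: "nat \<Rightarrow> 'a set"
  assumes F: "\<And>j. j \<in> I \<Longrightarrow> compact (F j)" "\<And>j. j \<in> I \<Longrightarrow> convex (F j)" "\<And>j. j \<in> I \<Longrightarrow> F j \<noteq> {}"
      "\<And>j. j \<in> I \<Longrightarrow> F j \<subseteq> {x. a j \<bullet> x = b j}"
    and r: "\<And>j. j \<in> I \<Longrightarrow> r j > 0"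
    and S: "\<And>j. j \<in> I \<Longrightarrow> S j = (\<Union>x\<in>F j. cball x (r j))" "\<And>j. j \<in> I \<Longrightarrow> S j \<subseteq> \<Omega>"
    and fin: "\<And>z. z \<in> \<Omega> \<Longrightarrow> \<exists>e>0. finite {j \<in> I. S j \<inter> ball z e \<noteq> {}}"
    and \<tau>: "continuous_on \<Omega> \<tau>" "\<And>z. z \<in> \<Omega> \<Longrightarrow> 0 < \<tau> z" "\<And>z. \<tau> z \<le> 1"
  obtains h where "inj h" "\<And>x y. norm (h x - h y) \<le> 2 * norm (x - y)"
    "\<And>x. x \<in> \<Omega> \<Longrightarrow> h x \<in> \<Omega>" "\<And>x. x \<in> \<Omega> \<Longrightarrow> norm (x - h x) \<le> \<tau> (h x)"
    "\<And>x. x \<notin> (\<Union>j\<in>I. S j) \<Longrightarrow> h x = x"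
    "\<And>x. x \<in> \<Omega> \<Longrightarrow> \<exists>D. has_strict_derivative h D x \<and> (\<forall>j\<in>I. h x \<in> F j \<longrightarrow> (\<forall>v. a j \<bullet> D v = 0))"
proof -
  define p :: "nat \<Rightarrow> real" where "p j = (1/2) ^ (j + 2)" for j
  have p: "p j > 0" for j by (simp add: p_def)
  have psums: "p sums (1/2)" unfolding p_def by (rule sums_half_powers)
  have "\<exists>u. (\<forall>z. isCont u z) \<and> (\<forall>z. u z \<noteq> 0 \<longrightarrow> j \<in> I \<and> z \<in> S j) \<and>
      (\<forall>z\<in>\<Omega>. \<bar>u z\<bar> * norm (a j) \<le> p j * \<tau> z) \<and>
      (\<forall>y z. - p j * (norm (y - z))\<^sup>2 \<le> (u y - u z) * (a j \<bullet> (y - z))) \<and>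
      (j \<in> I \<longrightarrow> (\<forall>z\<in>F j. singular_along u (a j) z) \<and> (\<forall>z. z \<notin> F j \<longrightarrow> (\<exists>D. has_strict_derivative u D z)))" for j
  proof (cases "j \<in> I")
    case False
    then show ?thesis using p[of j] \<tau>(2) by (intro exI[of _ "\<lambda>_. 0"]) (auto simp: less_imp_le)
  next
    case True
    obtain v C where v: "\<And>z. isCont v z" "\<And>z. \<bar>v z\<bar> \<le> C"
      "\<And>z. (\<And>x. x \<in> F j \<Longrightarrow> r j \<le> dist z x) \<Longrightarrow> v z = 0"
      "\<And>y z. - C * (norm (y - z))\<^sup>2 \<le> (v y - v z) * (a j \<bullet> (y - z))"
      "\<And>z. z \<in> F j \<Longrightarrow> singular_along v (a j) z"
      "\<And>z. z \<notin> F j \<Longrightarrow> \<exists>D. has_strict_derivative v D z"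
      using facet_profile_exists[OF compact_imp_closed[OF F(1)] F(2-4) r, OF True True True True True] by metis
    have C: "C \<ge> 0" using v(2)[of 0] by simp
    have vS: "z \<in> S j" if "v z \<noteq> 0" for z
    proof (rule ccontr)
      assume "z \<notin> S j"
      then have "r j \<le> dist z x" if "x \<in> F j" for x using that S(1)[OF True] by (auto simp: dist_commute)
      then show False using v(3) that by blast
    qed
    have "compact (S j)" unfolding S(1)[OF True] by (rule compact_Union_cball[OF F(1)[OF True]])
    moreover have "S j \<noteq> {}" using F(3)[OF True] r[OF True] by (auto simp: S(1)[OF True] intro!: exI[of _ "_ :: 'a"] less_imp_le)
    ultimately obtain z0 where z0: "z0 \<in> S j" "\<And>z. z \<in> S j \<Longrightarrow> \<tau> z0 \<le> \<tau> z"
      using continuous_attains_inf[OF _ _ continuous_on_subset[OF \<tau>(1) S(2)[OF True]]] by blast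
    define m where "m = \<tau> z0"
    have m: "m > 0" "m \<le> 1" using z0(1) S(2)[OF True] \<tau> by (auto simp: m_def)
    \<comment> \<open>\<open>m\<close> is the minimum of \<open>\<tau>\<close> on the compact
      support. The denominator dominates both \<open>C * norm (a j)\<close>, which is needed for the
      displacement, and \<open>C\<close>, which is needed for the monotonicity; there
      \<open>m \<le> 1\<close> is used.\<close>
    define c where "c = p j * m / ((C + 1) * (1 + norm (a j)))"
    have den: "(C + 1) * (1 + norm (a j)) > 0" using C by (simp add: add_nonneg_pos add_pos_nonneg)
    have c: "c > 0" using p[of j] m den by (simp add: c_def)
    have cden: "c * ((C + 1) * (1 + norm (a j))) = p j * m"
      unfolding c_def using den by (metis less_irrefl nonzero_eq_divide_eq)
    have "C * norm (a j) \<le> (C + 1) * (1 + norm (a j))" "C \<le> (C + 1) * (1 + norm (a j))"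
      using C by (auto simp: algebra_simps)
    from mult_left_mono[OF this(1), of c] mult_left_mono[OF this(2), of c]
    have cC: "c * (C * norm (a j)) \<le> p j * m" "c * C \<le> p j * m" using c unfolding cden by auto
    show ?thesis
    proof (rule exI[of _ "\<lambda>z. c * v z"], intro conjI allI ballI impI)
      show "isCont (\<lambda>z. c * v z) z" for z by (intro continuous_intros v)
      show "j \<in> I" by fact
      show "z \<in> S j" if "c * v z \<noteq> 0" for z using that by (intro vS) simp
      show "\<bar>c * v z\<bar> * norm (a j) \<le> p j * \<tau> z" if "z \<in> \<Omega>" for z
      proof (cases "v z = 0")
        case True
        then show ?thesis using p[of j] \<tau>(2)[OF that] by simp
      next
        case False
        have "\<bar>c * v z\<bar> * norm (a j) = c * (\<bar>v z\<bar> * norm (a j))" using c by (simp add: abs_mult)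
        also have "\<dots> \<le> c * (C * norm (a j))" using c v(2) by (intro mult_left_mono mult_right_mono) auto
        also have "\<dots> \<le> p j * m" by (rule cC)
        also have "\<dots> \<le> p j * \<tau> z" using p[of j] z0(2)[OF vS[OF False]] by (simp add: m_def)
        finally show ?thesis .
      qed
      show "- p j * (norm (y - z))\<^sup>2 \<le> (c * v y - c * v z) * (a j \<bullet> (y - z))" for y z
      proof -
        have "c * C \<le> p j" using cC(2) mult_left_mono[OF m(2), of "p j"] p[of j] by linarith
        from mult_right_mono[OF this, of "(norm (y - z))\<^sup>2"]
        have "- p j * (norm (y - z))\<^sup>2 \<le> c * (- C * (norm (y - z))\<^sup>2)" by simp
        also have "\<dots> \<le> c * ((v y - v z) * (a j \<bullet> (y - z)))" using v(4)[of y z] c by (intro mult_left_mono) auto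
        finally show ?thesis by (simp add: algebra_simps)
      qed
      show "singular_along (\<lambda>z. c * v z) (a j) z" if "z \<in> F j" for z
        by (rule singular_along_scale[OF v(5)[OF that] c])
      show "\<exists>D. has_strict_derivative (\<lambda>z. c * v z) D z" if "z \<notin> F j" for z
        using has_strict_derivative_mult[OF has_strict_derivative_const] v(6)[OF that] by blast
    qed
  qed
  then obtain u where u: "\<And>j z. isCont (u j) z" "\<And>j z. u j z \<noteq> 0 \<Longrightarrow> j \<in> I \<and> z \<in> S j"
      "\<And>j z. z \<in> \<Omega> \<Longrightarrow> \<bar>u j z\<bar> * norm (a j) \<le> p j * \<tau> z"
      "\<And>j y z. - p j * (norm (y - z))\<^sup>2 \<le> (u j y - u j z) * (a j \<bullet> (y - z))"
      "\<And>j z. j \<in> I \<Longrightarrow> z \<in> F j \<Longrightarrow> singular_along (u j) (a j) z"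
      "\<And>j z. j \<in> I \<Longrightarrow> z \<notin> F j \<Longrightarrow> \<exists>D. has_strict_derivative (u j) D z"
    by metis
  have term_p: "norm (u j z *\<^sub>R a j) \<le> p j" for j z
  proof (cases "z \<in> \<Omega>")
    case True
    then show ?thesis
      using u(3)[OF True, of j] mult_left_mono[OF \<tau>(3)[of z], of "p j"] p[of j]
      unfolding norm_scaleR by linarith
  next
    case False
    then have "u j z = 0" using u(2)[of j z] S(2)[of j] by blast
    then show ?thesis using p[of j] by simp
  qed
  define V where "V z = (\<Sum>j. u j z *\<^sub>R a j)" for z
  have summ: "summable (\<lambda>j. u j z *\<^sub>R a j)" for z
    using term_p by (intro summable_comparison_test'[OF sums_summable[OF psums]]) auto
  have V_sums: "(\<lambda>j. u j z *\<^sub>R a j) sums V z" for z unfolding V_def by (rule summable_sums[OF summ])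
  have V_cont: "continuous_on UNIV V"
  proof (rule uniform_limit_theorem)
    show "uniform_limit UNIV (\<lambda>n z. \<Sum>j<n. u j z *\<^sub>R a j) V sequentially"
      unfolding V_def by (rule Weierstrass_m_test[OF term_p sums_summable[OF psums]])
    show "\<forall>\<^sub>F n in sequentially. continuous_on UNIV (\<lambda>z. \<Sum>j<n. u j z *\<^sub>R a j)"
      by (intro always_eventually allI continuous_at_imp_continuous_on ballI continuous_intros u(1))
  qed simp
  have V_le: "norm (V z) \<le> \<tau> z / 2" if "z \<in> \<Omega>" for z
  proof -
    have ps: "(\<lambda>j. p j * \<tau> z) sums (1/2 * \<tau> z)" by (rule sums_mult2[OF psums])
    have t: "norm (u j z *\<^sub>R a j) \<le> p j * \<tau> z" for j using u(3)[OF that] by simp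
    have "norm (V z) \<le> (\<Sum>j. p j * \<tau> z)"
      unfolding V_def using t by (intro norm_suminf_le sums_summable[OF ps])
    also have "\<dots> = \<tau> z / 2" using sums_unique[OF ps] by simp
    finally show ?thesis .
  qed
  have V_0: "V z = 0" if "z \<notin> (\<Union>j\<in>I. S j)" for z
  proof -
    have "u j z = 0" for j using u(2)[of j z] that by blast
    then show ?thesis by (simp add: V_def)
  qed
  have V_le1: "norm (V z) \<le> 1" for z
    using V_le[of z] \<tau>(3)[of z] V_0[of z] S(2) by (cases "z \<in> \<Omega>") fastforce+
  have V_mono: "- (1/2) * (norm (y - z))\<^sup>2 \<le> (V y - V z) \<bullet> (y - z)" for y z
  proof (rule sums_le)
    show "(\<lambda>j. (u j y - u j z) * (a j \<bullet> (y - z))) sums ((V y - V z) \<bullet> (y - z))"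
      using bounded_linear.sums[OF bounded_linear_inner_left sums_diff[OF V_sums V_sums], of y z "y - z"]
      by (simp add: algebra_simps)
    show "(\<lambda>j. - p j * (norm (y - z))\<^sup>2) sums (- (1/2) * (norm (y - z))\<^sup>2)"
      by (intro sums_mult2 sums_minus psums)
  qed (rule u(4))
  define G where "G z = z + V z" for z
  have mono: "(norm (y - z))\<^sup>2 / 2 \<le> (G y - G z) \<bullet> (y - z)" for y z
  proof -
    have "(G y - G z) \<bullet> (y - z) = (norm (y - z))\<^sup>2 + (V y - V z) \<bullet> (y - z)"
      unfolding power2_norm_eq_inner by (simp add: G_def algebra_simps)
    then show ?thesis using V_mono[of y z] by linarith
  qed
  have expand: "norm (y - z) \<le> 2 * norm (G y - G z)" for y z
  proof (cases "y = z")
    case False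
    have "norm (y - z) * norm (y - z) \<le> (2 * norm (G y - G z)) * norm (y - z)"
      using mono[of y z] norm_cauchy_schwarz[of "G y - G z" "y - z"] by (simp add: power2_eq_square)
    then show ?thesis using False by simp
  qed simp
  have injG: "inj G" using expand by (intro injI) (metis diff_self norm_le_zero_iff norm_zero mult_zero_right right_minus_eq)
  \<comment> \<open>Solving \<open>G z = x\<close> is a fixed point problem for
    \<open>x - V z\<close>, and \<open>norm (V z) \<le> 1\<close> keeps it in the unit ball around
    \<open>x\<close>.\<close>
  have surjG: "\<exists>z. G z = x" for x
  proof -
    have "continuous_on (cball x 1) (\<lambda>z. x - V z)"
      by (intro continuous_intros continuous_on_subset[OF V_cont]) auto
    moreover have "(\<lambda>z. x - V z) \<in> cball x 1 \<rightarrow> cball x 1" using V_le1 by (auto simp: dist_norm)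
    ultimately obtain z where "x - V z = z"
      using brouwer[of "cball x 1" "\<lambda>z. x - V z"] by auto
    then show ?thesis by (intro exI[of _ z]) (simp add: G_def algebra_simps)
  qed
  define h where "h = inv G"
  have hG: "h (G z) = z" for z unfolding h_def by (rule inv_f_f[OF injG])
  have Gh: "G (h x) = x" for x using surjG[of x] hG by metis
  have Lip: "norm (h x - h y) \<le> 2 * norm (x - y)" for x y using expand[of "h x" "h y"] by (simp add: Gh)
  \<comment> \<open>The supports lie in \<open>\<Omega>\<close>, so \<open>G\<close> is the identity
    on the complement of \<open>\<Omega>\<close> and no point of \<open>\<Omega>\<close> can come
    from there.\<close>
  have h\<Omega>: "h x \<in> \<Omega>" if "x \<in> \<Omega>" for x
  proof (rule ccontr)
    assume "h x \<notin> \<Omega>"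
    then have "V (h x) = 0" using S(2) by (intro V_0) auto
    then show False using Gh[of x] that \<open>h x \<notin> \<Omega>\<close> by (simp add: G_def)
  qed
  show ?thesis
  proof (rule that[of h])
    show "inj h" by (rule injI) (metis Gh)
    show "norm (x - h x) \<le> \<tau> (h x)" if "x \<in> \<Omega>" for x
    proof -
      have "x - h x = V (h x)" using Gh[of x] by (simp add: G_def algebra_simps)
      then show ?thesis using V_le[OF h\<Omega>[OF that]] \<tau>(2)[OF h\<Omega>[OF that]] by simp
    qed
    show "h x = x" if "x \<notin> (\<Union>j\<in>I. S j)" for x
      using hG[of x] V_0[OF that] by (simp add: G_def)
    show "\<exists>D. has_strict_derivative h D x \<and> (\<forall>j\<in>I. h x \<in> F j \<longrightarrow> (\<forall>v. a j \<bullet> D v = 0))" if "x \<in> \<Omega>" for x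
    proof -
      let ?z = "h x"
      have "?z \<in> \<Omega>" by (rule h\<Omega>[OF that])
      from fin[OF this] obtain e where e: "e > 0" "finite {j \<in> I. S j \<inter> ball ?z e \<noteq> {}}" by blast
      \<comment> \<open>Near \<open>h x\<close> only finitely many terms are present. Those whose
        facet contains \<open>h x\<close> are singular there; the others form the regular part
        \<open>E\<close>.\<close>
      define N where "N = {j \<in> I. S j \<inter> ball ?z e \<noteq> {}}"
      define J where "J = {j \<in> N. ?z \<in> F j}"
      define E where "E y = (\<Sum>j\<in>N - J. u j y *\<^sub>R a j)" for y
      have finN: "finite N" and finJ: "finite J" using e(2) by (simp_all only: N_def J_def) (rule finite_subset[rotated], auto)
      have "V y = (\<Sum>j\<in>N. u j y *\<^sub>R a j)" if "y \<in> ball ?z e" for y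
      proof -
        have "u j y = 0" if "j \<notin> N" for j using u(2)[of j y] that \<open>y \<in> ball ?z e\<close> by (auto simp: N_def)
        then show ?thesis unfolding V_def by (intro suminf_finite[OF finN]) auto
      qed
      then have "G y = y + (\<Sum>j\<in>J. u j y *\<^sub>R a j) + E y" if "y \<in> ball ?z e" for y
        using that sum.subset_diff[of J N "\<lambda>j. u j y *\<^sub>R a j"] finN by (auto simp: G_def E_def J_def algebra_simps)
      then have 1: "\<forall>\<^sub>F y in nhds ?z. G y = y + (\<Sum>j\<in>J. u j y *\<^sub>R a j) + E y"
        using e(1) eventually_nhds_in_open[of "ball ?z e" ?z] by (auto elim: eventually_mono)
      have "\<forall>j\<in>N - J. \<exists>D. has_strict_derivative (u j) D ?z" using u(6) by (auto simp: N_def J_def)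
      then obtain D where "\<And>j. j \<in> N - J \<Longrightarrow> has_strict_derivative (u j) (D j) ?z" by metis
      then have 2: "has_strict_derivative E (\<lambda>v. \<Sum>j\<in>N - J. D j v *\<^sub>R a j) ?z"
        unfolding E_def by (intro has_strict_derivative_sum has_strict_derivative_scaleR_right)
      have 3: "singular_along (u j) (a j) ?z" if "j \<in> J" for j using u(5) that by (auto simp: N_def J_def)
      obtain D' where D': "has_strict_derivative h D' (G ?z)" "\<And>v j. j \<in> J \<Longrightarrow> a j \<bullet> D' v = 0"
        using strict_derivative_of_singular_inverse[OF finJ 1 3 2 mono Lip hG Gh] by metis
      have "j \<in> J" if "j \<in> I" "?z \<in> F j" for j
      proof -
        have "?z \<in> S j" using S(1)[OF that(1)] that(2) r[OF that(1)] by (auto intro!: bexI[of _ ?z])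
        then show ?thesis using that e(1) by (auto simp: J_def N_def intro!: exI[of _ ?z])
      qed
      then show ?thesis using D' by (auto simp: Gh)
    qed
  qed (fact Lip h\<Omega>)+
qed

section \<open>Approximation of piecewise affine maps\<close>

text \<open>Take a quarter of the distance from \<open>(x, x)\<close> to the complement of
  \<open>U\<close>. Moving \<open>x\<close> to \<open>y\<close> moves \<open>(x, x)\<close> by at
  most \<open>2 * norm (x - y)\<close>, so \<open>\<tau>\<close> is Lipschitz with constant 1/2.
  This gives the last property, which converts a displacement bound at the image point into one at
  the original point. The bound by 1 in the hypothesis keeps the complement nonempty;
  \<open>infdist\<close> to the empty set would be 0.\<close>

lemma diagonal_gauge_exists:
  fixes U :: "('a::euclidean_space \<times> 'a) set"
  assumes U: "open U" "\<And>x y. (x, y) \<in> U \<Longrightarrow> norm (x - y) < 1"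
  obtains \<tau> where "continuous_on UNIV \<tau>" "\<And>x. (x, x) \<in> U \<Longrightarrow> 0 < \<tau> x" "\<And>x. \<tau> x \<le> 1"
    "\<And>x y. norm (x - y) < 4 * \<tau> x \<Longrightarrow> (x, y) \<in> U"
    "\<And>x y. norm (x - y) \<le> \<tau> y \<Longrightarrow> norm (x - y) \<le> 2 * \<tau> x"
proof -
  obtain e :: 'a where e: "norm e = 1" using vector_choose_size[of 1] by auto
  have out: "(x, x + e) \<in> - U" for x using U(2)[of x "x + e"] e by auto
  then have ne: "- U \<noteq> {}" by blast
  have cl: "closed (- U)" using U(1) by (rule closed_Compl)
  define \<tau> where "\<tau> x = infdist (x, x) (- U) / 4" for x
  have d: "dist (x, y) (x, z) = norm (y - z)" for x y z :: 'a
    by (simp add: dist_Pair_Pair dist_norm)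
  show ?thesis
  proof (rule that[of \<tau>])
    show "continuous_on UNIV \<tau>" unfolding \<tau>_def by (intro continuous_intros) simp
    show "0 < \<tau> x" if "(x, x) \<in> U" for x
      using infdist_pos_not_in_closed[OF cl ne, of "(x, x)"] that by (simp add: \<tau>_def)
    show "\<tau> x \<le> 1" for x
      using infdist_le[OF out[of x], of "(x, x)"] e unfolding d by (simp add: \<tau>_def)
    show "(x, y) \<in> U" if "norm (x - y) < 4 * \<tau> x" for x y
    proof (rule ccontr)
      assume "(x, y) \<notin> U"
      then have "infdist (x, x) (- U) \<le> norm (x - y)" using infdist_le[of "(x, y)" "- U" "(x, x)"] unfolding d by simp
      with that show False by (simp add: \<tau>_def)
    qed
    show "norm (x - y) \<le> 2 * \<tau> x" if "norm (x - y) \<le> \<tau> y" for x y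
    proof -
      have "dist (y, y) (x, x) \<le> dist (y, y) (y, x) + dist (y, x) (x, x)" by (rule dist_triangle)
      also have "\<dots> = 2 * norm (x - y)" by (simp add: dist_Pair_Pair dist_norm norm_minus_commute)
      finally have "\<tau> y \<le> \<tau> x + norm (x - y) / 2"
        using infdist_triangle[of "(y, y)" "- U" "(x, x)"] by (simp add: \<tau>_def)
      with that show ?thesis by simp
    qed
  qed
qed

section \<open>Half-space descriptions, local finiteness and Jacobian matrices\<close>

lemma polyhedron_halfspaces:
  assumes "polyhedron T"
  shows "\<exists>H. finite H \<and> T = {x. \<forall>(a, b)\<in>H. a \<bullet> x \<le> b} \<and> (\<forall>(a, b)\<in>H. a \<noteq> 0)"
proof -
  obtain F where F: "finite F" "T = \<Inter>F" "\<forall>h\<in>F. \<exists>a b. a \<noteq> 0 \<and> h = {x. a \<bullet> x \<le> b}"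
    using assms unfolding polyhedron_def by blast
  then obtain A B where AB: "\<And>h. h \<in> F \<Longrightarrow> A h \<noteq> 0 \<and> h = {x. A h \<bullet> x \<le> B h}" by metis
  have "T = {x. \<forall>(a, b)\<in>(\<lambda>h. (A h, B h)) ` F. a \<bullet> x \<le> b}"
    unfolding F(2) using AB by (auto; blast)
  then show ?thesis using F(1) AB by (intro exI[of _ "(\<lambda>h. (A h, B h)) ` F"]) auto
qed

lemma compact_meets_finitely_many:
  fixes K :: "'a::metric_space set"
  assumes "compact K" "\<And>x. x \<in> K \<Longrightarrow> \<exists>r>0. finite {T \<in> \<T>. T \<inter> ball x r \<noteq> {}}"
  shows "finite {T \<in> \<T>. T \<inter> K \<noteq> {}}"
proof -
  obtain r where r: "\<And>x. x \<in> K \<Longrightarrow> r x > 0" "\<And>x. x \<in> K \<Longrightarrow> finite {T \<in> \<T>. T \<inter> ball x (r x) \<noteq> {}}"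
    using assms(2) by metis
  obtain X where X: "X \<subseteq> K" "finite X" "K \<subseteq> (\<Union>x\<in>X. ball x (r x))"
  proof (rule compactE_image[OF assms(1), of K "\<lambda>x. ball x (r x)"])
    show "K \<subseteq> (\<Union>x\<in>K. ball x (r x))" using r(1) by force
  qed auto
  have "{T \<in> \<T>. T \<inter> K \<noteq> {}} \<subseteq> (\<Union>x\<in>X. {T \<in> \<T>. T \<inter> ball x (r x) \<noteq> {}})"
    using X(3) by blast
  then show ?thesis using X r(2) by (auto elim!: finite_subset)
qed

lemma Jac_eq_matrix:
  fixes f :: "real^'n \<Rightarrow> real^'n"
  assumes "(f has_derivative D) (at x)"
  shows "Jac f x = matrix D"
  using frechet_derivative_at[OF assms] by (simp add: jacobian_def)

text \<open>Matrices carry the Euclidean norm of their entries. Each entry is at most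
  \<open>K\<close>, and both Euclidean sums are estimated by plain sums, whence the squared
  dimension.\<close>

lemma norm_matrix_le:
  fixes D :: "real^'n \<Rightarrow> real^'n"
  assumes "\<And>v. norm (D v) \<le> K * norm v"
  shows "norm (matrix D) \<le> (real CARD('n))\<^sup>2 * K"
proof -
  have comp: "\<bar>matrix D $ i $ j\<bar> \<le> K" for i j
    using component_le_norm_cart[of "D (axis j 1)" i] assms[of "axis j 1"] by (simp add: matrix_def)
  have "norm (matrix D $ i) \<le> (\<Sum>j\<in>(UNIV::'n set). K)" for i
    by (rule order.trans[OF norm_le_l1_cart]) (intro sum_mono comp)
  then have "norm (matrix D $ i) \<le> real CARD('n) * K" for i by simp
  then have "norm (matrix D) \<le> (\<Sum>i\<in>(UNIV::'n set). real CARD('n) * K)"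
    by (subst norm_vec_def, intro order.trans[OF L2_set_le_sum] sum_mono) auto
  then show ?thesis by (simp add: power2_eq_square)
qed

lemma strictly_differentiable_imp_C1_on:
  fixes g :: "real^'n \<Rightarrow> real^'n"
  assumes "open \<Omega>" and D: "\<And>x. x \<in> \<Omega> \<Longrightarrow> has_strict_derivative g (D x) x"
  shows "C1_on \<Omega> g"
  unfolding C1_on_def
proof (intro conjI ballI)
  have der: "(g has_derivative D x) (at x)" if "x \<in> \<Omega>" for x
    by (rule has_strict_derivative_imp_has_derivative[OF D[OF that]])
  then show "g differentiable (at x)" if "x \<in> \<Omega>" for x using that differentiableI by blast
  have "continuous_on \<Omega> (\<lambda>x. matrix (D x))"
    unfolding matrix_def
    by (intro continuous_on_vec_lambda continuous_on_component has_strict_derivative_continuous[OF assms])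
  then show "continuous_on \<Omega> (Jac g)"
    by (rule continuous_on_eq) (simp add: Jac_eq_matrix[OF der])
qed

section \<open>Countable subadditivity of the norm and thin neighbourhoods of null sets\<close>

context banach_function_norm
begin

lemma norm_zero: "\<rho> (\<lambda>_. 0) = 0"
  using norm_eq_0_iff[of "\<lambda>_. 0"] by simp

text \<open>The triangle inequality handles partial sums; the Fatou property passes to their
  increasing limit.\<close>

lemma norm_suminf_le:
  assumes [measurable]: "\<And>j. U j \<in> borel_measurable M"
  shows "\<rho> (\<lambda>x. \<Sum>j. U j x) \<le> (\<Sum>j. \<rho> (U j))"
proof -
  have fin: "\<rho> (\<lambda>x. \<Sum>j<n. U j x) \<le> (\<Sum>j<n. \<rho> (U j))" for n
  proof (induction n)
    case 0
    then show ?case by (simp add: norm_zero)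
  next
    case (Suc n)
    have "\<rho> (\<lambda>x. (\<Sum>j<n. U j x) + U n x) \<le> \<rho> (\<lambda>x. \<Sum>j<n. U j x) + \<rho> (U n)"
      by (rule norm_triangle) simp_all
    also have "\<dots> \<le> (\<Sum>j<n. \<rho> (U j)) + \<rho> (U n)" by (rule add_right_mono[OF Suc.IH])
    finally show ?case by simp
  qed
  have "\<rho> (\<lambda>x. \<Sum>j. U j x) = (SUP n. \<rho> (\<lambda>x. \<Sum>j<n. U j x))"
    by (rule norm_Fatou) (auto simp: suminf_eq_SUP intro!: AE_I2 incseq_SucI)
  also have "\<dots> \<le> (\<Sum>j. \<rho> (U j))"
    by (intro SUP_least order.trans[OF fin] sum_le_suminf) auto
  finally show ?thesis .
qed

end

text \<open>A null set has open neighbourhoods of arbitrarily small measure, whose indicators have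
  small norm by the assumption on the characteristic function. Compactness fits a uniform
  neighbourhood of \<open>F\<close> inside, and the norm is monotone.\<close>

lemma indicator_neighbourhood_small:
  fixes F \<Omega> :: "'a::euclidean_space set"
  assumes ri: "ri_banach_function_norm (lebesgue_on \<Omega>) \<rho>"
    and char: "(characteristic_fun (lebesgue_on \<Omega>) \<rho> \<longlongrightarrow> 0) (at_right 0)"
    and \<Omega>: "open \<Omega>" and F: "compact F" "F \<subseteq> \<Omega>" "F \<noteq> {}" "negligible F"
    and pos: "0 < \<eta>" "0 < r0"
  shows "\<exists>r>0. r \<le> r0 \<and> (\<Union>x\<in>F. cball x r) \<subseteq> \<Omega> \<and> \<rho> (indicator (\<Union>x\<in>F. cball x r)) < ennreal \<eta>"
proof -
  interpret ri_banach_function_norm "lebesgue_on \<Omega>" \<rho> by (rule ri)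
  have "\<forall>\<^sub>F t in at_right 0. characteristic_fun (lebesgue_on \<Omega>) \<rho> t < ennreal \<eta>"
    using pos(1) by (intro order_tendstoD(2)[OF char]) simp
  then obtain \<delta> where \<delta>: "\<delta> > 0" "\<And>t. 0 < t \<Longrightarrow> t < \<delta> \<Longrightarrow> characteristic_fun (lebesgue_on \<Omega>) \<rho> t < ennreal \<eta>"
    unfolding eventually_at_right_field by auto
  have F0: "F \<in> null_sets lebesgue" using F(4) by (simp add: negligible_iff_null_sets)
  then have "F \<in> sets lebesgue" by auto
  then obtain O' where O': "open O'" "F \<subseteq> O'" "O' - F \<in> lmeasurable" "emeasure lebesgue (O' - F) < ennreal \<delta>"
    using sets_lebesgue_outer_open \<delta>(1) by metis
  define N where "N = O' \<inter> \<Omega>"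
  have N: "open N" "F \<subseteq> N" "N \<subseteq> \<Omega>" using O' \<Omega> F(2) by (auto simp: N_def)
  have "N \<noteq> {}" using N(2) F(3) by auto
  have Nl: "N \<in> sets lebesgue" using N(1) by (simp add: sets_completionI_sets)
  have "emeasure lebesgue N \<le> emeasure lebesgue ((O' - F) \<union> F)"
    using O'(1) F0 by (intro emeasure_mono) (auto simp: N_def)
  also have "\<dots> = emeasure lebesgue (O' - F)"
    using O'(3) F0 by (intro emeasure_Un_null_set) (auto simp: fmeasurable_def)
  finally have lt: "emeasure lebesgue N < ennreal \<delta>" using O'(4) by simp
  then obtain t where t: "emeasure lebesgue N = ennreal t" "0 \<le> t"
    by (cases "emeasure lebesgue N") auto
  \<comment> \<open>The limit from the right only speaks about positive \<open>t\<close>; nonempty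
    open sets have positive measure.\<close>
  have "t \<noteq> 0"
  proof
    assume "t = 0"
    then have "negligible N" using t Nl by (simp add: negligible_iff_null_sets null_sets_def)
    then show False using open_not_negligible[OF N(1)] \<open>N \<noteq> {}\<close> by blast
  qed
  with t lt have t': "0 < t" "t < \<delta>" by (auto simp: ennreal_less_iff)
  have \<Omega>l: "\<Omega> \<in> sets lebesgue" using \<Omega> by (simp add: sets_completionI_sets)
  have Nm: "N \<in> sets (lebesgue_on \<Omega>)" using Nl N(3) by (auto simp: sets_restrict_space)
  have "emeasure (lebesgue_on \<Omega>) N = ennreal t"
    using t(1) N(3) \<Omega>l by (simp add: emeasure_restrict_space)
  then have small: "\<rho> (indicator N) < ennreal \<eta>"
    using characteristic_fun_eq[OF Nm] \<delta>(2)[OF t'] by simp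
  obtain r1 where r1: "r1 > 0" "(\<Union>x\<in>F. cball x r1) \<subseteq> N"
    using compact_subset_open_imp_cball_epsilon_subset[OF F(1) N(1,2)] by metis
  define r where "r = min r0 r1"
  have sub: "(\<Union>x\<in>F. cball x r) \<subseteq> N" using r1(2) by (force simp: r_def)
  have "compact (\<Union>x\<in>F. cball x r)" by (rule compact_Union_cball[OF F(1)])
  then have "(\<Union>x\<in>F. cball x r) \<in> sets (lebesgue_on \<Omega>)"
    using sub N(3) by (auto simp: sets_restrict_space intro!: image_eqI[of _ _ "\<Union>x\<in>F. cball x r"] dest: lmeasurable_compact)
  then have "\<rho> (indicator (\<Union>x\<in>F. cball x r)) \<le> \<rho> (indicator N)"
    using Nm subsetD[OF sub] by (intro norm_mono) (auto simp: indicator_def intro!: AE_I2)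
  with small have "\<rho> (indicator (\<Union>x\<in>F. cball x r)) < ennreal \<eta>" by simp
  then show ?thesis using sub N(3) pos(2) r1(1) by (intro exI[of _ r]) (auto simp: r_def)
qed

text \<open>Near \<open>z\<close> a simplex containing \<open>z\<close> is invariant under translations parallel to all its
  facets through \<open>z\<close>, since only the inequalities active at \<open>z\<close> matter.\<close>

lemma piecewise_affine_local_structure:
  fixes f :: "real^'n \<Rightarrow> real^'n" and H :: "(real^'n) set \<Rightarrow> ((real^'n) \<times> real) set"
  assumes \<Omega>: "open \<Omega>" "\<Omega> = \<Union>\<T>" and fin: "\<exists>r>0. finite {T \<in> \<T>. T \<inter> ball z r \<noteq> {}}"
    and H: "\<And>T. T \<in> \<T> \<Longrightarrow> finite (H T)" "\<And>T. T \<in> \<T> \<Longrightarrow> T = {x. \<forall>(a, b)\<in>H T. a \<bullet> x \<le> b}"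
    and M: "\<And>T x. T \<in> \<T> \<Longrightarrow> x \<in> T \<Longrightarrow> f x = M T *v x + c T"
    and z: "T \<in> \<T>" "z \<in> T"
  obtains e L where "e > 0" "\<And>x y. x \<in> ball z e \<Longrightarrow> y \<in> ball z e \<Longrightarrow> norm (f x - f y) \<le> L * norm (x - y)"
    "L \<ge> 0"
    "\<And>y w. y \<in> ball z e \<Longrightarrow> norm w < e \<Longrightarrow>
      (\<forall>T\<in>\<T>. z \<in> T \<longrightarrow> (\<forall>(a, b)\<in>H T. a \<bullet> z = b \<longrightarrow> a \<bullet> w = 0)) \<Longrightarrow> f (y + w) = f y + M T *v w"
proof -
  obtain r where r: "r > 0" "finite {T \<in> \<T>. T \<inter> ball z r \<noteq> {}}" using fin by blast
  define \<N> where "\<N> = {T \<in> \<T>. T \<inter> ball z r \<noteq> {}}"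
  have fin\<N>: "finite \<N>" using r(2) by (simp add: \<N>_def)
  have closedT: "closed T" if "T \<in> \<T>" for T
  proof -
    have "T = (\<Inter>(a, b)\<in>H T. {x. a \<bullet> x \<le> b})" by (subst H(2)[OF that]) auto
    moreover have "closed (\<Inter>(a, b)\<in>H T. {x. a \<bullet> x \<le> b})"
      by (intro closed_INT ballI) (auto intro: closed_halfspace_le)
    ultimately show ?thesis by metis
  qed
  have "z \<in> \<Omega>" using z \<Omega>(2) by blast
  have "\<forall>\<^sub>F y in nhds z. \<forall>T\<in>\<N>. (y \<in> T \<longrightarrow> z \<in> T) \<and> (\<forall>p\<in>H T. fst p \<bullet> z < snd p \<longrightarrow> fst p \<bullet> y < snd p)"
  proof (intro eventually_ball_finite fin\<N> ballI eventually_conj)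
    fix T assume "T \<in> \<N>"
    then have T: "T \<in> \<T>" by (simp add: \<N>_def)
    show "\<forall>\<^sub>F y in nhds z. y \<in> T \<longrightarrow> z \<in> T"
    proof (cases "z \<in> T")
      case False
      then have "\<forall>\<^sub>F y in nhds z. y \<in> - T"
        using closedT[OF T] by (intro eventually_nhds_in_open) auto
      then show ?thesis by eventually_elim simp
    qed simp
    show "finite (H T)" by (rule H(1)[OF T])
    fix p assume "p \<in> H T"
    show "\<forall>\<^sub>F y in nhds z. fst p \<bullet> z < snd p \<longrightarrow> fst p \<bullet> y < snd p"
    proof (cases "fst p \<bullet> z < snd p")
      case True
      then have "\<forall>\<^sub>F y in nhds z. y \<in> {y. fst p \<bullet> y < snd p}"
        by (intro eventually_nhds_in_open open_halfspace_lt) auto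
      then show ?thesis by eventually_elim simp
    qed simp
  qed
  moreover have "\<forall>\<^sub>F y in nhds z. y \<in> \<Omega>" using \<Omega>(1) \<open>z \<in> \<Omega>\<close> by (rule eventually_nhds_in_open)
  ultimately have "\<forall>\<^sub>F y in nhds z. y \<in> \<Omega> \<and> (\<forall>T\<in>\<N>. (y \<in> T \<longrightarrow> z \<in> T) \<and>
      (\<forall>p\<in>H T. fst p \<bullet> z < snd p \<longrightarrow> fst p \<bullet> y < snd p))" by eventually_elim blast
  then obtain e0 where e0: "e0 > 0" "\<And>y. dist y z < e0 \<Longrightarrow> y \<in> \<Omega> \<and> (\<forall>T\<in>\<N>. (y \<in> T \<longrightarrow> z \<in> T) \<and>
      (\<forall>p\<in>H T. fst p \<bullet> z < snd p \<longrightarrow> fst p \<bullet> y < snd p))"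
    unfolding eventually_nhds_metric by blast
  define e1 where "e1 = min e0 r"
  have e1: "e1 > 0" using e0(1) r(1) by (simp add: e1_def)
  \<comment> \<open>Near \<open>z\<close> only simplices through \<open>z\<close> occur, because
    simplices are closed and locally finite, and the finitely many inequalities that are strict at
    \<open>z\<close> stay strict.\<close>
  have near: "y \<in> \<Omega>" "\<And>T. T \<in> \<T> \<Longrightarrow> y \<in> T \<Longrightarrow> z \<in> T \<and> T \<in> \<N>"
    "\<And>T a b. T \<in> \<T> \<Longrightarrow> z \<in> T \<Longrightarrow> (a, b) \<in> H T \<Longrightarrow> a \<bullet> z < b \<Longrightarrow> a \<bullet> y < b"
    if "y \<in> ball z e1" for y
  proof -
    have y: "dist y z < e0" "y \<in> ball z r" using that by (auto simp: e1_def dist_commute)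
    show "y \<in> \<Omega>" using e0(2)[OF y(1)] by blast
    show "z \<in> T \<and> T \<in> \<N>" if "T \<in> \<T>" "y \<in> T" for T
    proof -
      have "T \<in> \<N>" using that y(2) by (auto simp: \<N>_def)
      then show ?thesis using e0(2)[OF y(1)] that by blast
    qed
    show "a \<bullet> y < b" if "T \<in> \<T>" "z \<in> T" "(a, b) \<in> H T" "a \<bullet> z < b" for T a b
    proof -
      have "T \<in> \<N>" using that r(1) by (auto simp: \<N>_def intro!: exI[of _ z])
      then show ?thesis using e0(2)[OF y(1)] that by fastforce
    qed
  qed
  define e where "e = e1 / 2"
  have e: "e > 0" using e1 by (simp add: e_def)
  have move: "y + w \<in> S" if "S \<in> \<T>" "y \<in> S" "y \<in> ball z e" "norm w < e"
    and w: "\<forall>T\<in>\<T>. z \<in> T \<longrightarrow> (\<forall>(a, b)\<in>H T. a \<bullet> z = b \<longrightarrow> a \<bullet> w = 0)" for y w S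
  proof -
    have y1: "y \<in> ball z e1" using that(3) e by (simp add: e_def)
    have yw: "y + w \<in> ball z e1"
      using that(3,4) norm_triangle_ineq4[of "z - y" w] by (simp add: e_def dist_norm algebra_simps)
    have zS: "z \<in> S" using near(2)[OF y1 that(1,2)] by blast
    have "a \<bullet> (y + w) \<le> b" if ab: "(a, b) \<in> H S" for a b
    proof -
      have "a \<bullet> z \<le> b" using zS H(2)[OF \<open>S \<in> \<T>\<close>] ab by blast
      then consider "a \<bullet> z < b" | "a \<bullet> z = b" by linarith
      then show ?thesis
      proof cases
        case 1
        then show ?thesis using near(3)[OF yw \<open>S \<in> \<T>\<close> zS ab] by simp
      next
        case 2
        then have "a \<bullet> w = 0" using w \<open>S \<in> \<T>\<close> zS ab by blast
        moreover have "a \<bullet> y \<le> b" using \<open>y \<in> S\<close> H(2)[OF \<open>S \<in> \<T>\<close>] ab by blast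
        ultimately show ?thesis by (simp add: inner_add_right)
      qed
    qed
    then show ?thesis by (subst H(2)[OF \<open>S \<in> \<T>\<close>]) blast
  qed
  \<comment> \<open>The simplex \<open>S\<close> containing \<open>y\<close> need not be
    \<open>T\<close>. Both contain \<open>z\<close>, hence also \<open>z + w\<close>, so evaluating
    \<open>f\<close> at \<open>z\<close> and \<open>z + w\<close> in both ways shows that
    \<open>M S\<close> and \<open>M T\<close> agree on \<open>w\<close>.\<close>
  have affine: "f (y + w) = f y + M T *v w" if y: "y \<in> ball z e" and w: "norm w < e"
    "\<forall>T\<in>\<T>. z \<in> T \<longrightarrow> (\<forall>(a, b)\<in>H T. a \<bullet> z = b \<longrightarrow> a \<bullet> w = 0)" for y w
  proof -
    have y1: "y \<in> ball z e1" using y e by (simp add: e_def)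
    obtain S where S: "S \<in> \<T>" "y \<in> S" using near(1)[OF y1] \<Omega>(2) by blast
    have zS: "z \<in> S" using near(2)[OF y1 S] by blast
    have zb: "z \<in> ball z e" using e by simp
    have "f (y + w) = f y + M S *v w"
      using M[OF S] M[OF S(1) move[OF S y w]] by (simp add: matrix_vector_right_distrib)
    moreover have "f (z + w) = f z + M S *v w"
      using M[OF S(1) zS] M[OF S(1) move[OF S(1) zS zb w]] by (simp add: matrix_vector_right_distrib)
    moreover have "f (z + w) = f z + M T *v w"
      using M[OF z] M[OF z(1) move[OF z zb w]] by (simp add: matrix_vector_right_distrib)
    ultimately show ?thesis by simp
  qed
  define L where "L = (\<Sum>T\<in>\<N>. onorm ((*v) (M T)))"
  have on0: "0 \<le> onorm ((*v) (M T))" for T by (rule onorm_pos_le[OF matrix_vector_mul_bounded_linear])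
  have L0: "L \<ge> 0" unfolding L_def using on0 by (intro sum_nonneg) auto
  have Lip: "norm (f x - f y) \<le> L * norm (x - y)" if xy: "x \<in> ball z e" "y \<in> ball z e" for x y
  proof -
    \<comment> \<open>The segment may cross several simplices. Their preimages are finitely many
      closed sets covering the unit interval, so the Lipschitz bounds on the pieces combine; the sum
      \<open>L\<close> dominates every single piece.\<close>
    define \<gamma> where "\<gamma> t = y + t *\<^sub>R (x - y)" for t :: real
    have cont: "continuous_on UNIV \<gamma>" unfolding \<gamma>_def by (intro continuous_intros)
    have \<gamma>: "\<gamma> t \<in> ball z e1" if "t \<in> {0..1}" for t
    proof -
      have "\<gamma> t = (1 - t) *\<^sub>R y + t *\<^sub>R x" by (simp add: \<gamma>_def algebra_simps)
      then have "\<gamma> t \<in> ball z e" using convexD_alt[OF convex_ball[of z e] xy(2,1)] that by auto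
      then show ?thesis using e by (simp add: e_def)
    qed
    have "(L * norm (x - y))-lipschitz_on {0..1} (\<lambda>t. f (\<gamma> t))"
    proof (rule lipschitz_on_closed_Union)
      show "finite \<N>" by fact
      show "0 \<le> L * norm (x - y)" using L0 by simp
      show "closed (\<gamma> -` T)" if "T \<in> \<N>" for T
        using continuous_closed_vimage[OF closedT] cont that
        by (auto simp: \<N>_def continuous_on_eq_continuous_at)
      show "{0..1} \<subseteq> (\<Union>T\<in>\<N>. \<gamma> -` T)"
      proof
        fix t :: real assume "t \<in> {0..1}"
        from near(1,2)[OF \<gamma>[OF this]] show "t \<in> (\<Union>T\<in>\<N>. \<gamma> -` T)" using \<Omega>(2) by auto
      qed
      show "(L * norm (x - y))-lipschitz_on (\<gamma> -` T) (\<lambda>t. f (\<gamma> t))" if T: "T \<in> \<N>" for T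
      proof (rule lipschitz_onI)
        fix s t assume st: "s \<in> \<gamma> -` T" "t \<in> \<gamma> -` T"
        have T': "T \<in> \<T>" using T by (simp add: \<N>_def)
        have "\<gamma> s - \<gamma> t = (s - t) *\<^sub>R (x - y)" by (simp add: \<gamma>_def algebra_simps)
        then have "f (\<gamma> s) - f (\<gamma> t) = (s - t) *\<^sub>R (M T *v (x - y))"
          using M[OF T', of "\<gamma> s"] M[OF T', of "\<gamma> t"] st
          by (simp add: matrix_vector_mult_diff_distrib[symmetric] matrix_vector_mult_scaleR)
        then have "dist (f (\<gamma> s)) (f (\<gamma> t)) = \<bar>s - t\<bar> * norm (M T *v (x - y))" by (simp add: dist_norm)
        also have "\<dots> \<le> \<bar>s - t\<bar> * (L * norm (x - y))"
        proof (intro mult_left_mono)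
          have "norm (M T *v (x - y)) \<le> onorm ((*v) (M T)) * norm (x - y)"
            by (rule onorm[OF matrix_vector_mul_bounded_linear])
          also have "onorm ((*v) (M T)) \<le> L"
            unfolding L_def using fin\<N> T on0 by (intro member_le_sum) auto
          finally show "norm (M T *v (x - y)) \<le> L * norm (x - y)" by (simp add: mult_right_mono)
        qed simp
        finally show "dist (f (\<gamma> s)) (f (\<gamma> t)) \<le> L * norm (x - y) * dist s t"
          by (simp add: dist_real_def mult.commute)
      qed (use L0 in simp)
    qed
    from lipschitz_onD[OF this, of 1 0] show ?thesis by (simp add: \<gamma>_def dist_norm)
  qed
  show ?thesis by (rule that[of e L]) (use e L0 Lip affine in auto)
qed

text \<open>Replace \<open>h x\<close> by \<open>h y + D (x - y)\<close>: the error is small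
  relative to \<open>norm (x - y)\<close>, and \<open>f\<close> is locally Lipschitz. The remaining
  step from \<open>h y\<close> has a direction in the range of \<open>D\<close>, where
  \<open>f\<close> is exactly affine with a linear part that does not depend on
  \<open>y\<close>.\<close>

lemma strict_derivative_collapsed_piecewise_affine:
  fixes f h :: "real^'n \<Rightarrow> real^'n"
  assumes e: "e > 0" "\<And>x y. x \<in> ball (h x0) e \<Longrightarrow> y \<in> ball (h x0) e \<Longrightarrow> norm (f x - f y) \<le> L * norm (x - y)"
    and L: "L \<ge> 0"
    and affine: "\<And>y w. y \<in> ball (h x0) e \<Longrightarrow> norm w < e \<Longrightarrow> w \<in> range D \<Longrightarrow> f (y + w) = f y + A *v w"
    and h: "has_strict_derivative h D x0" "\<And>x y. norm (h x - h y) \<le> 2 * norm (x - y)"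
  shows "has_strict_derivative (\<lambda>x. f (h x)) (\<lambda>v. A *v D v) x0"
proof (rule has_strict_derivative_I)
  interpret D: bounded_linear D using h(1) by (rule has_strict_derivative_bounded_linear)
  show "bounded_linear (\<lambda>v. A *v D v)"
    by (rule bounded_linear_compose[OF matrix_vector_mul_bounded_linear D.bounded_linear_axioms])
  have D_le: "norm (D v) \<le> 2 * norm v" for v
    by (rule has_strict_derivative_Lipschitz_bound[OF h])
  fix \<epsilon> :: real assume "\<epsilon> > 0"
  then have "\<epsilon> / (L + 1) > 0" using L by simp
  from has_strict_derivative_eventually[OF h(1) this]
  have ev1: "\<forall>\<^sub>F p in nhds (x0, x0). norm (h (fst p) - h (snd p) - D (fst p - snd p)) \<le> \<epsilon> / (L + 1) * norm (fst p - snd p)" .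
  \<comment> \<open>Points within \<open>e / 16\<close> of \<open>x0\<close> differ by less than
    \<open>e / 8\<close>. The factor 2 for \<open>h\<close> and for \<open>D\<close> then keeps
    \<open>h x\<close>, \<open>h y\<close> and \<open>h y + D (x - y)\<close> in the ball of radius
    \<open>e\<close>.\<close>
  have ev2: "\<forall>\<^sub>F p in nhds (x0, x0). norm (fst p - x0) < e / 16 \<and> norm (snd p - x0) < e / 16"
  proof -
    have "\<forall>\<^sub>F y in nhds x0. norm (y - x0) < e / 16"
      using eventually_nhds_in_open[of "ball x0 (e / 16)" x0] e(1) by (simp add: dist_norm norm_minus_commute)
    then show ?thesis unfolding nhds_prod by (auto simp: eventually_prod_filter)
  qed
  from ev1 ev2 show "\<forall>\<^sub>F p in nhds (x0, x0). norm (f (h (fst p)) - f (h (snd p)) - A *v D (fst p - snd p))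
      \<le> \<epsilon> * norm (fst p - snd p)"
  proof eventually_elim
    case (elim p)
    let ?x = "fst p" and ?y = "snd p"
    let ?w = "D (?x - ?y)"
    have xy: "norm (?x - ?y) < e / 8"
      using elim(2) norm_triangle_ineq4[of "?x - x0" "?y - x0"] by simp
    have hx: "norm (h ?x - h x0) < e / 8" and hy: "norm (h ?y - h x0) < e / 8"
      using elim(2) h(2)[of ?x x0] h(2)[of ?y x0] by auto
    have w: "norm ?w < e / 4" using D_le[of "?x - ?y"] xy by simp
    have b: "h ?x \<in> ball (h x0) e" "h ?y \<in> ball (h x0) e" "h ?y + ?w \<in> ball (h x0) e"
      using hx hy w e(1) norm_triangle_ineq[of "h ?y - h x0" ?w]
      by (auto simp: dist_norm norm_minus_commute algebra_simps)
    have "f (h ?x) - f (h ?y) - A *v ?w = f (h ?x) - f (h ?y + ?w)"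
      using affine[OF b(2), of ?w] w e(1) by simp
    also have "norm \<dots> \<le> L * norm (h ?x - (h ?y + ?w))" by (rule e(2)[OF b(1,3)])
    also have "\<dots> \<le> L * (\<epsilon> / (L + 1) * norm (?x - ?y))"
      using elim(1) L by (intro mult_left_mono) (auto simp: algebra_simps)
    also have "\<dots> \<le> \<epsilon> * norm (?x - ?y)"
    proof -
      have "L * (\<epsilon> / (L + 1)) \<le> \<epsilon>" using L \<open>\<epsilon> > 0\<close> by (simp add: field_simps)
      from mult_right_mono[OF this, of "norm (?x - ?y)"] show ?thesis by (simp add: mult.assoc)
    qed
    finally show ?case .
  qed
qed

theorem theorem1p3:
  fixes \<Omega> :: "(real^'n) set"
    and f :: "real^'n \<Rightarrow> real^'n"
    and \<rho> :: "(real^'n \<Rightarrow> ennreal) \<Rightarrow> ennreal"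
  assumes "CARD('n) \<ge> 2"
    and "open \<Omega>" and "connected \<Omega>" and "\<Omega> \<noteq> {}"
    and "locally_finite_pa_homeomorphism \<Omega> f"
    and "ri_banach_function_norm (lebesgue_on \<Omega>) \<rho>"
    and "(characteristic_fun (lebesgue_on \<Omega>) \<rho> \<longlongrightarrow> 0) (at_right 0)"
  shows "\<forall>\<epsilon>::real. \<epsilon> > 0 \<longrightarrow>
    (\<exists>g :: real^'n \<Rightarrow> real^'n. inj_on g \<Omega> \<and> C1_on \<Omega> g \<and>
       Linfty_norm (lebesgue_on \<Omega>) (\<lambda>x. g x - f x) < ennreal \<epsilon> \<and>
       function_space_norm \<rho> (\<lambda>x. Jac g x - Jac f x) < ennreal \<epsilon>)"
proof (intro allI impI)
  fix \<epsilon> :: real assume \<epsilon>: "\<epsilon> > 0"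
  interpret ri_banach_function_norm "lebesgue_on \<Omega>" \<rho> by fact
  let ?n2 = "(real CARD('n))\<^sup>2"
  obtain f' \<T> where homeo: "homeomorphism \<Omega> (f ` \<Omega>) f f'" and sc: "simplicial_complex_of \<T> \<Omega>"
    and lf: "locally_finite_complex \<T> \<Omega>" and pa: "piecewise_affine_wrt \<T> f"
    using assms(5) unfolding locally_finite_pa_homeomorphism_def by blast
  have \<Omega>_eq: "\<Omega> = \<Union>\<T>" and count\<T>: "countable \<T>"
    and simp\<T>: "\<And>T. T \<in> \<T> \<Longrightarrow> int CARD('n) simplex T"
    using sc by (auto simp: simplicial_complex_of_def)
  have fin\<T>: "\<exists>r>0. finite {T \<in> \<T>. T \<inter> ball x r \<noteq> {}}" if "x \<in> \<Omega>" for x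
    using lf that by (auto simp: locally_finite_complex_def)
  obtain M c where M: "\<And>T x. T \<in> \<T> \<Longrightarrow> x \<in> T \<Longrightarrow> f x = M T *v x + c T"
    using pa unfolding piecewise_affine_wrt_def by metis
  have poly: "polytope T" if "T \<in> \<T>" for T using simplex_imp_polytope[OF simp\<T>[OF that]] .
  obtain H where H: "\<And>T. T \<in> \<T> \<Longrightarrow> finite (H T)" "\<And>T. T \<in> \<T> \<Longrightarrow> T = {x. \<forall>(a, b)\<in>H T. a \<bullet> x \<le> b}"
    "\<And>T a b. T \<in> \<T> \<Longrightarrow> (a, b) \<in> H T \<Longrightarrow> a \<noteq> 0"
  proof -
    have "\<forall>T\<in>\<T>. \<exists>H. finite H \<and> T = {x. \<forall>(a, b)\<in>H. a \<bullet> x \<le> b} \<and> (\<forall>(a, b)\<in>H. a \<noteq> 0)"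
      by (intro ballI polyhedron_halfspaces polytope_imp_polyhedron poly)
    from bchoice[OF this] obtain H where
      H: "\<forall>T\<in>\<T>. finite (H T) \<and> T = {x. \<forall>(a, b)\<in>H T. a \<bullet> x \<le> b} \<and> (\<forall>(a, b)\<in>H T. a \<noteq> 0)" ..
    show ?thesis by (rule that[of H]) (use H in fast)+
  qed
  have f_cont: "continuous_on \<Omega> f" using homeo by (simp add: homeomorphism_def)
  have f_inj: "inj_on f \<Omega>" using homeo by (metis homeomorphism_def inj_on_inverseI)
  have \<Omega>l: "\<Omega> \<in> sets lebesgue" using assms(2) by (simp add: sets_completionI_sets)

  have on_\<Omega>: "A \<in> sets (lebesgue_on \<Omega>)" if "A \<in> sets lebesgue" "A \<subseteq> \<Omega>" for A
    using that \<Omega>l by (simp add: sets_restrict_space_iff)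

  \<comment> \<open>\<open>\<epsilon> / 2\<close> leaves room for the strict bound on the essential
    supremum.\<close>
  define U where "U = {(x, y). x \<in> \<Omega> \<and> y \<in> \<Omega> \<and> norm (f x - f y) < \<epsilon> / 2 \<and> norm (x - y) < 1}"
  have "open U"
  proof -
    have "continuous_on (\<Omega> \<times> \<Omega>) (\<lambda>p. norm (f (fst p) - f (snd p)))"
      by (intro continuous_intros continuous_on_compose2[OF f_cont]) auto
    note 1 = continuous_open_preimage[OF this open_Times[OF assms(2,2)], of "{..<\<epsilon> / 2}", OF open_lessThan]
    have 2: "open {p :: (real^'n) \<times> (real^'n). norm (fst p - snd p) < 1}"
      by (intro open_Collect_less continuous_intros)
    have "U = (\<Omega> \<times> \<Omega> \<inter> (\<lambda>p. norm (f (fst p) - f (snd p))) -` {..<\<epsilon> / 2}) \<inter> {p. norm (fst p - snd p) < 1}"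
      by (auto simp: U_def)
    with open_Int[OF 1 2] show ?thesis by (simp only:)
  qed
  then obtain \<tau> where \<tau>: "continuous_on UNIV \<tau>" "\<And>x. (x, x) \<in> U \<Longrightarrow> 0 < \<tau> x" "\<And>x. \<tau> x \<le> 1"
    "\<And>x y. norm (x - y) < 4 * \<tau> x \<Longrightarrow> (x, y) \<in> U"
    "\<And>x y. norm (x - y) \<le> \<tau> y \<Longrightarrow> norm (x - y) \<le> 2 * \<tau> x"
  proof (rule diagonal_gauge_exists)
    show "norm (x - y) < 1" if "(x, y) \<in> U" for x y using that by (simp add: U_def)
  qed blast
  have \<tau>pos: "0 < \<tau> x" if "x \<in> \<Omega>" for x using that \<epsilon> by (intro \<tau>(2)) (simp add: U_def)
  have \<tau>close: "(x, y) \<in> U" if "x \<in> \<Omega>" "norm (x - y) \<le> 2 * \<tau> x" for x y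
    using \<tau>pos[OF that(1)] that(2) by (intro \<tau>(4)) simp

  \<comment> \<open>The index is a pair of a simplex and one of its inequalities, so a common wall
    of two simplices is listed separately for each of them. Every inequality active at a point of
    \<open>\<Omega>\<close> is thereby represented, also when walls overlap only partly.\<close>
  define P where "P = {(T, a, b). T \<in> \<T> \<and> (a, b) \<in> H T \<and> T \<inter> {x. a \<bullet> x = b} \<noteq> {}}"
  have P_sub: "P \<subseteq> (SIGMA T:\<T>. H T)" by (auto simp: P_def)
  have "countable (SIGMA T:\<T>. H T)" using count\<T> H(1) by (intro countable_SIGMA) (auto intro: countable_finite)
  then have countP: "countable P" using P_sub countable_subset by blast
  define I where "I = to_nat_on P ` P"
  define q where "q = from_nat_into P"
  have qI: "q (to_nat_on P p) = p" if "p \<in> P" for p using that countP by (simp add: q_def)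
  have qP: "q j \<in> P" if "j \<in> I" for j using that qI by (auto simp: I_def)
  have q_inj: "inj_on q I" by (rule inj_onI) (auto simp: I_def qI)
  define a where "a j = fst (snd (q j))" for j
  define F where "F j = fst (q j) \<inter> {x. a j \<bullet> x = snd (snd (q j))}" for j
  have F: "compact (F j)" "convex (F j)" "F j \<noteq> {}" "F j \<subseteq> {x. a j \<bullet> x = snd (snd (q j))}"
      "F j \<subseteq> \<Omega>" "negligible (F j)" if "j \<in> I" for j
  proof -
    obtain T a' b' where q: "q j = (T, a', b')" by (cases "q j") auto
    have p: "T \<in> \<T>" "(a', b') \<in> H T" "T \<inter> {x. a' \<bullet> x = b'} \<noteq> {}" using qP[OF that] by (auto simp: q P_def)
    have Fj: "F j = T \<inter> {x. a' \<bullet> x = b'}" by (simp add: F_def a_def q)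
    show "compact (F j)" unfolding Fj
      using polytope_imp_compact[OF poly[OF p(1)]] by (intro compact_Int_closed closed_hyperplane)
    show "convex (F j)" unfolding Fj
      using polytope_imp_convex[OF poly[OF p(1)]] by (intro convex_Int convex_hyperplane)
    show "F j \<noteq> {}" unfolding Fj by (rule p)
    show "F j \<subseteq> {x. a j \<bullet> x = snd (snd (q j))}" by (simp add: F_def)
    show "F j \<subseteq> \<Omega>" unfolding Fj \<Omega>_eq using p(1) by blast
    show "negligible (F j)" unfolding Fj
      by (rule negligible_subset[OF negligible_hyperplane[of a' b']]) (use H(3)[OF p(1,2)] in auto)
  qed

  \<comment> \<open>\<open>k\<close> bounds the linear parts both at \<open>x\<close> and at every
    possible image point \<open>h x\<close>. The factor 3 is 1 for \<open>Jac f\<close> plus 2 for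
    \<open>Jac g\<close>, since \<open>h\<close> is 2-Lipschitz. The bound
    \<open>1 / real (Suc j)\<close> on the radius preserves local finiteness.\<close>
  define R where "R j k r \<longleftrightarrow> k > 0 \<and> r > 0 \<and> r \<le> 1 / real (Suc j) \<and> (\<Union>x\<in>F j. cball x r) \<subseteq> \<Omega> \<and>
      ennreal (3 * ?n2 * k) * \<rho> (indicator (\<Union>x\<in>F j. cball x r)) \<le> ennreal (\<epsilon> * (1/2) ^ (j + 2)) \<and>
      (\<forall>x\<in>\<Union>x\<in>F j. cball x r. \<forall>z T v. norm (x - z) \<le> 2 * \<tau> x \<longrightarrow> T \<in> \<T> \<longrightarrow> z \<in> T \<longrightarrow>
        norm (M T *v v) \<le> k * norm v)" for j k r
  have "\<exists>k r. R j k r" if j: "j \<in> I" for j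
  proof -
    obtain r0 where r0: "r0 > 0" "(\<Union>x\<in>F j. cball x r0) \<subseteq> \<Omega>"
      using compact_subset_open_imp_cball_epsilon_subset[OF F(1)[OF j] assms(2) F(5)[OF j]] by metis
    \<comment> \<open>\<open>K\<close> collects all points within \<open>2 * \<tau> x\<close> of a
      point \<open>x\<close> of the larger neighbourhood. It is compact and lies in
      \<open>\<Omega>\<close>, so only finitely many simplices meet it.\<close>
    define K where "K = (\<lambda>(x, v). x + (2 * \<tau> x) *\<^sub>R v) ` ((\<Union>x\<in>F j. cball x r0) \<times> cball 0 1)"
    have "continuous_on ((\<Union>x\<in>F j. cball x r0) \<times> cball 0 1) (\<lambda>p. fst p + (2 * \<tau> (fst p)) *\<^sub>R snd p)"
      by (intro continuous_intros continuous_on_compose2[OF \<tau>(1)]) auto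
    then have "compact K" unfolding K_def split_beta
      by (intro compact_continuous_image compact_Times compact_Union_cball F(1)[OF j] compact_cball)
    have inK: "z \<in> K" if "x \<in> (\<Union>x\<in>F j. cball x r0)" "norm (x - z) \<le> 2 * \<tau> x" for x z
    proof -
      have "0 < \<tau> x" using r0(2) that(1) \<tau>pos by blast
      then have "z = x + (2 * \<tau> x) *\<^sub>R ((1 / (2 * \<tau> x)) *\<^sub>R (z - x))" "(1 / (2 * \<tau> x)) *\<^sub>R (z - x) \<in> cball 0 1"
        using that(2) by (auto simp: norm_minus_commute)
      then show ?thesis unfolding K_def using that(1) by (auto intro!: image_eqI[of _ _ "(x, (1 / (2 * \<tau> x)) *\<^sub>R (z - x))"])
    qed
    have K\<Omega>: "K \<subseteq> \<Omega>"
    proof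
      fix z assume "z \<in> K"
      then obtain x v where "(x, v) \<in> (\<Union>x\<in>F j. cball x r0) \<times> cball 0 1" "z = x + (2 * \<tau> x) *\<^sub>R v"
        unfolding K_def by fast
      then have xv: "x \<in> (\<Union>x\<in>F j. cball x r0)" "norm v \<le> 1" "z = x + (2 * \<tau> x) *\<^sub>R v"
        by auto
      have x: "x \<in> \<Omega>" using xv(1) r0(2) by blast
      have "norm (x - z) \<le> 2 * \<tau> x" using xv(2,3) \<tau>pos[OF x] by (simp add: mult_left_le)
      then show "z \<in> \<Omega>" using \<tau>close[OF x] by (auto simp: U_def)
    qed
    define Q where "Q = {T \<in> \<T>. T \<inter> K \<noteq> {}}"
    have finQ: "finite Q" unfolding Q_def
      using K\<Omega> fin\<T> by (intro compact_meets_finitely_many[OF \<open>compact K\<close>]) blast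
    have on0: "0 \<le> onorm ((*v) (M T))" for T by (rule onorm_pos_le[OF matrix_vector_mul_bounded_linear])
    \<comment> \<open>This constant depends on \<open>r0\<close> alone; the final radius is chosen
      afterwards in terms of it.\<close>
    define k where "k = 1 + (\<Sum>T\<in>Q. onorm ((*v) (M T)))"
    have k: "k > 0" unfolding k_def using on0 by (intro add_pos_nonneg sum_nonneg) auto
    have Mk: "norm (M T *v v) \<le> k * norm v" if "T \<in> \<T>" "z \<in> T" "z \<in> K" for T z v
    proof -
      have "norm (M T *v v) \<le> onorm ((*v) (M T)) * norm v"
        by (rule onorm[OF matrix_vector_mul_bounded_linear])
      also have "onorm ((*v) (M T)) \<le> (\<Sum>T\<in>Q. onorm ((*v) (M T)))"
        using that finQ on0 by (intro member_le_sum) (auto simp: Q_def)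
      also have "\<dots> \<le> k" by (simp add: k_def)
      finally show ?thesis by (simp add: mult_right_mono)
    qed
    have k3: "3 * ?n2 * k > 0" using k by simp
    define \<eta> where "\<eta> = \<epsilon> * (1/2) ^ (j + 2) / (3 * ?n2 * k)"
    have \<eta>: "\<eta> > 0" using \<epsilon> k3 by (simp add: \<eta>_def)
    obtain r where r: "r > 0" "r \<le> min r0 (1 / real (Suc j))" "(\<Union>x\<in>F j. cball x r) \<subseteq> \<Omega>"
      "\<rho> (indicator (\<Union>x\<in>F j. cball x r)) < ennreal \<eta>"
      using indicator_neighbourhood_small[OF assms(6,7,2) F(1)[OF j] F(5)[OF j] F(3)[OF j] F(6)[OF j] \<eta>, of "min r0 (1 / real (Suc j))"]
        r0(1) by auto
    have "ennreal (3 * ?n2 * k) * \<rho> (indicator (\<Union>x\<in>F j. cball x r)) \<le> ennreal (3 * ?n2 * k) * ennreal \<eta>"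
      using r(4) by (intro mult_left_mono) auto
    also have "\<dots> = ennreal (3 * ?n2 * k * \<eta>)" using k \<eta> by (simp add: ennreal_mult)
    also have "3 * ?n2 * k * \<eta> = \<epsilon> * (1/2) ^ (j + 2)" using k by (simp add: \<eta>_def)
    finally have 1: "ennreal (3 * ?n2 * k) * \<rho> (indicator (\<Union>x\<in>F j. cball x r)) \<le> ennreal (\<epsilon> * (1/2) ^ (j + 2))" .
    have 2: "norm (M T *v v) \<le> k * norm v" if "x \<in> (\<Union>x\<in>F j. cball x r)" "norm (x - z) \<le> 2 * \<tau> x" "T \<in> \<T>" "z \<in> T"
      for x z T v
    proof -
      have "x \<in> (\<Union>x\<in>F j. cball x r0)" using that(1) r(2) by force
      then show ?thesis using Mk[OF that(3,4) inK] that(2) by blast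
    qed
    have "R j k r" unfolding R_def using k r(1-3) 1 2 by (intro conjI ballI allI impI) auto
    then show ?thesis by blast
  qed
  then obtain k r where R: "\<And>j. j \<in> I \<Longrightarrow> R j (k j) (r j)" by metis
  have kr: "k j > 0" "r j > 0" "r j \<le> 1 / real (Suc j)"
      "(\<Union>x\<in>F j. cball x (r j)) \<subseteq> \<Omega>"
      "ennreal (3 * ?n2 * k j) * \<rho> (indicator (\<Union>x\<in>F j. cball x (r j))) \<le> ennreal (\<epsilon> * (1/2) ^ (j + 2))"
      "\<And>x z T v. x \<in> (\<Union>x\<in>F j. cball x (r j)) \<Longrightarrow> norm (x - z) \<le> 2 * \<tau> x \<Longrightarrow> T \<in> \<T> \<Longrightarrow> z \<in> T \<Longrightarrow>
        norm (M T *v v) \<le> k j * norm v"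
    if "j \<in> I" for j
    using R[OF that] unfolding R_def by blast+
  define S where "S j = (if j \<in> I then (\<Union>x\<in>F j. cball x (r j)) else {})" for j
  have S_eq: "S j = (\<Union>x\<in>F j. cball x (r j))" if "j \<in> I" for j using that by (simp add: S_def)
  have S_compact: "compact (S j)" for j using compact_Union_cball F(1) by (auto simp: S_def)
  have S\<Omega>: "S j \<subseteq> \<Omega>" for j using kr(4) by (auto simp: S_def)
  have S_fin: "\<exists>e>0. finite {j \<in> I. S j \<inter> ball z e \<noteq> {}}" if z: "z \<in> \<Omega>" for z
  proof -
    obtain e where e: "e > 0" "finite {T \<in> \<T>. T \<inter> ball z e \<noteq> {}}" using fin\<T>[OF z] by blast
    define A where "A = {j \<in> I. F j \<inter> ball z e \<noteq> {}}"
    have "q ` A \<subseteq> (SIGMA T:{T \<in> \<T>. T \<inter> ball z e \<noteq> {}}. H T)"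
    proof
      fix p assume "p \<in> q ` A"
      then obtain j where j: "j \<in> I" "F j \<inter> ball z e \<noteq> {}" "p = q j" by (auto simp: A_def)
      obtain T a' b' where q: "q j = (T, a', b')" by (cases "q j") auto
      have "T \<inter> ball z e \<noteq> {}" using j(2) by (auto simp: F_def q)
      moreover have "T \<in> \<T>" "(a', b') \<in> H T" using qP[OF j(1)] by (auto simp: P_def q)
      ultimately show "p \<in> (SIGMA T:{T \<in> \<T>. T \<inter> ball z e \<noteq> {}}. H T)" by (simp add: j(3) q)
    qed
    moreover have "finite (SIGMA T:{T \<in> \<T>. T \<inter> ball z e \<noteq> {}}. H T)" using e(2) H(1) by (intro finite_SigmaI) auto
    ultimately have "finite (q ` A)" by (rule finite_subset)
    then have "finite A" using inj_on_subset[OF q_inj, of A] finite_imageD by (auto simp: A_def)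
    \<comment> \<open>For \<open>j > m\<close> the radius is below \<open>e / 2\<close>, so a
      support meeting the half ball has its facet meeting the full ball, which happens only for
      \<open>j\<close> in the finite set \<open>A\<close>.\<close>
    obtain m where m: "1 / real (Suc m) < e / 2" using nat_approx_posE[of "e / 2"] e(1) by auto
    have "{j \<in> I. S j \<inter> ball z (e / 2) \<noteq> {}} \<subseteq> A \<union> {..m}"
    proof
      fix j assume "j \<in> {j \<in> I. S j \<inter> ball z (e / 2) \<noteq> {}}"
      then obtain x y where x: "j \<in> I" "x \<in> F j" "dist x y \<le> r j" "dist z y < e / 2" by (auto simp: S_def)
      show "j \<in> A \<union> {..m}"
      proof (cases "j \<le> m")
        case False
        then have "1 / real (Suc j) \<le> 1 / real (Suc m)" by (intro divide_left_mono) auto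
        then have "dist z x < e" using x kr(3)[OF x(1)] m dist_triangle2[of z x y] by simp
        then show ?thesis using x by (auto simp: A_def)
      qed simp
    qed
    then have "finite {j \<in> I. S j \<inter> ball z (e / 2) \<noteq> {}}" using \<open>finite A\<close> by (auto intro: finite_subset)
    then show ?thesis using e(1) by (intro exI[of _ "e / 2"]) auto
  qed
  obtain h where h: "inj h" "\<And>x y. norm (h x - h y) \<le> 2 * norm (x - y)"
    "\<And>x. x \<in> \<Omega> \<Longrightarrow> h x \<in> \<Omega>" "\<And>x. x \<in> \<Omega> \<Longrightarrow> norm (x - h x) \<le> \<tau> (h x)"
    "\<And>x. x \<notin> (\<Union>j\<in>I. S j) \<Longrightarrow> h x = x"
    "\<And>x. x \<in> \<Omega> \<Longrightarrow> \<exists>D. has_strict_derivative h D x \<and> (\<forall>j\<in>I. h x \<in> F j \<longrightarrow> (\<forall>v. a j \<bullet> D v = 0))"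
  proof (rule facet_collapsing_map_exists[OF F(1-4) kr(2) S_eq S\<Omega> S_fin
          continuous_on_subset[OF \<tau>(1) subset_UNIV] \<tau>pos \<tau>(3)], assumption+, goal_cases)
    case (1 h)
    show ?case by (rule 1(1)[OF 1(2-7)])
  qed
  obtain D where D: "\<And>x. x \<in> \<Omega> \<Longrightarrow> has_strict_derivative h (D x) x"
    "\<And>x j v. x \<in> \<Omega> \<Longrightarrow> j \<in> I \<Longrightarrow> h x \<in> F j \<Longrightarrow> a j \<bullet> D x v = 0" using h(6) by metis
  have D_le: "norm (D x v) \<le> 2 * norm v" if "x \<in> \<Omega>" for x v
    by (rule has_strict_derivative_Lipschitz_bound[OF D(1)[OF that] h(2)])
  \<comment> \<open>Any simplex through \<open>h x\<close> will do: on the range of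
    \<open>D x\<close> the linear parts of all of them coincide.\<close>
  obtain \<sigma> where \<sigma>: "\<And>x. x \<in> \<Omega> \<Longrightarrow> \<sigma> x \<in> \<T>" "\<And>x. x \<in> \<Omega> \<Longrightarrow> h x \<in> \<sigma> x"
  proof -
    have "\<forall>x\<in>\<Omega>. \<exists>T. T \<in> \<T> \<and> h x \<in> T" using h(3) \<Omega>_eq by blast
    from bchoice[OF this] show ?thesis using that by blast
  qed
  have hclose: "norm (x - h x) \<le> 2 * \<tau> x" if "x \<in> \<Omega>" for x by (rule \<tau>(5)[OF h(4)[OF that]])

  \<comment> \<open>The composition: strict derivative, injectivity and uniform distance to
    \<open>f\<close>\<close>
  define g where "g x = f (h x)" for x
  have g_sd: "has_strict_derivative g (\<lambda>v. M (\<sigma> x) *v D x v) x" if x: "x \<in> \<Omega>" for x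
  proof -
    obtain e L where eL: "e > 0" "\<And>y z. y \<in> ball (h x) e \<Longrightarrow> z \<in> ball (h x) e \<Longrightarrow> norm (f y - f z) \<le> L * norm (y - z)"
      "L \<ge> 0"
      "\<And>y w. y \<in> ball (h x) e \<Longrightarrow> norm w < e \<Longrightarrow>
        (\<forall>T\<in>\<T>. h x \<in> T \<longrightarrow> (\<forall>(a, b)\<in>H T. a \<bullet> h x = b \<longrightarrow> a \<bullet> w = 0)) \<Longrightarrow> f (y + w) = f y + M (\<sigma> x) *v w"
    proof (rule piecewise_affine_local_structure[where H = H and M = M and c = c,
          OF assms(2) \<Omega>_eq fin\<T>[OF h(3)[OF x]] H(1,2) M \<sigma>[OF x]], assumption+, goal_cases)
      case (1 e L)
      show ?case by (rule 1(1)[OF 1(2-5)])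
    qed
    \<comment> \<open>The active inequality belongs to \<open>P\<close>, because \<open>h x\<close>
      itself shows that its hyperplane meets the simplex.\<close>
    have act: "a' \<bullet> w = 0" if w: "w \<in> range (D x)" and T: "T \<in> \<T>" "h x \<in> T" "(a', b') \<in> H T" "a' \<bullet> h x = b'" for w T a' b'
    proof -
      have p: "(T, a', b') \<in> P" using T by (auto simp: P_def)
      define j where "j = to_nat_on P (T, a', b')"
      have j: "j \<in> I" "q j = (T, a', b')" using p qI by (auto simp: j_def I_def)
      then have "h x \<in> F j" "a j = a'" using T by (auto simp: F_def a_def)
      then show ?thesis using D(2)[OF x j(1)] w by auto
    qed
    show ?thesis unfolding g_def
    proof (rule strict_derivative_collapsed_piecewise_affine[OF eL(1-3) _ D(1)[OF x] h(2)])
      fix y w assume yw: "y \<in> ball (h x) e" "norm w < e" "w \<in> range (D x)"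
      show "f (y + w) = f y + M (\<sigma> x) *v w" by (rule eL(4)[OF yw(1,2)]) (use act[OF yw(3)] in blast)
    qed
  qed
  have g_C1: "C1_on \<Omega> g" by (rule strictly_differentiable_imp_C1_on[OF assms(2) g_sd])
  have g_inj: "inj_on g \<Omega>"
    unfolding g_def using f_inj h(1,3) by (intro inj_onI) (metis injD inj_onD)
  have g_cont: "continuous_on \<Omega> g"
    using has_strict_derivative_imp_isCont[OF g_sd] by (intro continuous_at_imp_continuous_on) blast
  have gf: "norm (g x - f x) \<le> \<epsilon> / 2" if "x \<in> \<Omega>" for x
    using \<tau>close[OF that hclose[OF that]] by (simp add: U_def g_def norm_minus_commute)
  have Linf: "Linfty_norm (lebesgue_on \<Omega>) (\<lambda>x. g x - f x) < ennreal \<epsilon>"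
  proof -
    have "(\<lambda>x. g x - f x) \<in> borel_measurable (lebesgue_on \<Omega>)"
      by (intro continuous_imp_measurable_on_sets_lebesgue continuous_intros g_cont f_cont \<Omega>l)
    then have "Linfty_norm (lebesgue_on \<Omega>) (\<lambda>x. g x - f x) \<le> ennreal (\<epsilon> / 2)"
      unfolding Linfty_norm_def using gf by (intro esssup_I AE_I2) (auto intro: ennreal_leI)
    also have "\<dots> < ennreal \<epsilon>" using \<epsilon> by (simp add: ennreal_less_iff)
    finally show ?thesis .
  qed

  \<comment> \<open>Pointwise comparison of the two Jacobians off a null set\<close>
  define N0 where "N0 = (\<Union>T\<in>\<T>. frontier T)"
  have N0: "negligible N0" unfolding N0_def
    using count\<T> poly by (intro negligible_countable_Union) (auto intro!: negligible_convex_frontier polytope_imp_convex)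
  have int: "\<exists>T\<in>\<T>. x \<in> interior T" if "x \<in> \<Omega>" "x \<notin> N0" for x
  proof -
    from that(1) \<Omega>_eq obtain T where T: "T \<in> \<T>" "x \<in> T" by blast
    then have "x \<notin> frontier T" using that(2) by (auto simp: N0_def)
    then have "x \<in> interior T" using T(2) closure_subset[of T] by (auto simp: frontier_def)
    then show ?thesis using T(1) by blast
  qed
  have f_der: "(f has_derivative (*v) (M T)) (at x)" if T: "T \<in> \<T>" "x \<in> interior T" for x T
  proof -
    have "((\<lambda>x. M T *v x + c T) has_derivative (*v) (M T)) (at x)"
      by (intro has_derivative_add_const bounded_linear_imp_has_derivative matrix_vector_mul_bounded_linear)
    then show ?thesis
      by (rule has_derivative_transform_within_open[of _ _ _ _ "interior T"])
        (use T interior_subset[of T] M[OF T(1)] in auto)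
  qed
  have Jf: "Jac f x = M T" if "T \<in> \<T>" "x \<in> interior T" for x T
    using Jac_eq_matrix[OF f_der[OF that]] by simp
  have Jg: "Jac g x = matrix (\<lambda>v. M (\<sigma> x) *v D x v)" if "x \<in> \<Omega>" for x
    by (rule Jac_eq_matrix[OF has_strict_derivative_imp_has_derivative[OF g_sd[OF that]]])
  define \<kappa> where "\<kappa> j = (if j \<in> I then 3 * ?n2 * k j else 0)" for j
  have bound_in: "norm (Jac g x - Jac f x) \<le> \<kappa> j" if x: "x \<in> \<Omega>" "x \<notin> N0" and j: "x \<in> S j" for x j
  proof -
    have jI: "j \<in> I" "x \<in> (\<Union>x\<in>F j. cball x (r j))" using j by (auto simp: S_def split: if_splits)
    obtain T where T: "T \<in> \<T>" "x \<in> interior T" using int[OF x] by blast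
    have xT: "x \<in> T" using T(2) interior_subset by blast
    \<comment> \<open>The bound is used twice: here with the point \<open>x\<close> itself, below
      with \<open>h x\<close> and the simplex \<open>\<sigma> x\<close>.\<close>
    have "norm (M T *v v) \<le> k j * norm v" for v
      using kr(6)[OF jI, of x T] \<tau>pos[OF x(1)] T(1) xT by simp
    then have "norm (matrix ((*v) (M T))) \<le> ?n2 * k j" by (rule norm_matrix_le)
    then have 1: "norm (Jac f x) \<le> ?n2 * k j" by (simp add: Jf[OF T])
    have "norm (M (\<sigma> x) *v D x v) \<le> (2 * k j) * norm v" for v
    proof -
      have "norm (M (\<sigma> x) *v D x v) \<le> k j * norm (D x v)"
        by (rule kr(6)[OF jI hclose[OF x(1)] \<sigma>[OF x(1)]])
      also have "\<dots> \<le> k j * (2 * norm v)" using kr(1)[OF jI(1)] by (intro mult_left_mono D_le x) auto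
      finally show ?thesis by simp
    qed
    then have 2: "norm (Jac g x) \<le> ?n2 * (2 * k j)" unfolding Jg[OF x(1)] by (rule norm_matrix_le)
    show ?thesis using norm_triangle_ineq4[of "Jac g x" "Jac f x"] 1 2 by (simp add: \<kappa>_def jI)
  qed
  have bound_out: "Jac g x = Jac f x" if x: "x \<in> \<Omega>" "x \<notin> N0" and out: "\<And>j. x \<notin> S j" for x
  proof -
    obtain T where T: "T \<in> \<T>" "x \<in> interior T" using int[OF x] by blast
    obtain e where e: "e > 0" "finite {j \<in> I. S j \<inter> ball x e \<noteq> {}}" using S_fin[OF x(1)] by blast
    \<comment> \<open>The supports are closed and locally finite, so \<open>x\<close> has a
      neighbourhood missing all of them. There \<open>h\<close> is the identity and \<open>g\<close>
      equals \<open>f\<close>.\<close>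
    define W where "W = ball x e - (\<Union>j\<in>{j \<in> I. S j \<inter> ball x e \<noteq> {}}. S j)"
    have W: "open W" "x \<in> W" unfolding W_def
      using e out compact_imp_closed[OF S_compact] by (auto intro!: open_Diff closed_UN)
    have "g y = f y" if "y \<in> W" for y
    proof -
      have "y \<notin> (\<Union>j\<in>I. S j)" using that unfolding W_def by blast
      then show ?thesis using h(5) by (simp add: g_def)
    qed
    then have "(g has_derivative (*v) (M T)) (at x)"
      using has_derivative_transform_within_open[OF f_der[OF T] W] by simp
    from Jac_eq_matrix[OF this] Jac_eq_matrix[OF f_der[OF T]] show ?thesis by simp
  qed

  \<comment> \<open>Measurability and summation of the norms\<close>
  have Jdiff_meas: "(\<lambda>x. ennreal (norm (Jac g x - Jac f x))) \<in> borel_measurable (lebesgue_on \<Omega>)"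
  proof -
    have "Jac f \<in> borel_measurable (lebesgue_on \<Omega>)"
    proof (rule measurable_piecewise_restrict[of "insert N0 (interior ` \<T>)"])
      show "countable (insert N0 (interior ` \<T>))" using count\<T> by simp
      show "space (lebesgue_on \<Omega>) \<subseteq> \<Union>(insert N0 (interior ` \<T>))" using int by auto
      have N0l: "N0 \<inter> \<Omega> \<in> sets (lebesgue_on \<Omega>)"
        using negligible_imp_sets[OF N0] \<Omega>l by (intro on_\<Omega>) auto
      have Tl: "interior T \<inter> \<Omega> \<in> sets (lebesgue_on \<Omega>)" for T
        using \<Omega>l by (intro on_\<Omega>) (auto simp: sets_completionI_sets)
      show "X \<inter> space (lebesgue_on \<Omega>) \<in> sets (lebesgue_on \<Omega>)" if "X \<in> insert N0 (interior ` \<T>)" for X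
        using that N0l Tl by auto
      show "Jac f \<in> borel_measurable (restrict_space (lebesgue_on \<Omega>) X)" if X: "X \<in> insert N0 (interior ` \<T>)" for X
      proof (cases "X = N0")
        case True
        \<comment> \<open>On the null set the values of \<open>Jac f\<close> are arbitrary;
          completeness of Lebesgue measure makes every preimage measurable.\<close>
        show ?thesis
        proof (rule measurableI)
          fix A :: "(real^'n^'n) set"
          let ?A = "Jac f -` A \<inter> space (restrict_space (lebesgue_on \<Omega>) X)"
          have sub: "?A \<subseteq> N0" "?A \<subseteq> \<Omega>" by (auto simp: True space_restrict_space)
          have "?A \<in> sets lebesgue" by (rule negligible_imp_sets[OF negligible_subset[OF N0 sub(1)]])
          then show "?A \<in> sets (restrict_space (lebesgue_on \<Omega>) X)"
            using sub N0l on_\<Omega>[OF _ sub(2)] unfolding True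
            by (subst sets_restrict_space_iff) (simp_all add: Int_commute)
        qed simp
      next
        case False
        then obtain T where T: "T \<in> \<T>" "X = interior T" using X by auto
        have "(\<lambda>_. M T) \<in> borel_measurable (restrict_space (lebesgue_on \<Omega>) X)" by simp
        then show ?thesis
          by (rule measurable_cong[THEN iffD1, rotated]) (auto simp: space_restrict_space T(2) Jf[OF T(1)])
      qed
    qed
    moreover have "Jac g \<in> borel_measurable (lebesgue_on \<Omega>)"
      using g_C1 \<Omega>l by (intro continuous_imp_measurable_on_sets_lebesgue) (auto simp: C1_on_def)
    ultimately show ?thesis by measurable
  qed
  have S_meas [measurable]: "S j \<in> sets (lebesgue_on \<Omega>)" for j
    using lmeasurable_compact[OF S_compact] S\<Omega> by (intro on_\<Omega>) auto
  have AE_N0: "AE x in lebesgue_on \<Omega>. x \<notin> N0"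
    using N0 \<Omega>l by (subst AE_restrict_space_iff) (auto simp: negligible_iff_null_sets dest: AE_not_in)
  have le_suminf: "u j \<le> suminf u" for u :: "nat \<Rightarrow> ennreal" and j
    using sum_le_suminf[OF summableI, of "{j}" u] by simp
  have fs: "function_space_norm \<rho> (\<lambda>x. Jac g x - Jac f x) < ennreal \<epsilon>"
  proof -
    have "function_space_norm \<rho> (\<lambda>x. Jac g x - Jac f x) \<le> \<rho> (\<lambda>x. \<Sum>j. ennreal (\<kappa> j) * indicator (S j) x)"
      unfolding function_space_norm_def
    proof (rule norm_mono[OF Jdiff_meas])
      show "(\<lambda>x. \<Sum>j. ennreal (\<kappa> j) * indicator (S j) x) \<in> borel_measurable (lebesgue_on \<Omega>)"
        by measurable
      show "AE x in lebesgue_on \<Omega>. ennreal (norm (Jac g x - Jac f x)) \<le> (\<Sum>j. ennreal (\<kappa> j) * indicator (S j) x)"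
        using AE_N0 AE_space
      proof eventually_elim
        case (elim x)
        then have x: "x \<in> \<Omega>" "x \<notin> N0" by auto
        show ?case
        proof (cases "\<exists>j. x \<in> S j")
          case True
          \<comment> \<open>Supports may overlap; one support containing \<open>x\<close> already
            gives the bound, and the other terms are nonnegative.\<close>
          then obtain j where j: "x \<in> S j" by blast
          have "ennreal (norm (Jac g x - Jac f x)) \<le> ennreal (\<kappa> j) * indicator (S j) x"
            using bound_in[OF x j] j by (simp add: ennreal_leI)
          also have "\<dots> \<le> (\<Sum>j. ennreal (\<kappa> j) * indicator (S j) x)"
            by (rule le_suminf)
          finally show ?thesis .
        next
          case False
          then show ?thesis using bound_out[OF x] by simp
        qed
      qed
    qed
    also have "\<dots> \<le> (\<Sum>j. \<rho> (\<lambda>x. ennreal (\<kappa> j) * indicator (S j) x))"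
      by (intro norm_suminf_le) measurable
    also have "\<dots> \<le> (\<Sum>j. ennreal (\<epsilon> * (1/2) ^ (j + 2)))"
    proof (intro suminf_le summableI)
      fix j
      show "\<rho> (\<lambda>x. ennreal (\<kappa> j) * indicator (S j) x) \<le> ennreal (\<epsilon> * (1/2) ^ (j + 2))"
      proof (cases "j \<in> I")
        case True
        have "\<rho> (\<lambda>x. ennreal (\<kappa> j) * indicator (S j) x) = ennreal (\<kappa> j) * \<rho> (indicator (S j))"
          using S_meas[of j] kr(1)[OF True] True by (intro norm_scale) (auto simp: \<kappa>_def)
        also have "\<dots> \<le> ennreal (\<epsilon> * (1/2) ^ (j + 2))"
          using kr(5)[OF True] True by (simp add: S_def \<kappa>_def)
        finally show ?thesis .
      next
        case False
        then show ?thesis by (simp add: \<kappa>_def norm_zero)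
      qed
    qed
    also have "\<dots> = ennreal (\<epsilon> * (1/2))"
      using sums_mult[OF sums_half_powers, of \<epsilon>] \<epsilon>
      by (intro suminf_ennreal_eq) auto
    also have "\<dots> < ennreal \<epsilon>" using \<epsilon> by (simp add: ennreal_less_iff)
    finally show ?thesis .
  qed
  show "\<exists>g. inj_on g \<Omega> \<and> C1_on \<Omega> g \<and> Linfty_norm (lebesgue_on \<Omega>) (\<lambda>x. g x - f x) < ennreal \<epsilon> \<and>
       function_space_norm \<rho> (\<lambda>x. Jac g x - Jac f x) < ennreal \<epsilon>"
    using g_inj g_C1 Linf fs by blast
qed

end
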